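(* Let $M$ be a smooth manifold and let $X$ be a smooth CW complex. Then for every continuous map $f : M \to X$ there exist a smooth map $g : M \to X$ and a continuous homotopy from $f$ to $g$. Moreover, if $f$ is smooth on a closed subset $A \subset M$, and in addition $M$ is compact or $X$ is of finite dimension, then the continuous homotopy can be taken to be relative to $A$.
   Context: A diffeological space is a set $X$ together with, for every $n\ge 0$ and every open set $U\subset\mathbb{R}^n$, a set $\mathcal{D}_X(U)$ of maps $U\to X$ (called plots), such that: all constant maps are plots; if $P:U\to X$ is a plot and $\phi:V\to U$ is a smooth map between open subsets of Euclidean spaces, then $P\circ\phi$ is a plot; and if $P:U\to X$ is a map and $U$ has an open covering $\{U_\alpha\}$ with every $P|_{U_\alpha}$ a plot, then $P$ is a plot. A map $f:X\to Y$ of diffeological spaces is smooth if $f\circ P$ is a plot of $Y$ for every plot $P$ of $X$. The category $\mathsf{Diffeology}$ of diffeological spaces and smooth maps is complete and cocomplete. Smooth manifolds are assumed paracompact and are regarded as diffeological spaces whose plots are the ordinary smooth maps; spheres $S^n$ and closed disks $D^{n+1}$ carry their standard diffeologies as subsets of $\mathbb{R}^{n+1}$. The $D$-topology of a diffeological space $X$ is the finest topology making all plots continuous; $D(X)$ denotes $X$ with this topology. A smooth CW complex $X$ is the colimit in $\mathsf{Diffeology}$ of skeleta $\{X_n\}_{n\ge0}$ defined inductively: $X_0$ is a discrete set with the discrete diffeology; for each $n\ge0$ there is a smooth attaching map $h_n: S_n=\coprod_\alpha S^n_\alpha\to X_n$ from a disjoint union of $n$-spheres, and $X_{n+1}=X_n\cup_{h_n}\coprod_\alpha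 D^{n+1}_\alpha$ is the pushout in $\mathsf{Diffeology}$ of $h_n$ and the natural inclusion $S_n\hookrightarrow\coprod_\alpha D^{n+1}_\alpha$. It is of finite dimension if $X=X_d$ for some $d$. For diffeological spaces $X,Y$, a continuous map $f:X\to Y$ means a continuous map $D(X)\to D(Y)$. A continuous homotopy from $f$ to $g$, where $f,g:X\to Y$ are continuous maps, is a continuous map $H:D(X\times\mathbb{R})\to D(Y)$ such that for some $0<\varepsilon\ll1$ one has $H(x,t)=f(x)$ for $t\le\varepsilon$ and $H(x,t)=g(x)$ for $t\ge1-\varepsilon$. It is relative to $A\subset X$ if $H(x,t)=f(x)$ for all $x\in A$ and $t\in\mathbb{R}$. A map $f$ from a manifold $M$ is smooth on a closed subset $A\subset M$ if $f$ is smooth on some open subset of $M$ containing $A$. *)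

theory Defs
  imports "HOL-Analysis.Analysis"
begin

section \<open>Smooth maps between open subsets of Euclidean spaces\<close>

text \<open>
  Since the dimension of the domain of a plot varies, \<open>\<real>\<^sup>n\<close> is the library's
  \<^const>\<open>Euclidean_space\<close>: the sequences \<open>x :: nat \<Rightarrow> real\<close> with \<open>x i = 0\<close> for \<open>i \<ge> n\<close>.
\<close>

text \<open>
  Class \<open>C\<^sup>k\<close> by iterated partial derivatives. For open \<open>U\<close>, the derivative at \<open>x \<in> U\<close> in
  direction \<open>i < n\<close> only depends on the values of \<open>f\<close> on \<open>U\<close>.
\<close>

primrec Ck_fun :: "nat \<Rightarrow> nat \<Rightarrow> (nat \<Rightarrow> real) set \<Rightarrow> ((nat \<Rightarrow> real) \<Rightarrow> real) \<Rightarrow> bool" where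
  "Ck_fun 0 n U f \<longleftrightarrow> continuous_map (subtopology (Euclidean_space n) U) euclideanreal f"
| "Ck_fun (Suc k) n U f \<longleftrightarrow>
     continuous_map (subtopology (Euclidean_space n) U) euclideanreal f \<and>
     (\<forall>i<n. \<exists>f'. (\<forall>x\<in>U. ((\<lambda>t. f (x(i := t))) has_real_derivative f' x) (at (x i))) \<and>
                 Ck_fun k n U f')"

definition smooth_fun :: "nat \<Rightarrow> (nat \<Rightarrow> real) set \<Rightarrow> ((nat \<Rightarrow> real) \<Rightarrow> real) \<Rightarrow> bool" where
  "smooth_fun n U f \<longleftrightarrow> openin (Euclidean_space n) U \<and> (\<forall>k. Ck_fun k n U f)"

definition smooth_eucl ::
  "nat \<Rightarrow> (nat \<Rightarrow> real) set \<Rightarrow> nat \<Rightarrow> (nat \<Rightarrow> real) set \<Rightarrow> ((nat \<Rightarrow> real) \<Rightarrow> (nat \<Rightarrow> real)) \<Rightarrow> bool" where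
  "smooth_eucl m V n U \<phi> \<longleftrightarrow>
     openin (Euclidean_space m) V \<and> U \<subseteq> topspace (Euclidean_space n) \<and> \<phi> \<in> V \<rightarrow> U \<and>
     (\<forall>i<n. smooth_fun m V (\<lambda>x. \<phi> x i))"

lemma smooth_eucl_continuous_map:
  assumes "smooth_eucl m V n U \<phi>"
  shows "continuous_map (subtopology (Euclidean_space m) V) (Euclidean_space n) \<phi>"
proof -
  have V: "V \<subseteq> topspace (Euclidean_space m)"
    using assms by (simp add: smooth_eucl_def openin_subset)
  have "continuous_map (subtopology (Euclidean_space m) V) euclideanreal (\<lambda>x. \<phi> x i)" if "i < n" for i
    using assms that unfolding smooth_eucl_def smooth_fun_def by (metis Ck_fun.simps(1))
  then have "continuous_map (subtopology (Euclidean_space m) V) (Euclidean_space n)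
               (\<lambda>x i. if i < n then \<phi> x i else 0)"
    by (simp add: continuous_map_componentwise_Euclidean_space)
  then show ?thesis
  proof (rule continuous_map_eq)
    fix x assume "x \<in> topspace (subtopology (Euclidean_space m) V)"
    then have "\<phi> x \<in> topspace (Euclidean_space n)"
      using assms V by (auto simp: smooth_eucl_def)
    then show "(\<lambda>i. if i < n then \<phi> x i else 0) = \<phi> x"
      by (auto simp: topspace_Euclidean_space fun_eq_iff)
  qed
qed

lemma smooth_eucl_openin_vimage:
  assumes "smooth_eucl m V n U \<phi>" "openin (Euclidean_space n) W"
  shows "openin (Euclidean_space m) {x \<in> V. \<phi> x \<in> W}"
proof -
  have V: "openin (Euclidean_space m) V" "V \<subseteq> topspace (Euclidean_space m)"
    using assms by (simp_all add: smooth_eucl_def openin_subset)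
  have "openin (subtopology (Euclidean_space m) V)
          {x \<in> topspace (subtopology (Euclidean_space m) V). \<phi> x \<in> W}"
    using smooth_eucl_continuous_map[OF assms(1)] assms(2) openin_continuous_map_preimage by blast
  moreover have "topspace (subtopology (Euclidean_space m) V) = V"
    using V by auto
  ultimately show ?thesis
    using V(1) by (metis openin_trans_full)
qed

lemma Ck_fun_subset:
  assumes "Ck_fun k n U f" "V \<subseteq> U"
  shows "Ck_fun k n V f"
  using assms
proof (induction k arbitrary: f)
  case 0
  then show ?case
    by (auto intro: continuous_map_from_subtopology_mono)
next
  case (Suc k)
  then show ?case
    by (auto intro: continuous_map_from_subtopology_mono) (metis subsetD)
qed

lemma smooth_eucl_subset:
  assumes "smooth_eucl m V n U \<phi>" "openin (Euclidean_space m) V'" "V' \<subseteq> V"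
    and "U' \<subseteq> U" "\<phi> \<in> V' \<rightarrow> U'"
  shows "smooth_eucl m V' n U' \<phi>"
  using assms(1,2,4,5) Ck_fun_subset[OF _ assms(3)] unfolding smooth_eucl_def smooth_fun_def
  by (meson subset_trans)


section \<open>Diffeological spaces\<close>

text \<open>
  \<open>plots X n U\<close> are the plots \<open>U \<rightarrow> X\<close> for open \<open>U \<subseteq> \<real>\<^sup>n\<close>. Functions are total, so
  \<open>plots X n U\<close> is required to be closed under changing a function outside \<open>U\<close>
  (last clause of \<open>diffeological_space\<close>) and empty if \<open>U\<close> is not open.
\<close>

record 'a diffeology =
  points :: "'a set"
  plots :: "nat \<Rightarrow> (nat \<Rightarrow> real) set \<Rightarrow> ((nat \<Rightarrow> real) \<Rightarrow> 'a) set"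

definition diffeological_space :: "'a diffeology \<Rightarrow> bool" where
  "diffeological_space X \<longleftrightarrow>
     (\<forall>n U. \<forall>P\<in>plots X n U. openin (Euclidean_space n) U \<and> P \<in> U \<rightarrow> points X) \<and>
     (\<forall>n U. \<forall>x\<in>points X. openin (Euclidean_space n) U \<longrightarrow> (\<lambda>_. x) \<in> plots X n U) \<and>
     (\<forall>n U m V \<phi>. \<forall>P\<in>plots X n U. smooth_eucl m V n U \<phi> \<longrightarrow> P \<circ> \<phi> \<in> plots X m V) \<and>
     (\<forall>n U P \<U>. P \<in> U \<rightarrow> points X \<and> \<Union>\<U> = U \<and>
        (\<forall>W\<in>\<U>. openin (Euclidean_space n) W \<and> P \<in> plots X n W) \<longrightarrow> P \<in> plots X n U) \<and>
     (\<forall>n U P Q. P \<in> plots X n U \<and> (\<forall>x\<in>U. P x = Q x) \<longrightarrow> Q \<in> plots X n U)"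

definition smooth_map :: "'a diffeology \<Rightarrow> 'b diffeology \<Rightarrow> ('a \<Rightarrow> 'b) \<Rightarrow> bool" where
  "smooth_map X Y f \<longleftrightarrow>
     f \<in> points X \<rightarrow> points Y \<and> (\<forall>n U. \<forall>P\<in>plots X n U. f \<circ> P \<in> plots Y n U)"

definition diffeomorphism :: "'a diffeology \<Rightarrow> 'b diffeology \<Rightarrow> ('a \<Rightarrow> 'b) \<Rightarrow> bool" where
  "diffeomorphism X Y f \<longleftrightarrow>
     smooth_map X Y f \<and>
     (\<exists>g. smooth_map Y X g \<and> (\<forall>x\<in>points X. g (f x) = x) \<and> (\<forall>y\<in>points Y. f (g y) = y))"

definition D_open :: "'a diffeology \<Rightarrow> 'a set \<Rightarrow> bool" where
  "D_open X W \<longleftrightarrow>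
     W \<subseteq> points X \<and>
     (\<forall>n U. \<forall>P\<in>plots X n U. openin (Euclidean_space n) {x \<in> U. P x \<in> W})"

definition D_topology :: "'a diffeology \<Rightarrow> 'a topology" where
  "D_topology X = topology (D_open X)"

definition D_continuous :: "'a diffeology \<Rightarrow> 'b diffeology \<Rightarrow> ('a \<Rightarrow> 'b) \<Rightarrow> bool" where
  "D_continuous X Y f \<longleftrightarrow> continuous_map (D_topology X) (D_topology Y) f"

lemma istopology_D_open: "istopology (D_open X)"
  unfolding istopology_def
proof (intro conjI allI impI)
  fix S T assume ST: "D_open X S" "D_open X T"
  have "openin (Euclidean_space n) {x \<in> U. P x \<in> S \<inter> T}" if "P \<in> plots X n U" for n U P
  proof -
    have "{x \<in> U. P x \<in> S \<inter> T} = {x \<in> U. P x \<in> S} \<inter> {x \<in> U. P x \<in> T}"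
      by auto
    then show ?thesis
      using ST that by (auto simp: D_open_def)
  qed
  then show "D_open X (S \<inter> T)"
    using ST by (auto simp: D_open_def)
next
  fix \<K> assume K: "\<forall>K\<in>\<K>. D_open X K"
  have "openin (Euclidean_space n) {x \<in> U. P x \<in> \<Union>\<K>}" if "P \<in> plots X n U" for n U P
  proof -
    have "{x \<in> U. P x \<in> \<Union>\<K>} = \<Union>((\<lambda>K. {x \<in> U. P x \<in> K}) ` \<K>)"
      by auto
    then show ?thesis
      using K that by (auto simp: D_open_def)
  qed
  then show "D_open X (\<Union>\<K>)"
    using K by (auto simp: D_open_def)
qed

lemma openin_D_topology: "openin (D_topology X) W \<longleftrightarrow> D_open X W"
  by (simp add: D_topology_def istopology_D_open topology_inverse')


section \<open>Constructions\<close>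

definition euclidean_diff :: "nat \<Rightarrow> (nat \<Rightarrow> real) diffeology" where
  "euclidean_diff n =
     \<lparr>points = topspace (Euclidean_space n),
      plots = \<lambda>m U. {P. smooth_eucl m U n (topspace (Euclidean_space n)) P}\<rparr>"

definition real_diff :: "real diffeology" where
  "real_diff = \<lparr>points = UNIV, plots = \<lambda>m U. {P. smooth_fun m U P}\<rparr>"

definition sub_diff :: "'a diffeology \<Rightarrow> 'a set \<Rightarrow> 'a diffeology" where
  "sub_diff X S =
     \<lparr>points = points X \<inter> S, plots = \<lambda>n U. {P \<in> plots X n U. P \<in> U \<rightarrow> S}\<rparr>"

definition prod_diff :: "'a diffeology \<Rightarrow> 'b diffeology \<Rightarrow> ('a \<times> 'b) diffeology" where
  "prod_diff X Y =
     \<lparr>points = points X \<times> points Y,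
      plots = \<lambda>n U. {P. fst \<circ> P \<in> plots X n U \<and> snd \<circ> P \<in> plots Y n U}\<rparr>"

text \<open>
  \<open>local_plots S F\<close>: the maps to \<open>S\<close> that locally belong to \<open>F\<close>. The discrete, coproduct and
  quotient diffeologies are all of this form.
\<close>

definition local_plots ::
  "'a set \<Rightarrow> (nat \<Rightarrow> (nat \<Rightarrow> real) set \<Rightarrow> ((nat \<Rightarrow> real) \<Rightarrow> 'a) \<Rightarrow> bool) \<Rightarrow>
   nat \<Rightarrow> (nat \<Rightarrow> real) set \<Rightarrow> ((nat \<Rightarrow> real) \<Rightarrow> 'a) set" where
  "local_plots S F n U =
     {P. openin (Euclidean_space n) U \<and> P \<in> U \<rightarrow> S \<and>
         (\<forall>x\<in>U. \<exists>W. openin (Euclidean_space n) W \<and> x \<in> W \<and> W \<subseteq> U \<and> F n W P)}"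

definition discrete_diff :: "'a set \<Rightarrow> 'a diffeology" where
  "discrete_diff S =
     \<lparr>points = S, plots = local_plots S (\<lambda>n W P. \<exists>s\<in>S. \<forall>y\<in>W. P y = s)\<rparr>"

definition sum_diff :: "'a diffeology \<Rightarrow> 'b diffeology \<Rightarrow> ('a + 'b) diffeology" where
  "sum_diff X Y =
     \<lparr>points = points X <+> points Y,
      plots = local_plots (points X <+> points Y)
        (\<lambda>n W P. (\<exists>Q\<in>plots X n W. \<forall>y\<in>W. P y = Inl (Q y)) \<or>
                 (\<exists>Q\<in>plots Y n W. \<forall>y\<in>W. P y = Inr (Q y)))\<rparr>"

definition coprod_diff :: "'i set \<Rightarrow> ('i \<Rightarrow> 'a diffeology) \<Rightarrow> ('i \<times> 'a) diffeology" where
  "coprod_diff J X =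
     \<lparr>points = (SIGMA i:J. points (X i)),
      plots = local_plots (SIGMA i:J. points (X i))
        (\<lambda>n W P. \<exists>i\<in>J. \<exists>Q\<in>plots (X i) n W. \<forall>y\<in>W. P y = (i, Q y))\<rparr>"

text \<open>\<open>equiv_gen S R\<close> is the equivalence relation on \<open>S\<close> generated by \<open>R \<subseteq> S \<times> S\<close>.\<close>

definition equiv_gen :: "'a set \<Rightarrow> ('a \<times> 'a) set \<Rightarrow> ('a \<times> 'a) set" where
  "equiv_gen S R = (R \<union> R\<inverse>)\<^sup>* \<inter> S \<times> S"

definition quot_proj :: "'a diffeology \<Rightarrow> ('a \<times> 'a) set \<Rightarrow> 'a \<Rightarrow> 'a set" where
  "quot_proj X R x = equiv_gen (points X) R `` {x}"

definition quot_diff :: "'a diffeology \<Rightarrow> ('a \<times> 'a) set \<Rightarrow> 'a set diffeology" where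
  "quot_diff X R =
     \<lparr>points = points X // equiv_gen (points X) R,
      plots = local_plots (points X // equiv_gen (points X) R)
        (\<lambda>n W P. \<exists>Q\<in>plots X n W. \<forall>y\<in>W. P y = quot_proj X R (Q y))\<rparr>"


lemma points_sum_diff [simp]: "points (sum_diff X Y) = points X <+> points Y"
  by (simp add: sum_diff_def)

lemma points_coprod_diff [simp]: "points (coprod_diff J X) = (SIGMA i:J. points (X i))"
  by (simp add: coprod_diff_def)

lemma points_quot_diff [simp]: "points (quot_diff X R) = points X // equiv_gen (points X) R"
  by (simp add: quot_diff_def)


subsection \<open>Diffeology axioms for the constructed spaces\<close>

lemma diffeological_spaceD:
  assumes "diffeological_space X"
  shows "P \<in> plots X n U \<Longrightarrow> openin (Euclidean_space n) U"
    and "P \<in> plots X n U \<Longrightarrow> P \<in> U \<rightarrow> points X"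
    and "c \<in> points X \<Longrightarrow> openin (Euclidean_space n) U \<Longrightarrow> (\<lambda>_. c) \<in> plots X n U"
    and "P \<in> plots X n U \<Longrightarrow> smooth_eucl m V n U \<phi> \<Longrightarrow> P \<circ> \<phi> \<in> plots X m V"
    and "P \<in> plots X n U \<Longrightarrow> (\<And>x. x \<in> U \<Longrightarrow> P x = Q x) \<Longrightarrow> Q \<in> plots X n U"
proof -
  note X = assms[unfolded diffeological_space_def]
  show "P \<in> plots X n U \<Longrightarrow> openin (Euclidean_space n) U" "P \<in> plots X n U \<Longrightarrow> P \<in> U \<rightarrow> points X"
    using conjunct1[OF X] by blast+
  show "c \<in> points X \<Longrightarrow> openin (Euclidean_space n) U \<Longrightarrow> (\<lambda>_. c) \<in> plots X n U"
    using conjunct1[OF conjunct2[OF X]] by blast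
  show "P \<in> plots X n U \<Longrightarrow> smooth_eucl m V n U \<phi> \<Longrightarrow> P \<circ> \<phi> \<in> plots X m V"
    using conjunct1[OF conjunct2[OF conjunct2[OF X]]] by blast
  show "P \<in> plots X n U \<Longrightarrow> (\<And>x. x \<in> U \<Longrightarrow> P x = Q x) \<Longrightarrow> Q \<in> plots X n U"
    using conjunct2[OF conjunct2[OF conjunct2[OF conjunct2[OF X]]]] by blast
qed

lemma diffeological_space_local:
  assumes X: "diffeological_space X"
    and loc: "\<And>x. x \<in> U \<Longrightarrow> \<exists>W. openin (Euclidean_space n) W \<and> x \<in> W \<and> W \<subseteq> U \<and> P \<in> plots X n W"
  shows "P \<in> plots X n U"
proof -
  let ?\<U> = "{W. openin (Euclidean_space n) W \<and> W \<subseteq> U \<and> P \<in> plots X n W}"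
  have "\<Union>?\<U> = U"
    using loc by blast
  moreover have "P \<in> U \<rightarrow> points X"
    using loc diffeological_spaceD(2)[OF X] by blast
  moreover have "\<forall>W\<in>?\<U>. openin (Euclidean_space n) W \<and> P \<in> plots X n W"
    by blast
  ultimately show ?thesis
    using conjunct1[OF conjunct2[OF conjunct2[OF conjunct2[OF X[unfolded diffeological_space_def]]]]]
    by blast
qed

lemma diffeological_space_cover:
  assumes "diffeological_space X" "\<Union>\<U> = U"
    and "\<And>W. W \<in> \<U> \<Longrightarrow> openin (Euclidean_space n) W \<and> P \<in> plots X n W"
  shows "P \<in> plots X n U"
  using assms(2,3) by (intro diffeological_space_local[OF assms(1)]) (metis UnionE Union_upper)

lemma diffeological_space_local_plots:
  assumes const: "\<And>n W c. c \<in> S \<Longrightarrow> openin (Euclidean_space n) W \<Longrightarrow> F n W (\<lambda>_. c)"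
    and comp: "\<And>n W P m V \<phi>. F n W P \<Longrightarrow> openin (Euclidean_space n) W \<Longrightarrow>
                 smooth_eucl m V n W \<phi> \<Longrightarrow> F m V (P \<circ> \<phi>)"
    and cong: "\<And>n W P Q. F n W P \<Longrightarrow> (\<And>x. x \<in> W \<Longrightarrow> P x = Q x) \<Longrightarrow> F n W Q"
  shows "diffeological_space \<lparr>points = S, plots = local_plots S F\<rparr>"
  unfolding diffeological_space_def diffeology.simps
proof (intro conjI allI ballI impI; (elim conjE)?)
  fix n U P assume "P \<in> local_plots S F n U"
  then show "openin (Euclidean_space n) U" "P \<in> U \<rightarrow> S"
    by (simp_all add: local_plots_def)
next
  fix n U c assume "c \<in> S" "openin (Euclidean_space n) U"
  then show "(\<lambda>_. c) \<in> local_plots S F n U"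
    using const by (auto simp: local_plots_def)
next
  fix n U m V \<phi> P assume P: "P \<in> local_plots S F n U" and \<phi>: "smooth_eucl m V n U \<phi>"
  have "\<exists>W. openin (Euclidean_space m) W \<and> x \<in> W \<and> W \<subseteq> V \<and> F m W (P \<circ> \<phi>)" if x: "x \<in> V" for x
  proof -
    have "\<phi> x \<in> U"
      using x \<phi> by (auto simp: smooth_eucl_def)
    then obtain W where W: "openin (Euclidean_space n) W" "\<phi> x \<in> W" "W \<subseteq> U" "F n W P"
      using P by (auto simp: local_plots_def)
    let ?W' = "{x \<in> V. \<phi> x \<in> W}"
    have o: "openin (Euclidean_space m) ?W'"
      using smooth_eucl_openin_vimage[OF \<phi> W(1)] .
    have "smooth_eucl m ?W' n W \<phi>"
      using smooth_eucl_subset[OF \<phi> o _ W(3)] by auto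
    then have "F m ?W' (P \<circ> \<phi>)"
      using comp W by blast
    then show ?thesis
      using o x W(2) by blast
  qed
  moreover have "openin (Euclidean_space m) V" "P \<circ> \<phi> \<in> V \<rightarrow> S"
    using P \<phi> by (auto simp: smooth_eucl_def local_plots_def Pi_iff)
  ultimately show "P \<circ> \<phi> \<in> local_plots S F m V"
    by (simp add: local_plots_def)
next
  fix n U P \<U>
  assume P: "P \<in> U \<rightarrow> S" and U: "\<Union>\<U> = U"
    and W: "\<forall>W\<in>\<U>. openin (Euclidean_space n) W \<and> P \<in> local_plots S F n W"
  have "openin (Euclidean_space n) U"
    using U W by blast
  moreover have "\<exists>W. openin (Euclidean_space n) W \<and> x \<in> W \<and> W \<subseteq> U \<and> F n W P" if x: "x \<in> U" for x
  proof -
    obtain V where V: "V \<in> \<U>" "x \<in> V"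
      using U x by blast
    then have "P \<in> local_plots S F n V" "V \<subseteq> U"
      using W U by auto
    then show ?thesis
      using V(2) unfolding local_plots_def by blast
  qed
  ultimately show "P \<in> local_plots S F n U"
    using P by (simp add: local_plots_def)
next
  fix n U P Q assume P: "P \<in> local_plots S F n U" and eq: "\<forall>x\<in>U. P x = Q x"
  have "\<exists>W. openin (Euclidean_space n) W \<and> x \<in> W \<and> W \<subseteq> U \<and> F n W Q" if x: "x \<in> U" for x
  proof -
    obtain W where W: "openin (Euclidean_space n) W" "x \<in> W" "W \<subseteq> U" "F n W P"
      using P x by (auto simp: local_plots_def)
    then have "F n W Q"
      using cong eq by blast
    with W show ?thesis
      by blast
  qed
  then show "Q \<in> local_plots S F n U"
    using P eq by (simp add: local_plots_def Pi_iff)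
qed

lemma lift_comp:
  assumes "diffeological_space X" "smooth_eucl m V n W \<phi>" "\<exists>Q\<in>plots X n W. \<forall>y\<in>W. P y = F (Q y)"
  shows "\<exists>Q\<in>plots X m V. \<forall>y\<in>V. (P \<circ> \<phi>) y = F (Q y)"
proof -
  obtain Q where Q: "Q \<in> plots X n W" "\<forall>y\<in>W. P y = F (Q y)"
    using assms(3) by blast
  have "Q \<circ> \<phi> \<in> plots X m V"
    using diffeological_spaceD(4)[OF assms(1) Q(1) assms(2)] .
  moreover have "\<phi> y \<in> W" if "y \<in> V" for y
    using assms(2) that by (auto simp: smooth_eucl_def)
  ultimately show ?thesis
    using Q(2) by (intro bexI[of _ "Q \<circ> \<phi>"]) auto
qed

lemma lift_const:
  assumes "diffeological_space X" "x \<in> points X" "openin (Euclidean_space n) W" "c = F x"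
  shows "\<exists>Q\<in>plots X n W. \<forall>y\<in>W. c = F (Q y)"
  using diffeological_spaceD(3)[OF assms(1-3)] assms(4) by (intro bexI[of _ "\<lambda>_. x"]) simp_all

lemma local_plotsI:
  assumes "openin (Euclidean_space n) U" "P \<in> U \<rightarrow> S" "F n U P"
  shows "P \<in> local_plots S F n U"
  using assms by (auto simp: local_plots_def)

lemma local_plotsE:
  assumes "P \<in> local_plots S F n U" "x \<in> U"
  obtains W where "openin (Euclidean_space n) W" "x \<in> W" "W \<subseteq> U" "F n W P"
  using assms by (auto simp: local_plots_def)

lemma diffeological_space_discrete: "diffeological_space (discrete_diff S)"
  unfolding discrete_diff_def
  by (rule diffeological_space_local_plots) (auto simp: smooth_eucl_def Pi_iff)

lemma diffeological_space_sum:
  assumes X: "diffeological_space X" and Y: "diffeological_space Y"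
  shows "diffeological_space (sum_diff X Y)"
  unfolding sum_diff_def
proof (rule diffeological_space_local_plots, goal_cases)
  case (1 n W c)
  from 1(1) show ?case
  proof (rule PlusE)
    fix x assume "x \<in> points X" "c = Inl x"
    then show ?thesis
      using lift_const[OF X _ 1(2), of x c Inl] by simp
  next
    fix x assume "x \<in> points Y" "c = Inr x"
    then show ?thesis
      using lift_const[OF Y _ 1(2), of x c Inr] by simp
  qed
next
  case (2 n W P m V \<phi>)
  from 2(1) show ?case
    using lift_comp[OF X 2(3), of P Inl] lift_comp[OF Y 2(3), of P Inr] by (elim disjE) simp_all
next
  case (3 n W P Q)
  then show ?case by simp
qed

lemma diffeological_space_coprod:
  assumes X: "\<And>i. i \<in> J \<Longrightarrow> diffeological_space (X i)"
  shows "diffeological_space (coprod_diff J X)"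
  unfolding coprod_diff_def
proof (rule diffeological_space_local_plots, goal_cases)
  case (1 n W c)
  from 1(1) obtain i x where i: "i \<in> J" and "x \<in> points (X i)" "c = (i, x)"
    by (rule SigmaE)
  then have "\<exists>Q\<in>plots (X i) n W. \<forall>y\<in>W. c = (i, Q y)"
    using lift_const[OF X[OF i] _ 1(2), of x c "Pair i"] by simp
  with i show ?case ..
next
  case (2 n W P m V \<phi>)
  from 2(1) obtain i where i: "i \<in> J" and "\<exists>Q\<in>plots (X i) n W. \<forall>y\<in>W. P y = (i, Q y)" ..
  then have "\<exists>Q\<in>plots (X i) m V. \<forall>y\<in>V. (P \<circ> \<phi>) y = (i, Q y)"
    using lift_comp[OF X[OF i] 2(3), of P "Pair i"] by simp
  with i show ?case ..
next
  case (3 n W P Q)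
  then show ?case by simp
qed

lemma quot_proj_in: "x \<in> points X \<Longrightarrow> quot_proj X R x \<in> points X // equiv_gen (points X) R"
  by (simp add: quot_proj_def quotientI)

lemma diffeological_space_quot:
  assumes X: "diffeological_space X"
  shows "diffeological_space (quot_diff X R)"
  unfolding quot_diff_def
proof (rule diffeological_space_local_plots, goal_cases)
  case (1 n W c)
  from 1(1) obtain x where "x \<in> points X" "c = quot_proj X R x"
    unfolding quot_proj_def by (rule quotientE)
  then show ?case
    by (rule lift_const[OF X _ 1(2)])
next
  case (2 n W P m V \<phi>)
  show ?case
    using lift_comp[OF X 2(3,1)] .
next
  case (3 n W P Q)
  then show ?case by simp
qed

lemma diffeological_space_sub:
  assumes X: "diffeological_space X"
  shows "diffeological_space (sub_diff X S)"
  unfolding diffeological_space_def sub_diff_def diffeology.simps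
proof (intro conjI allI ballI impI; (elim conjE)?)
  fix n U P assume "P \<in> {P \<in> plots X n U. P \<in> U \<rightarrow> S}"
  then show "openin (Euclidean_space n) U" "P \<in> U \<rightarrow> points X \<inter> S"
    using diffeological_spaceD(1,2)[OF X] by fastforce+
next
  fix n U m V \<phi> P assume "P \<in> {P \<in> plots X n U. P \<in> U \<rightarrow> S}" "smooth_eucl m V n U \<phi>"
  then show "P \<circ> \<phi> \<in> {P \<in> plots X m V. P \<in> V \<rightarrow> S}"
    using diffeological_spaceD(4)[OF X] by (auto simp: smooth_eucl_def Pi_iff)
next
  fix n U P \<U>
  assume *: "P \<in> U \<rightarrow> points X \<inter> S" "\<Union>\<U> = U"
    "\<forall>W\<in>\<U>. openin (Euclidean_space n) W \<and> P \<in> {P \<in> plots X n W. P \<in> W \<rightarrow> S}"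
  then have "P \<in> plots X n U"
    by (intro diffeological_space_cover[OF X, of \<U>]) simp_all
  with * show "P \<in> {P \<in> plots X n U. P \<in> U \<rightarrow> S}"
    by auto
next
  fix n U P Q assume *: "P \<in> {P \<in> plots X n U. P \<in> U \<rightarrow> S}" "\<forall>x\<in>U. P x = Q x"
  then have "Q \<in> plots X n U"
    using diffeological_spaceD(5)[OF X] by blast
  with * show "Q \<in> {P \<in> plots X n U. P \<in> U \<rightarrow> S}"
    by (simp add: Pi_iff)
qed (use diffeological_spaceD(3)[OF X] in auto)

lemma diffeological_space_prod:
  assumes X: "diffeological_space X" and Y: "diffeological_space Y"
  shows "diffeological_space (prod_diff X Y)"
  unfolding diffeological_space_def prod_diff_def diffeology.simps
proof (intro conjI allI ballI impI; (elim conjE)?)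
  fix n U P assume P: "P \<in> {P. fst \<circ> P \<in> plots X n U \<and> snd \<circ> P \<in> plots Y n U}"
  then show "openin (Euclidean_space n) U"
    using diffeological_spaceD(1)[OF X] by blast
  show "P \<in> U \<rightarrow> points X \<times> points Y"
    using P diffeological_spaceD(2)[OF X] diffeological_spaceD(2)[OF Y]
    by (fastforce simp: Pi_iff mem_Times_iff)
next
  fix n U c assume "c \<in> points X \<times> points Y" "openin (Euclidean_space n) U"
  then show "(\<lambda>_. c) \<in> {P. fst \<circ> P \<in> plots X n U \<and> snd \<circ> P \<in> plots Y n U}"
    using diffeological_spaceD(3)[OF X] diffeological_spaceD(3)[OF Y] by (auto simp: o_def)
next
  fix n U m V \<phi> P
  assume "P \<in> {P. fst \<circ> P \<in> plots X n U \<and> snd \<circ> P \<in> plots Y n U}" "smooth_eucl m V n U \<phi>"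
  then show "P \<circ> \<phi> \<in> {P. fst \<circ> P \<in> plots X m V \<and> snd \<circ> P \<in> plots Y m V}"
    using diffeological_spaceD(4)[OF X] diffeological_spaceD(4)[OF Y]
    by (auto simp: comp_assoc[symmetric])
next
  fix n U P \<U>
  assume *: "P \<in> U \<rightarrow> points X \<times> points Y" "\<Union>\<U> = U"
    "\<forall>W\<in>\<U>. openin (Euclidean_space n) W \<and>
       P \<in> {P. fst \<circ> P \<in> plots X n W \<and> snd \<circ> P \<in> plots Y n W}"
  have "fst \<circ> P \<in> plots X n U"
    using * by (intro diffeological_space_cover[OF X, of \<U>]) simp_all
  moreover have "snd \<circ> P \<in> plots Y n U"
    using * by (intro diffeological_space_cover[OF Y, of \<U>]) simp_all
  ultimately show "P \<in> {P. fst \<circ> P \<in> plots X n U \<and> snd \<circ> P \<in> plots Y n U}"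
    by simp
next
  fix n U P Q
  assume *: "P \<in> {P. fst \<circ> P \<in> plots X n U \<and> snd \<circ> P \<in> plots Y n U}" "\<forall>x\<in>U. P x = Q x"
  then have "fst \<circ> Q \<in> plots X n U" "snd \<circ> Q \<in> plots Y n U"
    by (auto intro: diffeological_spaceD(5)[OF X, of "fst \<circ> P"]
        diffeological_spaceD(5)[OF Y, of "snd \<circ> P"])
  then show "Q \<in> {P. fst \<circ> P \<in> plots X n U \<and> snd \<circ> P \<in> plots Y n U}"
    by simp
qed


section \<open>Pushouts and sequential colimits\<close>

text \<open>
  The colimits in question are constructed as quotients of coproducts; \<open>is_pushout\<close> and
  \<open>is_seq_colimit\<close> say that a given cocone is isomorphic to the constructed one. The
  universal properties, for test spaces over an arbitrary type, are
  \<open>is_pushout_universal\<close> and \<open>is_seq_colimit_universal\<close> below.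
\<close>

definition pushout_rel ::
  "'a diffeology \<Rightarrow> ('a \<Rightarrow> 'b) \<Rightarrow> ('a \<Rightarrow> 'c) \<Rightarrow> (('b + 'c) \<times> ('b + 'c)) set" where
  "pushout_rel A f g = {(Inl (f a), Inr (g a)) | a. a \<in> points A}"

definition is_pushout ::
  "'a diffeology \<Rightarrow> 'b diffeology \<Rightarrow> 'c diffeology \<Rightarrow> ('a \<Rightarrow> 'b) \<Rightarrow> ('a \<Rightarrow> 'c) \<Rightarrow>
   'p diffeology \<Rightarrow> ('b \<Rightarrow> 'p) \<Rightarrow> ('c \<Rightarrow> 'p) \<Rightarrow> bool" where
  "is_pushout A B C f g P i j \<longleftrightarrow>
     diffeological_space P \<and>
     (\<exists>u. diffeomorphism (quot_diff (sum_diff B C) (pushout_rel A f g)) P u \<and>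
          (\<forall>b\<in>points B. u (quot_proj (sum_diff B C) (pushout_rel A f g) (Inl b)) = i b) \<and>
          (\<forall>c\<in>points C. u (quot_proj (sum_diff B C) (pushout_rel A f g) (Inr c)) = j c))"

definition seq_rel ::
  "(nat \<Rightarrow> 'a diffeology) \<Rightarrow> (nat \<Rightarrow> 'a \<Rightarrow> 'a) \<Rightarrow> ((nat \<times> 'a) \<times> (nat \<times> 'a)) set" where
  "seq_rel X \<iota> = {((n, x), (Suc n, \<iota> n x)) | n x. x \<in> points (X n)}"

definition is_seq_colimit ::
  "(nat \<Rightarrow> 'a diffeology) \<Rightarrow> (nat \<Rightarrow> 'a \<Rightarrow> 'a) \<Rightarrow> 'p diffeology \<Rightarrow> (nat \<Rightarrow> 'a \<Rightarrow> 'p) \<Rightarrow> bool" where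
  "is_seq_colimit X \<iota> P \<kappa> \<longleftrightarrow>
     diffeological_space P \<and>
     (\<exists>u. diffeomorphism (quot_diff (coprod_diff UNIV X) (seq_rel X \<iota>)) P u \<and>
          (\<forall>n. \<forall>x\<in>points (X n).
             u (quot_proj (coprod_diff UNIV X) (seq_rel X \<iota>) (n, x)) = \<kappa> n x))"

lemma smooth_map_comp:
  "smooth_map X Y f \<Longrightarrow> smooth_map Y Z g \<Longrightarrow> smooth_map X Z (g \<circ> f)"
  unfolding smooth_map_def by (auto simp: Pi_iff comp_assoc)

lemma smooth_map_cong:
  assumes "diffeological_space X" "diffeological_space Y" "smooth_map X Y f"
    and "\<And>x. x \<in> points X \<Longrightarrow> f x = g x"
  shows "smooth_map X Y g"
  unfolding smooth_map_def
proof (intro conjI allI ballI)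
  show "g \<in> points X \<rightarrow> points Y"
    using assms(3,4) by (auto simp: smooth_map_def Pi_iff)
next
  fix n U P assume P: "P \<in> plots X n U"
  have "P \<in> U \<rightarrow> points X"
    using diffeological_spaceD(2)[OF assms(1) P] .
  then have "\<And>x. x \<in> U \<Longrightarrow> (f \<circ> P) x = (g \<circ> P) x"
    by (simp add: assms(4) Pi_iff)
  moreover have "f \<circ> P \<in> plots Y n U"
    using assms(3) P by (simp add: smooth_map_def)
  ultimately show "g \<circ> P \<in> plots Y n U"
    using diffeological_spaceD(5)[OF assms(2)] by metis
qed

lemma equiv_gen_equiv: "equiv S (equiv_gen S R)"
proof -
  have "sym (R \<union> R\<inverse>)"
    by (auto simp: sym_def)
  then have "sym ((R \<union> R\<inverse>)\<^sup>*)"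
    by (rule sym_rtrancl)
  then show ?thesis
    unfolding equiv_def equiv_gen_def refl_on_def sym_def trans_def
    by (auto intro: rtrancl_trans)
qed

lemma quot_proj_smooth:
  assumes X: "diffeological_space X"
  shows "smooth_map X (quot_diff X R) (quot_proj X R)"
  unfolding smooth_map_def
proof (intro conjI allI ballI)
  show "quot_proj X R \<in> points X \<rightarrow> points (quot_diff X R)"
    by (auto simp: quot_proj_in)
next
  fix n U P assume P: "P \<in> plots X n U"
  then have "openin (Euclidean_space n) U" "P \<in> U \<rightarrow> points X"
    using diffeological_spaceD(1,2)[OF X] by auto
  with P show "quot_proj X R \<circ> P \<in> plots (quot_diff X R) n U"
    by (auto simp: quot_diff_def local_plots_def Pi_iff quot_proj_in)
qed

lemma quot_proj_eq:
  assumes "(x, y) \<in> R" "x \<in> points X" "y \<in> points X"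
  shows "quot_proj X R x = quot_proj X R y"
proof -
  have "(x, y) \<in> equiv_gen (points X) R"
    using assms by (auto simp: equiv_gen_def)
  then show ?thesis
    unfolding quot_proj_def by (rule equiv_class_eq[OF equiv_gen_equiv])
qed

lemma quot_factor:
  assumes X: "diffeological_space X" and Y: "diffeological_space Y" and p: "smooth_map X Y p"
    and R: "\<And>x y. (x, y) \<in> R \<Longrightarrow> p x = p y"
  obtains u where "smooth_map (quot_diff X R) Y u" "\<And>x. x \<in> points X \<Longrightarrow> u (quot_proj X R x) = p x"
proof -
  define u where "u c = p (SOME x. x \<in> c)" for c
  have eq: "p x = p y" if "(x, y) \<in> equiv_gen (points X) R" for x y
  proof -
    have "(x, y) \<in> (R \<union> R\<inverse>)\<^sup>*"
      using that by (simp add: equiv_gen_def)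
    then show ?thesis
      by (induction rule: rtrancl_induct) (auto dest: R)
  qed
  have u: "u (quot_proj X R x) = p x" if "x \<in> points X" for x
  proof -
    have "x \<in> quot_proj X R x"
      using that by (simp add: quot_proj_def equiv_gen_def)
    then have "(SOME y. y \<in> quot_proj X R x) \<in> quot_proj X R x"
      by (rule someI)
    then have "(x, SOME y. y \<in> quot_proj X R x) \<in> equiv_gen (points X) R"
      unfolding quot_proj_def by (rule Image_singleton_iff[THEN iffD1])
    then show ?thesis
      unfolding u_def using eq by metis
  qed
  have "smooth_map (quot_diff X R) Y u"
    unfolding smooth_map_def
  proof (intro conjI allI ballI)
    show "u \<in> points (quot_diff X R) \<rightarrow> points Y"
    proof
      fix c assume "c \<in> points (quot_diff X R)"
      then obtain x where "x \<in> points X" "c = quot_proj X R x"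
        unfolding points_quot_diff quot_proj_def by (rule quotientE)
      then show "u c \<in> points Y"
        using u p by (auto simp: smooth_map_def)
    qed
  next
    fix n U P assume P: "P \<in> plots (quot_diff X R) n U"
    show "u \<circ> P \<in> plots Y n U"
    proof (rule diffeological_space_local[OF Y])
      fix x assume x: "x \<in> U"
      obtain W where W: "openin (Euclidean_space n) W" "x \<in> W" "W \<subseteq> U"
        and ex: "\<exists>Q\<in>plots X n W. \<forall>y\<in>W. P y = quot_proj X R (Q y)"
        by (rule local_plotsE[OF P[unfolded quot_diff_def diffeology.simps] x])
      from ex obtain Q where Q: "Q \<in> plots X n W" "\<forall>y\<in>W. P y = quot_proj X R (Q y)"
        by (elim bexE)
      have "Q \<in> W \<rightarrow> points X"
        using diffeological_spaceD(2)[OF X Q(1)] .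
      then have eq': "(p \<circ> Q) y = (u \<circ> P) y" if "y \<in> W" for y
        using that Q(2) u by (simp add: Pi_iff)
      have "p \<circ> Q \<in> plots Y n W"
        using p Q(1) by (simp add: smooth_map_def)
      then have "u \<circ> P \<in> plots Y n W"
        using eq' by (rule diffeological_spaceD(5)[OF Y])
      with W show "\<exists>W. openin (Euclidean_space n) W \<and> x \<in> W \<and> W \<subseteq> U \<and> u \<circ> P \<in> plots Y n W"
        by blast
    qed
  qed
  with u show thesis
    using that by blast
qed

lemma smooth_Inl:
  assumes "diffeological_space X" shows "smooth_map X (sum_diff X Y) Inl"
  unfolding smooth_map_def sum_diff_def diffeology.simps
proof (intro conjI allI ballI)
  fix n U P assume P: "P \<in> plots X n U"
  then have "Inl \<circ> P \<in> U \<rightarrow> points X <+> points Y"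
    using diffeological_spaceD(2)[OF assms P] by auto
  moreover have "\<exists>Q\<in>plots X n U. \<forall>y\<in>U. (Inl \<circ> P) y = Inl (Q y)"
    using P by (intro bexI[of _ P]) simp_all
  ultimately show "Inl \<circ> P \<in> local_plots (points X <+> points Y)
        (\<lambda>n W P. (\<exists>Q\<in>plots X n W. \<forall>y\<in>W. P y = Inl (Q y)) \<or>
                 (\<exists>Q\<in>plots Y n W. \<forall>y\<in>W. P y = Inr (Q y))) n U"
    by (intro local_plotsI diffeological_spaceD(1)[OF assms P] disjI1)
qed auto

lemma smooth_Inr:
  assumes "diffeological_space Y" shows "smooth_map Y (sum_diff X Y) Inr"
  unfolding smooth_map_def sum_diff_def diffeology.simps
proof (intro conjI allI ballI)
  fix n U P assume P: "P \<in> plots Y n U"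
  then have "Inr \<circ> P \<in> U \<rightarrow> points X <+> points Y"
    using diffeological_spaceD(2)[OF assms P] by auto
  moreover have "\<exists>Q\<in>plots Y n U. \<forall>y\<in>U. (Inr \<circ> P) y = Inr (Q y)"
    using P by (intro bexI[of _ P]) simp_all
  ultimately show "Inr \<circ> P \<in> local_plots (points X <+> points Y)
        (\<lambda>n W P. (\<exists>Q\<in>plots X n W. \<forall>y\<in>W. P y = Inl (Q y)) \<or>
                 (\<exists>Q\<in>plots Y n W. \<forall>y\<in>W. P y = Inr (Q y))) n U"
    by (intro local_plotsI diffeological_spaceD(1)[OF assms P] disjI2)
qed auto

lemma smooth_case_sum:
  assumes Y: "diffeological_space Y" and p: "smooth_map B Y p" and q: "smooth_map C Y q"
  shows "smooth_map (sum_diff B C) Y (case_sum p q)"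
  unfolding smooth_map_def
proof (intro conjI allI ballI)
  show "case_sum p q \<in> points (sum_diff B C) \<rightarrow> points Y"
    using p q by (auto simp: smooth_map_def)
next
  fix n U P assume P: "P \<in> plots (sum_diff B C) n U"
  show "case_sum p q \<circ> P \<in> plots Y n U"
  proof (rule diffeological_space_local[OF Y])
    fix x assume x: "x \<in> U"
    obtain W where W: "openin (Euclidean_space n) W" "x \<in> W" "W \<subseteq> U"
      and Q: "(\<exists>Q\<in>plots B n W. \<forall>y\<in>W. P y = Inl (Q y)) \<or> (\<exists>Q\<in>plots C n W. \<forall>y\<in>W. P y = Inr (Q y))"
      by (rule local_plotsE[OF P[unfolded sum_diff_def diffeology.simps] x])
    from Q have "case_sum p q \<circ> P \<in> plots Y n W"
    proof (elim disjE bexE)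
      fix Q assume "Q \<in> plots B n W" "\<forall>y\<in>W. P y = Inl (Q y)"
      then have "p \<circ> Q \<in> plots Y n W" "\<And>y. y \<in> W \<Longrightarrow> (p \<circ> Q) y = (case_sum p q \<circ> P) y"
        using p by (simp_all add: smooth_map_def)
      then show ?thesis
        by (rule diffeological_spaceD(5)[OF Y])
    next
      fix Q assume "Q \<in> plots C n W" "\<forall>y\<in>W. P y = Inr (Q y)"
      then have "q \<circ> Q \<in> plots Y n W" "\<And>y. y \<in> W \<Longrightarrow> (q \<circ> Q) y = (case_sum p q \<circ> P) y"
        using q by (simp_all add: smooth_map_def)
      then show ?thesis
        by (rule diffeological_spaceD(5)[OF Y])
    qed
    with W show "\<exists>W. openin (Euclidean_space n) W \<and> x \<in> W \<and> W \<subseteq> U \<and> case_sum p q \<circ> P \<in> plots Y n W"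
      by blast
  qed
qed

lemma smooth_coprod_in:
  assumes "diffeological_space (X i)" "i \<in> J"
  shows "smooth_map (X i) (coprod_diff J X) (Pair i)"
  unfolding smooth_map_def coprod_diff_def diffeology.simps
proof (intro conjI allI ballI)
  fix n U P assume P: "P \<in> plots (X i) n U"
  then have "Pair i \<circ> P \<in> U \<rightarrow> (SIGMA i:J. points (X i))"
    using diffeological_spaceD(2)[OF assms(1) P] assms(2) by auto
  moreover have "\<exists>Q\<in>plots (X i) n U. \<forall>y\<in>U. (Pair i \<circ> P) y = (i, Q y)"
    using P by (intro bexI[of _ P]) simp_all
  then have "\<exists>i'\<in>J. \<exists>Q\<in>plots (X i') n U. \<forall>y\<in>U. (Pair i \<circ> P) y = (i', Q y)"
    by (rule bexI[of _ i]) (rule assms(2))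
  ultimately show "Pair i \<circ> P \<in> local_plots (SIGMA i:J. points (X i))
        (\<lambda>n W P. \<exists>i\<in>J. \<exists>Q\<in>plots (X i) n W. \<forall>y\<in>W. P y = (i, Q y)) n U"
    by (rule local_plotsI[OF diffeological_spaceD(1)[OF assms(1) P]])
qed (use assms(2) in auto)

lemma smooth_case_prod:
  assumes Y: "diffeological_space Y" and p: "\<And>i. i \<in> J \<Longrightarrow> smooth_map (X i) Y (p i)"
  shows "smooth_map (coprod_diff J X) Y (case_prod p)"
  unfolding smooth_map_def
proof (intro conjI allI ballI)
  have "p i x \<in> points Y" if "i \<in> J" "x \<in> points (X i)" for i x
    using p[OF that(1)] that(2) by (auto simp: smooth_map_def)
  then show "case_prod p \<in> points (coprod_diff J X) \<rightarrow> points Y"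
    by (simp add: Pi_iff)
next
  fix n U P assume P: "P \<in> plots (coprod_diff J X) n U"
  show "case_prod p \<circ> P \<in> plots Y n U"
  proof (rule diffeological_space_local[OF Y])
    fix x assume x: "x \<in> U"
    obtain W where W: "openin (Euclidean_space n) W" "x \<in> W" "W \<subseteq> U"
      and ex: "\<exists>i\<in>J. \<exists>Q\<in>plots (X i) n W. \<forall>y\<in>W. P y = (i, Q y)"
      by (rule local_plotsE[OF P[unfolded coprod_diff_def diffeology.simps] x])
    from ex obtain i Q where Q: "i \<in> J" "Q \<in> plots (X i) n W" "\<forall>y\<in>W. P y = (i, Q y)"
      by (elim bexE)
    have "p i \<circ> Q \<in> plots Y n W"
      using p[OF Q(1)] Q(2) by (simp add: smooth_map_def)
    then have "case_prod p \<circ> P \<in> plots Y n W"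
      by (rule diffeological_spaceD(5)[OF Y]) (simp add: Q(3))
    with W show "\<exists>W. openin (Euclidean_space n) W \<and> x \<in> W \<and> W \<subseteq> U \<and> case_prod p \<circ> P \<in> plots Y n W"
      by blast
  qed
qed

lemma quot_iso_factor:
  assumes X: "diffeological_space X" and P: "diffeological_space P" and Y: "diffeological_space Y"
    and u: "diffeomorphism (quot_diff X R) P u" and p: "smooth_map X Y p"
    and R: "\<And>x y. (x, y) \<in> R \<Longrightarrow> p x = p y"
  shows "\<exists>v. smooth_map P Y v \<and> (\<forall>x\<in>points X. v (u (quot_proj X R x)) = p x) \<and>
           (\<forall>v'. (\<forall>x\<in>points X. v' (u (quot_proj X R x)) = p x) \<longrightarrow> (\<forall>y\<in>points P. v' y = v y))"
proof -
  obtain w where w: "smooth_map (quot_diff X R) Y w" "\<And>x. x \<in> points X \<Longrightarrow> w (quot_proj X R x) = p x"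
    using quot_factor[where R=R, OF X Y p] R by metis
  obtain g where g: "smooth_map P (quot_diff X R) g"
    "\<And>c. c \<in> points (quot_diff X R) \<Longrightarrow> g (u c) = c" "\<And>y. y \<in> points P \<Longrightarrow> u (g y) = y"
    using u unfolding diffeomorphism_def by metis
  have w': "smooth_map P Y (w \<circ> g)"
    using smooth_map_comp[OF g(1) w(1)] .
  have v: "(w \<circ> g) (u (quot_proj X R x)) = p x" if "x \<in> points X" for x
    using g(2)[of "quot_proj X R x"] w(2) that by (simp add: quot_proj_in)
  have uniq: "v' y = (w \<circ> g) y"
    if v': "\<forall>x\<in>points X. v' (u (quot_proj X R x)) = p x" and y: "y \<in> points P" for v' y
  proof -
    have "g y \<in> points (quot_diff X R)"
      using g(1) y unfolding smooth_map_def by (metis PiE)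
    then obtain x where x: "x \<in> points X" "g y = quot_proj X R x"
      unfolding points_quot_diff quot_proj_def by (rule quotientE)
    then have "u (quot_proj X R x) = y"
      using g(3)[OF y] by simp
    then show ?thesis
      using v'[rule_format, OF x(1)] v[OF x(1)] by simp
  qed
  show ?thesis
    by (intro exI[of _ "w \<circ> g"] conjI w') (use v uniq in \<open>simp_all add: Ball_def\<close>)
qed

theorem is_pushout_cocone:
  assumes "diffeological_space B" "diffeological_space C"
    and f: "smooth_map A B f" and g: "smooth_map A C g" and "is_pushout A B C f g P i j"
  shows "smooth_map B P i" "smooth_map C P j" "\<And>a. a \<in> points A \<Longrightarrow> i (f a) = j (g a)"
proof -
  let ?X = "sum_diff B C" and ?R = "pushout_rel A f g"
  obtain u where P: "diffeological_space P" and u: "smooth_map (quot_diff ?X ?R) P u"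
    "\<And>b. b \<in> points B \<Longrightarrow> u (quot_proj ?X ?R (Inl b)) = i b"
    "\<And>c. c \<in> points C \<Longrightarrow> u (quot_proj ?X ?R (Inr c)) = j c"
    using assms(5) unfolding is_pushout_def diffeomorphism_def by blast
  have X: "diffeological_space ?X"
    using diffeological_space_sum assms(1,2) .
  have uX: "smooth_map ?X P (u \<circ> quot_proj ?X ?R)"
    using smooth_map_comp[OF quot_proj_smooth[OF X] u(1)] .
  show "smooth_map B P i"
    using smooth_map_comp[OF smooth_Inl[OF assms(1)] uX] u(2)
    by (auto intro: smooth_map_cong[OF assms(1) P])
  show "smooth_map C P j"
    using smooth_map_comp[OF smooth_Inr[OF assms(2)] uX] u(3)
    by (auto intro: smooth_map_cong[OF assms(2) P])
  fix a assume a: "a \<in> points A"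
  then have fg: "f a \<in> points B" "g a \<in> points C"
    using f g by (auto simp: smooth_map_def)
  then have "quot_proj ?X ?R (Inl (f a)) = quot_proj ?X ?R (Inr (g a))"
    using a by (intro quot_proj_eq) (auto simp: pushout_rel_def)
  then show "i (f a) = j (g a)"
    using u(2,3) fg by metis
qed

theorem is_pushout_universal:
  fixes Y :: "'y diffeology"
  assumes "diffeological_space B" "diffeological_space C" "is_pushout A B C f g P i j"
    and Y: "diffeological_space Y" and p: "smooth_map B Y p" and q: "smooth_map C Y q"
    and pq: "\<And>a. a \<in> points A \<Longrightarrow> p (f a) = q (g a)"
  shows "\<exists>v. smooth_map P Y v \<and> (\<forall>b\<in>points B. v (i b) = p b) \<and> (\<forall>c\<in>points C. v (j c) = q c) \<and>
           (\<forall>v'. (\<forall>b\<in>points B. v' (i b) = p b) \<and> (\<forall>c\<in>points C. v' (j c) = q c) \<longrightarrow>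
                 (\<forall>y\<in>points P. v' y = v y))"
proof -
  let ?X = "sum_diff B C" and ?R = "pushout_rel A f g"
  obtain u where P: "diffeological_space P" and u: "diffeomorphism (quot_diff ?X ?R) P u"
    and ui: "\<And>b. b \<in> points B \<Longrightarrow> u (quot_proj ?X ?R (Inl b)) = i b"
    and uj: "\<And>c. c \<in> points C \<Longrightarrow> u (quot_proj ?X ?R (Inr c)) = j c"
    using assms(3) unfolding is_pushout_def by blast
  have all: "(\<forall>x\<in>points ?X. v (u (quot_proj ?X ?R x)) = case_sum p q x) \<longleftrightarrow>
        (\<forall>b\<in>points B. v (i b) = p b) \<and> (\<forall>c\<in>points C. v (j c) = q c)" for v
    by (simp add: Plus_def ball_Un ui uj)
  have "\<exists>v. smooth_map P Y v \<and> (\<forall>x\<in>points ?X. v (u (quot_proj ?X ?R x)) = case_sum p q x) \<and>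
        (\<forall>v'. (\<forall>x\<in>points ?X. v' (u (quot_proj ?X ?R x)) = case_sum p q x) \<longrightarrow>
              (\<forall>y\<in>points P. v' y = v y))"
    using pq
    by (intro quot_iso_factor[OF diffeological_space_sum[OF assms(1,2)] P Y u smooth_case_sum[OF Y p q]])
       (auto simp: pushout_rel_def)
  then show ?thesis
    unfolding all by simp
qed

theorem is_seq_colimit_cocone:
  assumes X: "\<And>n. diffeological_space (X n)"
    and \<iota>: "\<And>n. smooth_map (X n) (X (Suc n)) (\<iota> n)" and "is_seq_colimit X \<iota> P \<kappa>"
  shows "smooth_map (X n) P (\<kappa> n)" "\<And>x. x \<in> points (X n) \<Longrightarrow> \<kappa> (Suc n) (\<iota> n x) = \<kappa> n x"
proof -
  let ?X = "coprod_diff UNIV X" and ?R = "seq_rel X \<iota>"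
  obtain u where P: "diffeological_space P" and u: "diffeomorphism (quot_diff ?X ?R) P u"
    and "\<forall>n. \<forall>x\<in>points (X n). u (quot_proj ?X ?R (n, x)) = \<kappa> n x"
    using assms(3) unfolding is_seq_colimit_def by (elim conjE exE)
  then have uk: "u (quot_proj ?X ?R (n, x)) = \<kappa> n x" if "x \<in> points (X n)" for n x
    using that by simp
  have cX: "diffeological_space ?X"
    by (rule diffeological_space_coprod) (rule X)
  have uX: "smooth_map ?X P (u \<circ> quot_proj ?X ?R)"
    by (rule smooth_map_comp[OF quot_proj_smooth[OF cX] conjunct1[OF u[unfolded diffeomorphism_def]]])
  show "smooth_map (X n) P (\<kappa> n)"
    by (rule smooth_map_cong[OF X P smooth_map_comp[where f="Pair n", OF smooth_coprod_in[of X n UNIV, OF X UNIV_I] uX]])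
       (simp add: uk)
  fix x assume x: "x \<in> points (X n)"
  then have x': "\<iota> n x \<in> points (X (Suc n))"
    using \<iota>[of n] unfolding smooth_map_def by (metis PiE)
  have "quot_proj ?X ?R (n, x) = quot_proj ?X ?R (Suc n, \<iota> n x)"
    using x x' by (intro quot_proj_eq) (auto simp: seq_rel_def)
  then show "\<kappa> (Suc n) (\<iota> n x) = \<kappa> n x"
    using uk[OF x] uk[OF x'] by simp
qed

theorem is_seq_colimit_universal:
  fixes Y :: "'y diffeology"
  assumes X: "\<And>n. diffeological_space (X n)" and "is_seq_colimit X \<iota> P \<kappa>"
    and Y: "diffeological_space Y" and p: "\<And>n. smooth_map (X n) Y (p n)"
    and compat: "\<And>n x. x \<in> points (X n) \<Longrightarrow> p (Suc n) (\<iota> n x) = p n x"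
  shows "\<exists>v. smooth_map P Y v \<and> (\<forall>n. \<forall>x\<in>points (X n). v (\<kappa> n x) = p n x) \<and>
           (\<forall>v'. (\<forall>n. \<forall>x\<in>points (X n). v' (\<kappa> n x) = p n x) \<longrightarrow> (\<forall>y\<in>points P. v' y = v y))"
proof -
  let ?X = "coprod_diff UNIV X" and ?R = "seq_rel X \<iota>"
  obtain u where P: "diffeological_space P" and u: "diffeomorphism (quot_diff ?X ?R) P u"
    and "\<forall>n. \<forall>x\<in>points (X n). u (quot_proj ?X ?R (n, x)) = \<kappa> n x"
    using assms(2) unfolding is_seq_colimit_def by (elim conjE exE)
  then have uk: "u (quot_proj ?X ?R (n, x)) = \<kappa> n x" if "x \<in> points (X n)" for n x
    using that by simp
  have all: "(\<forall>x\<in>points ?X. v (u (quot_proj ?X ?R x)) = case_prod p x) \<longleftrightarrow>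
        (\<forall>n. \<forall>x\<in>points (X n). v (\<kappa> n x) = p n x)" for v
    by (simp add: split_paired_Ball_Sigma uk)
  have "\<exists>v. smooth_map P Y v \<and> (\<forall>x\<in>points ?X. v (u (quot_proj ?X ?R x)) = case_prod p x) \<and>
        (\<forall>v'. (\<forall>x\<in>points ?X. v' (u (quot_proj ?X ?R x)) = case_prod p x) \<longrightarrow>
              (\<forall>y\<in>points P. v' y = v y))"
    by (intro quot_iso_factor[OF diffeological_space_coprod[OF X] P Y u smooth_case_prod[OF Y p]])
       (auto simp: seq_rel_def compat)
  then show ?thesis
    unfolding all .
qed


section \<open>Smooth CW complexes\<close>

definition sphere_diff :: "nat \<Rightarrow> (nat \<Rightarrow> real) diffeology" where
  "sphere_diff n = sub_diff (euclidean_diff (Suc n)) (topspace (nsphere n))"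

text \<open>\<open>disk_diff n\<close> is the closed unit disk \<open>D\<^sup>n\<close> in \<open>\<real>\<^sup>n\<close>.\<close>

definition disk_diff :: "nat \<Rightarrow> (nat \<Rightarrow> real) diffeology" where
  "disk_diff n = sub_diff (euclidean_diff n) {x. (\<Sum>i<n. (x i)\<^sup>2) \<le> 1}"

text \<open>
  A smooth CW complex \<open>X\<close> with skeleta \<open>sk n\<close>, indexing sets \<open>J n\<close> for the \<open>(n+1)\<close>-cells, and
  attaching maps \<open>h n\<close>. Attaching disks along their boundary spheres makes the canonical maps
  \<open>sk n \<rightarrow> sk (Suc n)\<close> injective, so the skeleta are taken to be subsets of \<open>X\<close>: all the
  maps between them are the identity on points. Each \<open>sk n\<close> carries a diffeology of its own,
  not assumed to be the one induced from \<open>X\<close>. In \<open>is_pushout\<close> below, the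
  first \<open>id\<close> is the inclusion of the spheres into the disks, the second one the inclusion
  \<open>sk n \<rightarrow> sk (Suc n)\<close>, and \<open>\<Phi>\<close> is the characteristic map of the \<open>(n+1)\<close>-cells.
\<close>

definition smooth_CW ::
  "'x diffeology \<Rightarrow> (nat \<Rightarrow> 'x diffeology) \<Rightarrow> (nat \<Rightarrow> 'i set) \<Rightarrow>
   (nat \<Rightarrow> 'i \<times> (nat \<Rightarrow> real) \<Rightarrow> 'x) \<Rightarrow> bool" where
  "smooth_CW X sk J h \<longleftrightarrow>
     (\<exists>S. sk 0 = discrete_diff S) \<and>
     (\<forall>n. smooth_map (coprod_diff (J n) (\<lambda>_. sphere_diff n)) (sk n) (h n) \<and>
          (\<exists>\<Phi>. is_pushout (coprod_diff (J n) (\<lambda>_. sphere_diff n)) (sk n)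
                  (coprod_diff (J n) (\<lambda>_. disk_diff (Suc n))) (h n) id (sk (Suc n)) id \<Phi>)) \<and>
     is_seq_colimit sk (\<lambda>_. id) X (\<lambda>_. id)"


section \<open>Smooth manifolds\<close>

definition paracompact_space :: "'a topology \<Rightarrow> bool" where
  "paracompact_space T \<longleftrightarrow>
     (\<forall>\<U>. (\<forall>U\<in>\<U>. openin T U) \<and> \<Union>\<U> = topspace T \<longrightarrow>
        (\<exists>\<V>. (\<forall>V\<in>\<V>. openin T V \<and> (\<exists>U\<in>\<U>. V \<subseteq> U)) \<and> \<Union>\<V> = topspace T \<and>
             locally_finite_in T \<V>))"

text \<open>
  A (Hausdorff, paracompact, boundaryless) smooth manifold of dimension \<open>m\<close>: a topological
  space with a smooth atlas. A chart \<open>(W, \<phi>)\<close> is a homeomorphism \<open>\<phi>\<close> from the open set \<open>W\<close> onto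
  the open set \<open>\<phi> ` W \<subseteq> \<real>\<^sup>m\<close>.
\<close>

definition smooth_manifold ::
  "nat \<Rightarrow> 'm topology \<Rightarrow> ('m set \<times> ('m \<Rightarrow> nat \<Rightarrow> real)) set \<Rightarrow> bool" where
  "smooth_manifold m T \<A> \<longleftrightarrow>
     Hausdorff_space T \<and> paracompact_space T \<and>
     (\<Union>(W, \<phi>)\<in>\<A>. W) = topspace T \<and>
     (\<forall>(W, \<phi>)\<in>\<A>. openin T W \<and> openin (Euclidean_space m) (\<phi> ` W) \<and>
        homeomorphic_map (subtopology T W) (subtopology (Euclidean_space m) (\<phi> ` W)) \<phi>) \<and>
     (\<forall>(W, \<phi>)\<in>\<A>. \<forall>(W', \<psi>)\<in>\<A>.
        smooth_eucl m (\<phi> ` (W \<inter> W')) m (\<psi> ` (W \<inter> W')) (\<psi> \<circ> inv_into W \<phi>))"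

definition manifold_diff ::
  "nat \<Rightarrow> 'm topology \<Rightarrow> ('m set \<times> ('m \<Rightarrow> nat \<Rightarrow> real)) set \<Rightarrow> 'm diffeology" where
  "manifold_diff m T \<A> =
     \<lparr>points = topspace T,
      plots = \<lambda>n U. {P. openin (Euclidean_space n) U \<and>
                        continuous_map (subtopology (Euclidean_space n) U) T P \<and>
                        (\<forall>(W, \<phi>)\<in>\<A>. smooth_eucl n {x \<in> U. P x \<in> W} m (\<phi> ` W) (\<phi> \<circ> P))}\<rparr>"


section \<open>Continuous homotopies\<close>

definition continuous_homotopy ::
  "'a diffeology \<Rightarrow> 'b diffeology \<Rightarrow> ('a \<Rightarrow> 'b) \<Rightarrow> ('a \<Rightarrow> 'b) \<Rightarrow> ('a \<times> real \<Rightarrow> 'b) \<Rightarrow> bool" where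
  "continuous_homotopy X Y f g H \<longleftrightarrow>
     D_continuous X Y f \<and> D_continuous X Y g \<and> D_continuous (prod_diff X real_diff) Y H \<and>
     (\<exists>\<epsilon>. 0 < \<epsilon> \<and> \<epsilon> < 1 / 2 \<and>
        (\<forall>x\<in>points X. \<forall>t. (t \<le> \<epsilon> \<longrightarrow> H (x, t) = f x) \<and> (t \<ge> 1 - \<epsilon> \<longrightarrow> H (x, t) = g x)))"

definition homotopy_rel :: "('a \<Rightarrow> 'b) \<Rightarrow> ('a \<times> real \<Rightarrow> 'b) \<Rightarrow> 'a set \<Rightarrow> bool" where
  "homotopy_rel f H A \<longleftrightarrow> (\<forall>x\<in>A. \<forall>t. H (x, t) = f x)"

text \<open>\<open>T\<close> is the topology of the manifold \<open>M\<close>.\<close>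

definition smooth_on_closed ::
  "'m topology \<Rightarrow> 'm diffeology \<Rightarrow> 'b diffeology \<Rightarrow> ('m \<Rightarrow> 'b) \<Rightarrow> 'm set \<Rightarrow> bool" where
  "smooth_on_closed T M Y f A \<longleftrightarrow>
     closedin T A \<and> (\<exists>O'. openin T O' \<and> A \<subseteq> O' \<and> smooth_map (sub_diff M O') Y f)"

end

(* The skeleta are treated one layer of cells at a time, for maps f from an arbitrary open subset
   V of M and relative to a closed set A near which f is smooth. Let f take values in X' = X + cells.
   On the preimage of the open cells, f is a continuous map into open balls; a partition of unity
   makes it smooth over the concentric balls of radius 3/4. Off A, composing with a smooth
   self-map of X' that is homotopic to the identity and collapses the shell of radii > 1/2 onto the
   boundary spheres sends the rest of V into X. That rest is an open subset V' of M, and the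
   map V' -> X is already smooth near the part of V' that is close to the complement of V', so
   induction applied to V' relative to that part finishes the step.

   In the infinite-dimensional case a convergent sequence cannot leave every skeleton, so every
   point of M has a neighbourhood that f sends into a finite skeleton. Hence there is a continuous
   rho >= 0 on M such that f sends {rho <= k} into the k-skeleton. One first makes f smooth on the disjoint
   bands around the walls rho = k + 1/2 and then, relative to these walls, between them. *)
theory Submission
  imports Defs
begin

section \<open>Calculus of smooth functions on Euclidean spaces\<close>

text \<open>The obstacle is the boundary of a cell. A plot of \<open>Z'\<close> is locally a plot of
  \<open>Z\<close> or of one closed disk, so a map that crosses an attaching sphere cannot be
  averaged in coordinates; it has to be moved until, locally, it either stays inside the cells or
  takes values in \<open>Z\<close>. The radii leave room for this. Smoothing moves cell coordinates
  by at most 1/8 and only where the radius is below 7/8, so no point leaves its open cell. Where the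
  smoothed map has radius at most 9/16, the original radius was at most 11/16 < 3/4, so smoothing
  was complete there. The gap between the collapsing radius 1/2 and 9/16 is an overlap in which the
  map to \<open>Z\<close> is already smooth, and relative to which the induction continues.

  The induction starts at the top layer of cells and hence needs a finite skeleton. Removing the
  integer levels, or the half-integer levels, of rho leaves open pieces on which such a skeleton can
  be chosen constantly; two cuts are made because the pieces of a single cut do not cover M.\<close>

abbreviation EE :: "nat \<Rightarrow> (nat \<Rightarrow> real) set" where "EE n \<equiv> topspace (Euclidean_space n)"

lemma Euclidean_space_eq: "Euclidean_space n = top_of_set (EE n)"
  by (simp add: Euclidean_space_def euclidean_product_topology)

text \<open>Openness of the section lets a partial derivative be computed from the values on U
  alone, although \<open>Ck_fun\<close> differentiates a total function along a coordinate
  line.\<close>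

lemma open_line_Euclidean_space:
  assumes "openin (Euclidean_space n) U" "x \<in> EE n" "i < n"
  shows "open {t. x(i := t) \<in> U}"
proof -
  have "continuous_on UNIV (\<lambda>t. (x(i := t)) j)" for j
    by (cases "j = i") (auto intro!: continuous_intros)
  then have "continuous_map euclideanreal (powertop_real UNIV) (\<lambda>t. x(i := t))"
    by (subst continuous_map_componentwise_UNIV) auto
  moreover have "x(i := t) \<in> {x. \<forall>i\<ge>n. x i = 0}" for t
    using assms(2,3) by (auto simp: topspace_Euclidean_space)
  ultimately have "continuous_map euclideanreal (Euclidean_space n) (\<lambda>t. x(i := t))"
    by (auto simp: Euclidean_space_def continuous_map_in_subtopology)
  from openin_continuous_map_preimage[OF this assms(1)] show ?thesis
    by simp
qed

lemma has_derivative_line_cong: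
  assumes "openin (Euclidean_space n) U" "x \<in> U" "i < n" "\<And>y. y \<in> U \<Longrightarrow> f y = g y"
    and "((\<lambda>t. f (x(i := t))) has_real_derivative d) (at (x i))"
  shows "((\<lambda>t. g (x(i := t))) has_real_derivative d) (at (x i))"
proof (rule has_field_derivative_transform_within_open[OF assms(5)])
  have "x \<in> EE n"
    using openin_subset[OF assms(1)] assms(2) by blast
  then show "open {t. x(i := t) \<in> U}"
    using open_line_Euclidean_space assms(1,3) by blast
qed (use assms(2,4) in auto)

lemma Ck_fun_cong:
  assumes "openin (Euclidean_space n) U" "\<And>y. y \<in> U \<Longrightarrow> f y = g y" "Ck_fun k n U f"
  shows "Ck_fun k n U g"
proof -
  have "continuous_map (subtopology (Euclidean_space n) U) euclideanreal f \<Longrightarrow>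
        continuous_map (subtopology (Euclidean_space n) U) euclideanreal g"
    using assms(2) by (auto elim!: continuous_map_eq)
  then show ?thesis
    using assms has_derivative_line_cong[OF assms(1)] by (cases k) (auto, metis)
qed

lemma Ck_fun_const: "Ck_fun k n U (\<lambda>_. c)"
proof (induction k arbitrary: c)
  case (Suc k)
  then show ?case
    by (auto intro!: exI[of _ "\<lambda>_. 0"])
qed auto

lemma Ck_fun_coord: "Ck_fun k n U (\<lambda>x. x i)"
proof -
  have c: "continuous_map (subtopology (Euclidean_space n) U) euclideanreal (\<lambda>x. x i)"
    unfolding Euclidean_space_def
    by (intro continuous_map_from_subtopology continuous_map_product_projection UNIV_I)
  show ?thesis
  proof (cases k)
    case (Suc l)
    have "\<exists>f'. (\<forall>x\<in>U. ((\<lambda>t. (x(j := t)) i) has_real_derivative f' x) (at (x j))) \<and> Ck_fun l n U f'" for j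
      by (rule exI[of _ "\<lambda>_. if i = j then 1 else 0"]) (auto intro!: derivative_eq_intros Ck_fun_const)
    with c show ?thesis by (simp add: Suc)
  qed (use c in simp)
qed

lemma Ck_fun_Suc_imp: "Ck_fun (Suc k) n U f \<Longrightarrow> Ck_fun k n U f"
proof (induction k arbitrary: f)
  case (Suc k)
  then show ?case by (metis Ck_fun.simps(2))
qed auto

lemma Ck_fun_continuous: "Ck_fun k n U f \<Longrightarrow> continuous_map (subtopology (Euclidean_space n) U) euclideanreal f"
  by (cases k) auto

lemma Ck_fun_add:
  assumes "Ck_fun k n U f" "Ck_fun k n U g"
  shows "Ck_fun k n U (\<lambda>x. f x + g x)"
  using assms
proof (induction k arbitrary: f g)
  case 0
  then show ?case by (auto intro: continuous_map_add)
next
  case (Suc k)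
  have "\<exists>h'. (\<forall>x\<in>U. ((\<lambda>t. f (x(i := t)) + g (x(i := t))) has_real_derivative h' x) (at (x i))) \<and> Ck_fun k n U h'"
    if i: "i < n" for i
  proof -
    obtain f' g' where f': "\<forall>x\<in>U. ((\<lambda>t. f (x(i := t))) has_real_derivative f' x) (at (x i))" "Ck_fun k n U f'"
      and g': "\<forall>x\<in>U. ((\<lambda>t. g (x(i := t))) has_real_derivative g' x) (at (x i))" "Ck_fun k n U g'"
      using Suc.prems i by (metis Ck_fun.simps(2))
    show ?thesis
      by (rule exI[of _ "\<lambda>x. f' x + g' x"]) (use f' g' Suc.IH in \<open>auto intro!: derivative_intros\<close>)
  qed
  with Suc.prems show ?case by (auto intro: continuous_map_add)
qed

lemma Ck_fun_mult:
  assumes "Ck_fun k n U f" "Ck_fun k n U g"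
  shows "Ck_fun k n U (\<lambda>x. f x * g x)"
  using assms
proof (induction k arbitrary: f g)
  case 0
  then show ?case by (auto intro: continuous_map_real_mult)
next
  case (Suc k)
  have "\<exists>h'. (\<forall>x\<in>U. ((\<lambda>t. f (x(i := t)) * g (x(i := t))) has_real_derivative h' x) (at (x i))) \<and> Ck_fun k n U h'"
    if i: "i < n" for i
  proof -
    obtain f' g' where f': "\<forall>x\<in>U. ((\<lambda>t. f (x(i := t))) has_real_derivative f' x) (at (x i))" "Ck_fun k n U f'"
      and g': "\<forall>x\<in>U. ((\<lambda>t. g (x(i := t))) has_real_derivative g' x) (at (x i))" "Ck_fun k n U g'"
      using Suc.prems i by (metis Ck_fun.simps(2))
    show ?thesis
      by (rule exI[of _ "\<lambda>x. f' x * g x + g' x * f x"])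
         (use f' g' Suc.IH Suc.prems[THEN Ck_fun_Suc_imp] in \<open>auto intro!: derivative_eq_intros Ck_fun_add\<close>)
  qed
  with Suc.prems show ?case by (auto intro: continuous_map_real_mult)
qed

text \<open>All derivatives are handled at once by an outer function taken from a family \<open>F\<close> in which
  every derivative is a combination of two members, as for powers and for \<open>flat\<close> below.\<close>

lemma Ck_fun_comp_real:
  fixes F :: "'p \<Rightarrow> real \<Rightarrow> real" and a b :: "'p \<Rightarrow> real" and \<sigma> \<tau> :: "'p \<Rightarrow> 'p"
  assumes D: "\<And>p t. t \<in> S \<Longrightarrow> (F p has_real_derivative a p * F (\<sigma> p) t + b p * F (\<tau> p) t) (at t)"
    and "Ck_fun k n U u" "\<And>x. x \<in> U \<Longrightarrow> u x \<in> S" "U \<subseteq> EE n"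
  shows "Ck_fun k n U (\<lambda>x. F p (u x))"
  using assms(2)
proof (induction k arbitrary: p)
  case 0
  have "continuous_on S (F p)" for p
    using D by (meson DERIV_isCont continuous_at_imp_continuous_on)
  then have "continuous_map (top_of_set S) euclideanreal (F p)" for p
    by simp
  moreover have "continuous_map (subtopology (Euclidean_space n) U) (top_of_set S) u"
    using 0 assms(3) by (auto simp: continuous_map_in_subtopology)
  ultimately show ?case
    using continuous_map_compose[of _ _ u euclideanreal "F p"] by (simp add: o_def)
next
  case (Suc k)
  have c: "continuous_map (subtopology (Euclidean_space n) U) euclideanreal (\<lambda>x. F p (u x))" for p
    using Suc.IH[OF Ck_fun_Suc_imp[OF Suc.prems]] by (rule Ck_fun_continuous)
  have "\<exists>h'. (\<forall>x\<in>U. ((\<lambda>t. F p (u (x(i := t)))) has_real_derivative h' x) (at (x i))) \<and> Ck_fun k n U h'"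
    if i: "i < n" for i
  proof -
    obtain u' where u': "\<forall>x\<in>U. ((\<lambda>t. u (x(i := t))) has_real_derivative u' x) (at (x i))" "Ck_fun k n U u'"
      using Suc.prems i by auto
    let ?h = "\<lambda>x. (a p * F (\<sigma> p) (u x) + b p * F (\<tau> p) (u x)) * u' x"
    have "((\<lambda>t. F p (u (x(i := t)))) has_real_derivative ?h x) (at (x i))" if x: "x \<in> U" for x
    proof -
      have "(F p has_real_derivative a p * F (\<sigma> p) (u x) + b p * F (\<tau> p) (u x)) (at (u (x(i := x i))))"
        using D assms(3) x by simp
      from DERIV_chain2[OF this u'(1)[rule_format, OF x]] show ?thesis .
    qed
    moreover have "Ck_fun k n U ?h"
      using Suc.IH[OF Ck_fun_Suc_imp[OF Suc.prems]]
      by (intro Ck_fun_mult[OF Ck_fun_add[OF Ck_fun_mult[OF Ck_fun_const] Ck_fun_mult[OF Ck_fun_const]] u'(2)])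
    ultimately show ?thesis by (intro exI[of _ ?h] conjI ballI)
  qed
  with c show ?case by simp
qed

lemma Ck_fun_local:
  assumes "\<And>x. x \<in> U \<Longrightarrow> \<exists>W. openin (Euclidean_space n) W \<and> x \<in> W \<and> W \<subseteq> U \<and> Ck_fun k n W f"
  shows "Ck_fun k n U f"
  using assms
proof (induction k arbitrary: f)
  case 0
  have U: "openin (Euclidean_space n) U"
    using 0 by (subst openin_subopen) blast
  obtain W where W: "\<And>x. x \<in> U \<Longrightarrow> openin (Euclidean_space n) (W x) \<and> x \<in> W x \<and> W x \<subseteq> U \<and> Ck_fun 0 n (W x) f"
    using 0 by metis
  have "continuous_map (subtopology (Euclidean_space n) U) euclideanreal f"
  proof (rule pasting_lemma[where I=U and T=W and f="\<lambda>_. f"])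
    fix i assume "i \<in> U"
    then show "openin (subtopology (Euclidean_space n) U) (W i)"
      using W openin_open_subtopology[OF U] by auto
    show "continuous_map (subtopology (subtopology (Euclidean_space n) U) (W i)) euclideanreal f"
      using W[OF \<open>i \<in> U\<close>] by (simp add: subtopology_subtopology Int_absorb1)
  qed (use W in auto)
  then show ?case by simp
next
  case (Suc k)
  have U: "openin (Euclidean_space n) U"
    using Suc.prems by (subst openin_subopen) blast
  have c: "Ck_fun k n U f"
  proof (rule Suc.IH)
    fix x assume "x \<in> U"
    from Suc.prems[OF this] show "\<exists>W. openin (Euclidean_space n) W \<and> x \<in> W \<and> W \<subseteq> U \<and> Ck_fun k n W f"
      using Ck_fun_Suc_imp by metis
  qed
  have "\<exists>f'. (\<forall>x\<in>U. ((\<lambda>t. f (x(i := t))) has_real_derivative f' x) (at (x i))) \<and> Ck_fun k n U f'"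
    if i: "i < n" for i
  proof -
    \<comment> \<open>The neighbourhoods W come with unrelated witnesses \<open>f'\<close>.
      Uniqueness of derivatives makes them agree on overlaps, so one function serves all of
      U.\<close>
    define d where "d x = (THE d. ((\<lambda>t. f (x(i := t))) has_real_derivative d) (at (x i)))" for x
    have d: "d x = d'" if "((\<lambda>t. f (x(i := t))) has_real_derivative d') (at (x i))" for x d'
      unfolding d_def using that DERIV_unique by blast
    have loc: "\<exists>W. openin (Euclidean_space n) W \<and> x \<in> W \<and> W \<subseteq> U \<and> Ck_fun k n W d \<and>
        ((\<lambda>t. f (x(i := t))) has_real_derivative d x) (at (x i))" if x: "x \<in> U" for x
    proof -
      obtain W where W: "openin (Euclidean_space n) W" "x \<in> W" "W \<subseteq> U" "Ck_fun (Suc k) n W f"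
        using Suc.prems x by blast
      then obtain f' where f': "\<forall>x\<in>W. ((\<lambda>t. f (x(i := t))) has_real_derivative f' x) (at (x i))"
        "Ck_fun k n W f'"
        using i by auto
      then have eq: "\<And>x. x \<in> W \<Longrightarrow> f' x = d x"
        using d by force
      then have "Ck_fun k n W d"
        by (rule Ck_fun_cong[OF W(1) _ f'(2)])
      moreover have "((\<lambda>t. f (x(i := t))) has_real_derivative d x) (at (x i))"
        using W(2) f'(1) eq by simp
      ultimately show ?thesis
        using W(1-3) by (intro exI[of _ W] conjI)
    qed
    have "Ck_fun k n U d"
      using loc by (intro Suc.IH) meson
    moreover have "\<forall>x\<in>U. ((\<lambda>t. f (x(i := t))) has_real_derivative d x) (at (x i))"
      using loc by meson
    ultimately show ?thesis
      by (intro exI[of _ d] conjI)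
  qed
  then show ?case
    unfolding Ck_fun.simps(2) using Ck_fun_continuous[OF c] by metis
qed

section \<open>Closure properties of smooth functions, and cut-off functions\<close>

lemma smooth_fun_cong:
  "smooth_fun n U f \<Longrightarrow> (\<And>y. y \<in> U \<Longrightarrow> f y = g y) \<Longrightarrow> smooth_fun n U g"
  unfolding smooth_fun_def by (intro conjI allI) (simp, rule Ck_fun_cong[of n U f g], simp_all)

lemma smooth_fun_const: "openin (Euclidean_space n) U \<Longrightarrow> smooth_fun n U (\<lambda>_. c)"
  by (simp add: smooth_fun_def Ck_fun_const)

lemma smooth_fun_coord: "openin (Euclidean_space n) U \<Longrightarrow> smooth_fun n U (\<lambda>x. x i)"
  by (simp add: smooth_fun_def Ck_fun_coord)

lemma smooth_fun_add: "smooth_fun n U f \<Longrightarrow> smooth_fun n U g \<Longrightarrow> smooth_fun n U (\<lambda>x. f x + g x)"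
  by (simp add: smooth_fun_def Ck_fun_add)

lemma smooth_fun_mult: "smooth_fun n U f \<Longrightarrow> smooth_fun n U g \<Longrightarrow> smooth_fun n U (\<lambda>x. f x * g x)"
  by (simp add: smooth_fun_def Ck_fun_mult)

lemma smooth_fun_diff: "smooth_fun n U f \<Longrightarrow> smooth_fun n U g \<Longrightarrow> smooth_fun n U (\<lambda>x. f x - g x)"
  using smooth_fun_add[of n U f "\<lambda>x. -1 * g x"] smooth_fun_mult[of n U "\<lambda>_. -1" g] smooth_fun_const[of n U "-1"]
  by (simp add: smooth_fun_def)

lemma smooth_fun_sum:
  assumes "openin (Euclidean_space n) U" "\<And>i. i \<in> I \<Longrightarrow> smooth_fun n U (f i)"
  shows "smooth_fun n U (\<lambda>x. \<Sum>i\<in>I. f i x)"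
  using assms(2)
  by (induction I rule: infinite_finite_induct) (simp_all add: smooth_fun_const[OF assms(1)] smooth_fun_add)

lemma smooth_fun_subset:
  "smooth_fun n U f \<Longrightarrow> openin (Euclidean_space n) V \<Longrightarrow> V \<subseteq> U \<Longrightarrow> smooth_fun n V f"
  unfolding smooth_fun_def by (intro conjI allI) (simp, rule Ck_fun_subset[of _ n U f V], simp_all)

lemma smooth_fun_local:
  assumes "\<And>x. x \<in> U \<Longrightarrow> \<exists>W. openin (Euclidean_space n) W \<and> x \<in> W \<and> W \<subseteq> U \<and> smooth_fun n W f"
  shows "smooth_fun n U f"
  unfolding smooth_fun_def
proof (intro conjI allI)
  show "openin (Euclidean_space n) U"
    using assms by (subst openin_subopen) blast
  show "Ck_fun k n U f" for k
    using assms by (intro Ck_fun_local) (meson smooth_fun_def)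
qed

text \<open>The source of quotients (exponent -1) and of the inverse norm (exponent -1/2). The
  powers are a family closed under differentiation; the second summand of
  \<open>Ck_fun_comp_real\<close> is switched off by the coefficient 0.\<close>

lemma smooth_fun_powr:
  assumes "smooth_fun n U u" "\<And>x. x \<in> U \<Longrightarrow> 0 < u x"
  shows "smooth_fun n U (\<lambda>x. u x powr p)"
proof -
  have "Ck_fun k n U (\<lambda>x. u x powr p)" for k
  proof (rule Ck_fun_comp_real[where F="\<lambda>p t. t powr p" and a="\<lambda>p. p" and \<sigma>="\<lambda>p. p - 1" and b="\<lambda>_. 0"
        and \<tau>="\<lambda>p. p" and S="{0<..}"])
    show "Ck_fun k n U u" "U \<subseteq> EE n"
      using assms(1) openin_subset by (auto simp: smooth_fun_def)
  qed (use assms(2) in \<open>auto intro!: derivative_eq_intros\<close>)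
  then show ?thesis
    using assms(1) by (simp add: smooth_fun_def)
qed

text \<open>\<open>flat 0\<close> is the classical exp(-1/t) extended by 0; the index p records the
  powers of 1/t that differentiation produces.\<close>

definition flat :: "nat \<Rightarrow> real \<Rightarrow> real" where
  "flat p t = (if t > 0 then (1 / t) ^ p * exp (- (1 / t)) else 0)"

text \<open>From the right, the substitution x = 1/t reduces this to the decay of x^p / exp x at
  infinity.\<close>

lemma tendsto_flat: "(flat p \<longlongrightarrow> 0) (at 0)"
proof -
  have "((\<lambda>t::real. (1/t) ^ p * exp (- (1/t))) \<longlongrightarrow> 0) (at_right 0)"
  proof -
    have "((\<lambda>x::real. x ^ p / exp x) \<longlongrightarrow> 0) at_top"
      by (rule tendsto_power_div_exp_0)
    then have "((\<lambda>x. inverse x ^ p / exp (inverse x)) \<longlongrightarrow> 0) (at_right (0::real))"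
      using filterlim_compose[OF _ filterlim_inverse_at_top_right] by blast
    then show ?thesis
      by (simp add: exp_minus divide_inverse)
  qed
  moreover have "\<forall>\<^sub>F t in at_right 0. (1/t) ^ p * exp (- (1/t)) = flat p t"
    by (auto simp: flat_def eventually_at_right_field intro!: exI[of _ 1])
  ultimately have "(flat p \<longlongrightarrow> 0) (at_right 0)"
    by (rule Lim_transform_eventually)
  moreover have "(flat p \<longlongrightarrow> 0) (at_left 0)"
    by (rule tendsto_eventually) (auto simp: flat_def eventually_at_left_field intro!: exI[of _ "-1"])
  ultimately show ?thesis
    by (simp add: filterlim_at_split)
qed

lemma DERIV_flat: "(flat p has_real_derivative 1 * flat (p + 2) t + (- real p) * flat (p + 1) t) (at t)"
proof -
  consider "t > 0" | "t < 0" | "t = 0" by linarith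
  then show ?thesis
  proof cases
    case 1
    have i: "((\<lambda>t. 1 / t) has_real_derivative - ((1 / t) ^ 2)) (at t)"
      using 1 by (auto intro!: derivative_eq_intros simp: power2_eq_square)
    have "exp (- (1 / t)) * (- (- ((1 / t) ^ 2))) * (1 / t) ^ p
            + (real p * (- ((1 / t) ^ 2) * (1 / t) ^ (p - Suc 0))) * exp (- (1 / t)) =
          1 * flat (p + 2) t + (- real p) * flat (p + 1) t"
      using 1 by (cases p) (simp_all add: flat_def power2_eq_square algebra_simps add_divide_distrib diff_divide_distrib)
    moreover have "((\<lambda>t. (1 / t) ^ p * exp (- (1 / t))) has_real_derivative
        (real p * (- ((1 / t) ^ 2) * (1 / t) ^ (p - Suc 0))) * exp (- (1 / t))
        + exp (- (1 / t)) * (- (- ((1 / t) ^ 2))) * (1 / t) ^ p) (at t)"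
      by (intro DERIV_mult DERIV_power i DERIV_fun_exp DERIV_minus)
    ultimately have "((\<lambda>t. (1 / t) ^ p * exp (- (1 / t))) has_real_derivative
        1 * flat (p + 2) t + (- real p) * flat (p + 1) t) (at t)"
      by (simp only: add.commute)
    then show ?thesis
      by (rule has_field_derivative_transform_within_open[of _ _ _ "{0<..}"]) (use 1 in \<open>auto simp: flat_def\<close>)
  next
    case 2
    have "((\<lambda>t. 0) has_real_derivative 1 * flat (p + 2) t + (- real p) * flat (p + 1) t) (at t)"
      using 2 by (simp add: flat_def)
    then show ?thesis
      by (rule has_field_derivative_transform_within_open[of _ _ _ "{..<0}"]) (use 2 in \<open>auto simp: flat_def\<close>)
  next
    case 3
    \<comment> \<open>At 0 the difference quotient of \<open>flat p\<close> is
      \<open>flat (p + 1)\<close>, whose limit is known.\<close>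
    have "((\<lambda>h. (flat p (0 + h) - flat p 0) / h) \<longlongrightarrow> 0) (at 0)"
      by (rule Lim_transform_eventually[OF tendsto_flat[of "p + 1"]])
         (auto simp: flat_def eventually_at_filter)
    then show ?thesis
      using 3 by (simp add: DERIV_def flat_def)
  qed
qed

lemma smooth_fun_flat:
  assumes "smooth_fun n U u"
  shows "smooth_fun n U (\<lambda>x. flat p (u x))"
proof -
  have "Ck_fun k n U (\<lambda>x. flat p (u x))" for k
  proof (rule Ck_fun_comp_real[where F=flat and a="\<lambda>_. 1" and \<sigma>="\<lambda>p. p + 2" and b="\<lambda>p. - real p"
        and \<tau>="\<lambda>p. p + 1" and S=UNIV])
    show "Ck_fun k n U u" "U \<subseteq> EE n"
      using assms openin_subset by (auto simp: smooth_fun_def)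
  qed (use DERIV_flat in auto)
  then show ?thesis
    using assms by (simp add: smooth_fun_def)
qed

lemma flat_0: "flat 0 t = (if t > 0 then exp (- (1 / t)) else 0)"
  by (simp add: flat_def)

text \<open>The usual quotient of flat functions, with the transition squeezed into [1/3, 2/3].
  Arguments merely close to 0 or 1 already give the exact values, so a cut-off composed with it is
  constant on open sets.\<close>

definition smooth_step :: "real \<Rightarrow> real" where
  "smooth_step t = flat 0 (t - 1/3) * (flat 0 (t - 1/3) + flat 0 (2/3 - t)) powr (- 1)"

lemma smooth_step_denom_pos: "0 < flat 0 (t - 1/3) + flat 0 (2/3 - t)"
  by (simp add: flat_0 add_pos_pos)

lemma smooth_step_bounds: "0 \<le> smooth_step t" "smooth_step t \<le> 1"
  and smooth_step_0: "t \<le> 1/3 \<Longrightarrow> smooth_step t = 0"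
  and smooth_step_1: "2/3 \<le> t \<Longrightarrow> smooth_step t = 1"
proof -
  let ?d = "flat 0 (t - 1/3) + flat 0 (2/3 - t)"
  have e: "smooth_step t = flat 0 (t - 1/3) / ?d"
    using smooth_step_denom_pos[of t] by (simp add: smooth_step_def powr_minus_divide)
  have f: "0 \<le> flat 0 s" for s
    by (simp add: flat_0)
  show "0 \<le> smooth_step t" "smooth_step t \<le> 1"
    using smooth_step_denom_pos[of t] f by (simp_all add: e divide_le_eq)
  show "t \<le> 1/3 \<Longrightarrow> smooth_step t = 0"
    by (simp add: e flat_0)
  show "2/3 \<le> t \<Longrightarrow> smooth_step t = 1"
    by (simp add: e flat_0)
qed

lemma smooth_fun_smooth_step:
  assumes "smooth_fun n U u"
  shows "smooth_fun n U (\<lambda>x. smooth_step (u x))"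
proof -
  have "openin (Euclidean_space n) U"
    using assms by (simp add: smooth_fun_def)
  then show ?thesis
    unfolding smooth_step_def
    by (intro smooth_fun_mult smooth_fun_powr smooth_fun_add smooth_fun_flat smooth_fun_diff
        smooth_fun_const assms smooth_step_denom_pos)
qed

section \<open>Smooth functions on manifolds\<close>

lemma Euclidean_ball_subset:
  assumes "openin (Euclidean_space m) U" "c \<in> U"
  obtains e where "0 < e" "\<And>y. y \<in> EE m \<Longrightarrow> (\<Sum>i<m. (y i - c i)\<^sup>2) < e \<Longrightarrow> y \<in> U"
proof -
  obtain W where W: "openin (powertop_real UNIV) W" "U = W \<inter> EE m"
    using assms(1) unfolding Euclidean_space_def by (auto simp: openin_subtopology topspace_Euclidean_space)
  obtain X where X: "c \<in> Pi\<^sub>E UNIV X" "\<And>i. open (X i)" "Pi\<^sub>E UNIV X \<subseteq> W"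
    using product_topology_open_contains_basis[OF W(1), of c] assms(2) W(2) by auto
  have "\<exists>d>0. \<forall>t. \<bar>t - c i\<bar> < d \<longrightarrow> t \<in> X i" for i
    using X(1,2) by (metis PiE_E UNIV_I dist_real_def open_dist)
  then obtain d where d: "\<And>i. d i > 0" "\<And>i t. \<bar>t - c i\<bar> < d i \<Longrightarrow> t \<in> X i"
    by metis
  \<comment> \<open>The extra element 1 keeps the minimum meaningful for m = 0.\<close>
  define e where "e = Min (insert 1 ((\<lambda>i. (d i)\<^sup>2) ` {..<m}))"
  have "0 < e"
    unfolding e_def using d(1) by (subst Min_gr_iff) (auto simp: less_imp_neq[THEN not_sym])
  moreover have "y \<in> U" if y: "y \<in> EE m" "(\<Sum>i<m. (y i - c i)\<^sup>2) < e" for y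
  proof -
    have "y i \<in> X i" for i
    proof (cases "i < m")
      case True
      have "(y i - c i)\<^sup>2 \<le> (\<Sum>i<m. (y i - c i)\<^sup>2)"
        using True by (intro member_le_sum) auto
      also have "\<dots> < e" by fact
      also have "e \<le> (d i)\<^sup>2"
        unfolding e_def using True by (intro Min_le) auto
      finally have "\<bar>y i - c i\<bar> < d i"
        using d(1)[of i] by (metis abs_of_pos less_eq_real_def power2_abs power_less_imp_less_base)
      then show ?thesis by (rule d(2))
    next
      case False
      then have "y i = c i"
        using y(1) assms(2) W(2) by (auto simp: topspace_Euclidean_space)
      then show ?thesis
        using X(1) by (auto simp: PiE_def)
    qed
    then have "y \<in> W"
      using X(3) by (auto simp: PiE_def)
    then show ?thesis
      using y(1) W(2) by blast
  qed
  ultimately show ?thesis using that by blast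
qed

lemma continuous_map_sumsq:
  "continuous_map (Euclidean_space m) euclideanreal (\<lambda>y. \<Sum>i<k. (y i - c i)\<^sup>2)"
proof -
  have "continuous_map (Euclidean_space m) euclideanreal (\<lambda>y. y i)" for i
    unfolding Euclidean_space_def
    by (intro continuous_map_from_subtopology continuous_map_product_projection UNIV_I)
  then show ?thesis
    by (intro continuous_intros) auto
qed

text \<open>A closed subset of a product of compact intervals; the factors {0} beyond m keep the box
  inside \<open>EE m\<close>.\<close>

lemma compactin_Euclidean_ball:
  "compactin (Euclidean_space m) {y \<in> EE m. (\<Sum>i<m. (y i - c i)\<^sup>2) \<le> e}"
proof -
  define B where "B i = (if i < m then {c i - sqrt e..c i + sqrt e} else {0})" for i
  have "compactin (powertop_real UNIV) (Pi\<^sub>E UNIV B)"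
    by (subst compactin_PiE) (auto simp: B_def)
  moreover have sub: "Pi\<^sub>E UNIV B \<subseteq> EE m"
    by (auto simp: B_def topspace_Euclidean_space PiE_def Pi_iff) (metis less_le_not_le singletonD)
  ultimately have cB: "compactin (Euclidean_space m) (Pi\<^sub>E UNIV B)"
    by (auto simp: Euclidean_space_def compactin_subtopology topspace_Euclidean_space)
  have "closedin (Euclidean_space m) {y \<in> EE m. (\<Sum>i<m. (y i - c i)\<^sup>2) \<in> {..e}}"
    by (rule closedin_continuous_map_preimage[OF continuous_map_sumsq]) simp
  then have clo: "closedin (Euclidean_space m) {y \<in> EE m. (\<Sum>i<m. (y i - c i)\<^sup>2) \<le> e}"
    by simp
  have sub': "{y \<in> EE m. (\<Sum>i<m. (y i - c i)\<^sup>2) \<le> e} \<subseteq> Pi\<^sub>E UNIV B"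
  proof safe
    fix y i assume y: "y \<in> EE m" "(\<Sum>i<m. (y i - c i)\<^sup>2) \<le> e"
    show "y i \<in> B i"
    proof (cases "i < m")
      case True
      have "(y i - c i)\<^sup>2 \<le> (\<Sum>i<m. (y i - c i)\<^sup>2)"
        using True by (intro member_le_sum) auto
      then have "\<bar>y i - c i\<bar> \<le> sqrt e"
        using y(2) real_le_rsqrt by fastforce
      then show ?thesis
        using True by (auto simp: B_def)
    qed (use y(1) in \<open>auto simp: B_def topspace_Euclidean_space\<close>)
  qed auto
  show ?thesis
    by (rule closed_compactin[OF cB sub' clo])
qed

lemma plots_sub_diff [simp]: "P \<in> plots (sub_diff X V) n U \<longleftrightarrow> P \<in> plots X n U \<and> P \<in> U \<rightarrow> V"
  by (simp add: sub_diff_def)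

lemma points_sub_diff [simp]: "points (sub_diff X V) = points X \<inter> V"
  by (simp add: sub_diff_def)

lemma plots_real_diff [simp]: "P \<in> plots real_diff n U \<longleftrightarrow> smooth_fun n U P"
  by (simp add: real_diff_def)

section \<open>Plots and the D-topology of a manifold\<close>

locale manifold =
  fixes m :: nat and T :: "'m topology" and \<A> :: "('m set \<times> ('m \<Rightarrow> nat \<Rightarrow> real)) set"
  assumes manifold: "smooth_manifold m T \<A>"
begin

abbreviation \<M> :: "'m diffeology" where "\<M> \<equiv> manifold_diff m T \<A>"

lemma Hausdorff: "Hausdorff_space T"
  and paracompact: "paracompact_space T"
  and atlas_cover: "\<And>x. x \<in> topspace T \<Longrightarrow> \<exists>W \<phi>. (W, \<phi>) \<in> \<A> \<and> x \<in> W"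
  using manifold unfolding smooth_manifold_def by blast+

lemma chart:
  assumes "(W, \<phi>) \<in> \<A>"
  shows "openin T W" "openin (Euclidean_space m) (\<phi> ` W)"
    "homeomorphic_map (subtopology T W) (subtopology (Euclidean_space m) (\<phi> ` W)) \<phi>"
  using assms manifold unfolding smooth_manifold_def by blast+

lemma transition:
  assumes "(W, \<phi>) \<in> \<A>" "(W', \<psi>) \<in> \<A>"
  shows "smooth_eucl m (\<phi> ` (W \<inter> W')) m (\<psi> ` (W \<inter> W')) (\<psi> \<circ> inv_into W \<phi>)"
proof -
  have "\<forall>(W, \<phi>)\<in>\<A>. \<forall>(W', \<psi>)\<in>\<A>. smooth_eucl m (\<phi> ` (W \<inter> W')) m (\<psi> ` (W \<inter> W')) (\<psi> \<circ> inv_into W \<phi>)"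
    using manifold unfolding smooth_manifold_def by blast
  then show ?thesis using assms by auto
qed

lemma chart_inj: "(W, \<phi>) \<in> \<A> \<Longrightarrow> inj_on \<phi> W"
  using homeomorphic_imp_injective_map[OF chart(3)] chart(1) openin_subset
  by (metis inf.absorb_iff2 topspace_subtopology)

lemma chart_inv_continuous:
  assumes "(W, \<phi>) \<in> \<A>"
  shows "continuous_map (subtopology (Euclidean_space m) (\<phi> ` W)) T (inv_into W \<phi>)"
proof -
  have W: "W \<subseteq> topspace T" "\<phi> ` W \<subseteq> EE m"
    using chart[OF assms] openin_subset by blast+
  obtain g where g: "homeomorphic_maps (subtopology T W) (subtopology (Euclidean_space m) (\<phi> ` W)) \<phi> g"
    using chart(3)[OF assms] homeomorphic_map_maps by blast
  have "continuous_map (subtopology (Euclidean_space m) (\<phi> ` W)) T g"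
    using g unfolding homeomorphic_maps_def using continuous_map_in_subtopology by blast
  moreover have "g y = inv_into W \<phi> y" if "y \<in> \<phi> ` W" for y
  proof -
    obtain x where x: "x \<in> W" "y = \<phi> x"
      using \<open>y \<in> \<phi> ` W\<close> by blast
    moreover have "g (\<phi> x) = x"
      using g x(1) W unfolding homeomorphic_maps_def by auto
    ultimately show ?thesis
      using chart_inj[OF assms] by simp
  qed
  ultimately show ?thesis
    by (rule continuous_map_eq) auto
qed

lemma points_manifold [simp]: "points \<M> = topspace T"
  by (simp add: manifold_diff_def)

lemma plotD:
  assumes "P \<in> plots \<M> n U"
  shows "openin (Euclidean_space n) U" "continuous_map (subtopology (Euclidean_space n) U) T P"
    "P \<in> U \<rightarrow> topspace T"
    "(W, \<phi>) \<in> \<A> \<Longrightarrow> smooth_eucl n {x \<in> U. P x \<in> W} m (\<phi> ` W) (\<phi> \<circ> P)"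
proof -
  show o: "openin (Euclidean_space n) U" and c: "continuous_map (subtopology (Euclidean_space n) U) T P"
    using assms by (simp_all add: manifold_diff_def)
  show "P \<in> U \<rightarrow> topspace T"
    using c openin_subset[OF o] by (auto simp: continuous_map_def)
  show "(W, \<phi>) \<in> \<A> \<Longrightarrow> smooth_eucl n {x \<in> U. P x \<in> W} m (\<phi> ` W) (\<phi> \<circ> P)"
    using assms by (auto simp: manifold_diff_def)
qed

lemma plot_vimage_open:
  assumes "P \<in> plots \<M> n U" "openin T W"
  shows "openin (Euclidean_space n) {x \<in> U. P x \<in> W}"
proof -
  have U: "U \<subseteq> EE n" "openin (Euclidean_space n) U"
    using plotD(1)[OF assms(1)] openin_subset by auto
  have "openin (subtopology (Euclidean_space n) U) {x \<in> topspace (subtopology (Euclidean_space n) U). P x \<in> W}"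
    using plotD(2)[OF assms(1)] assms(2) openin_continuous_map_preimage by blast
  moreover have "topspace (subtopology (Euclidean_space n) U) = U"
    using U by auto
  ultimately show ?thesis
    using U(2) openin_trans_full by metis
qed

lemma plot_subset:
  assumes "P \<in> plots \<M> n U" "openin (Euclidean_space n) V" "V \<subseteq> U"
  shows "P \<in> plots \<M> n V"
proof -
  have c: "continuous_map (subtopology (Euclidean_space n) V) T P"
    using plotD(2)[OF assms(1)] assms(3) continuous_map_from_subtopology_mono by blast
  have "smooth_eucl n {x \<in> V. P x \<in> W} m (\<phi> ` W) (\<phi> \<circ> P)" if W: "(W, \<phi>) \<in> \<A>" for W \<phi>
  proof (rule smooth_eucl_subset[OF plotD(4)[OF assms(1) W]])
    have "{x \<in> V. P x \<in> W} = V \<inter> {x \<in> U. P x \<in> W}"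
      using assms(3) by auto
    then show "openin (Euclidean_space n) {x \<in> V. P x \<in> W}"
      using assms(2) plot_vimage_open[OF assms(1) chart(1)[OF W]] by auto
  qed (use assms(3) in auto)
  with c assms(2) show ?thesis
    by (auto simp: manifold_diff_def)
qed

lemma inv_chart_plot:
  assumes "(W, \<phi>) \<in> \<A>"
  shows "inv_into W \<phi> \<in> plots \<M> m (\<phi> ` W)"
proof -
  have "smooth_eucl m {x \<in> \<phi> ` W. inv_into W \<phi> x \<in> W'} m (\<psi> ` W') (\<psi> \<circ> inv_into W \<phi>)"
    if W': "(W', \<psi>) \<in> \<A>" for W' \<psi>
  proof -
    have "{x \<in> \<phi> ` W. inv_into W \<phi> x \<in> W'} = \<phi> ` (W \<inter> W')"
      using chart_inj[OF assms] by auto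
    moreover have "\<psi> ` W' \<subseteq> EE m"
      using chart(2)[OF W'] openin_subset by blast
    ultimately show ?thesis
      using transition[OF assms W'] unfolding smooth_eucl_def by auto
  qed
  with chart(2)[OF assms] chart_inv_continuous[OF assms] show ?thesis
    by (auto simp: manifold_diff_def)
qed

text \<open>Inverse charts are plots, so a D-open set has open image in every chart, and charts are
  homeomorphisms.\<close>

lemma D_topology_manifold: "D_topology \<M> = T"
proof (rule topology_eq[THEN iffD2], intro allI iffI)
  fix W assume "openin T W"
  then show "openin (D_topology \<M>) W"
    unfolding openin_D_topology D_open_def using plot_vimage_open openin_subset[of T W]
    by (simp add: points_manifold)
next
  fix W assume "openin (D_topology \<M>) W"
  then have W: "D_open \<M> W" by (simp add: openin_D_topology)
  show "openin T W"
  proof (subst openin_subopen, intro ballI)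
    fix x assume x: "x \<in> W"
    then have "x \<in> topspace T"
      using W by (auto simp: D_open_def)
    then obtain C \<phi> where C: "(C, \<phi>) \<in> \<A>" "x \<in> C"
      using atlas_cover by blast
    let ?O = "{y \<in> \<phi> ` C. inv_into C \<phi> y \<in> W}"
    have "openin (Euclidean_space m) ?O"
      using W inv_chart_plot[OF C(1)] by (simp add: D_open_def)
    then have "openin (subtopology (Euclidean_space m) (\<phi> ` C)) ?O"
      by (simp add: chart(2)[OF C(1)] openin_open_subtopology)
    then have "openin (subtopology T C) {x \<in> topspace (subtopology T C). \<phi> x \<in> ?O}"
      using chart(3)[OF C(1)] homeomorphic_imp_continuous_map openin_continuous_map_preimage by blast
    from openin_trans_full[OF this chart(1)[OF C(1)]]
    have "openin T {x \<in> topspace (subtopology T C). \<phi> x \<in> ?O}" .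
    moreover have "{x \<in> topspace (subtopology T C). \<phi> x \<in> ?O} = C \<inter> W"
      using openin_subset[OF chart(1)[OF C(1)]] inv_into_f_f[OF chart_inj[OF C(1)]]
      by (auto dest: inj_onD[OF chart_inj[OF C(1)]])
    ultimately have "openin T (C \<inter> W)"
      by simp
    then show "\<exists>S. openin T S \<and> x \<in> S \<and> S \<subseteq> W"
      using C(2) x by blast
  qed
qed

subsection \<open>Smooth real functions\<close>

text \<open>Smoothness is tested on plots instead of charts, so that every closure property is
  inherited pointwise from \<open>smooth_fun\<close> and V may be an arbitrary set.\<close>

definition msmooth :: "'m set \<Rightarrow> ('m \<Rightarrow> real) \<Rightarrow> bool" where
  "msmooth V u \<longleftrightarrow> (\<forall>n U. \<forall>P\<in>plots \<M> n U. P \<in> U \<rightarrow> V \<longrightarrow> smooth_fun n U (u \<circ> P))"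

lemma msmoothD: "msmooth V u \<Longrightarrow> P \<in> plots \<M> n U \<Longrightarrow> P \<in> U \<rightarrow> V \<Longrightarrow> smooth_fun n U (\<lambda>x. u (P x))"
  by (auto simp: msmooth_def o_def)

lemma msmooth_const: "msmooth V (\<lambda>_. c)"
  by (auto simp: msmooth_def o_def intro: smooth_fun_const plotD(1))

lemma msmooth_add: "msmooth V f \<Longrightarrow> msmooth V g \<Longrightarrow> msmooth V (\<lambda>x. f x + g x)"
  by (simp add: msmooth_def o_def smooth_fun_add)

lemma msmooth_diff: "msmooth V f \<Longrightarrow> msmooth V g \<Longrightarrow> msmooth V (\<lambda>x. f x - g x)"
  by (simp add: msmooth_def o_def smooth_fun_diff)

lemma msmooth_mult: "msmooth V f \<Longrightarrow> msmooth V g \<Longrightarrow> msmooth V (\<lambda>x. f x * g x)"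
  by (simp add: msmooth_def o_def smooth_fun_mult)

lemma msmooth_smooth_step: "msmooth V f \<Longrightarrow> msmooth V (\<lambda>x. smooth_step (f x))"
  by (simp add: msmooth_def o_def smooth_fun_smooth_step)

lemma msmooth_powr: "msmooth V f \<Longrightarrow> (\<And>x. x \<in> V \<Longrightarrow> 0 < f x) \<Longrightarrow> msmooth V (\<lambda>x. f x powr p)"
  by (auto simp: msmooth_def o_def Pi_iff intro: smooth_fun_powr)

lemma msmooth_sum: "(\<And>i. i \<in> I \<Longrightarrow> msmooth V (f i)) \<Longrightarrow> msmooth V (\<lambda>x. \<Sum>i\<in>I. f i x)"
  by (induction I rule: infinite_finite_induct) (simp_all add: msmooth_const msmooth_add)

lemma msmooth_subset: "msmooth V f \<Longrightarrow> W \<subseteq> V \<Longrightarrow> msmooth W f"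
  unfolding msmooth_def by blast

lemma msmooth_cong: "msmooth V f \<Longrightarrow> (\<And>x. x \<in> V \<Longrightarrow> f x = g x) \<Longrightarrow> msmooth V g"
  unfolding msmooth_def
proof (intro allI ballI impI)
  fix n U P
  assume f: "\<forall>n U. \<forall>P\<in>plots \<M> n U. P \<in> U \<rightarrow> V \<longrightarrow> smooth_fun n U (f \<circ> P)"
    and eq: "\<And>x. x \<in> V \<Longrightarrow> f x = g x" and P: "P \<in> plots \<M> n U" "P \<in> U \<rightarrow> V"
  show "smooth_fun n U (g \<circ> P)"
    by (rule smooth_fun_cong[of n U "f \<circ> P"]) (use f P eq in \<open>auto simp: Pi_iff\<close>)
qed

lemma msmooth_local:
  assumes "\<And>x. x \<in> V \<Longrightarrow> \<exists>W. openin T W \<and> x \<in> W \<and> msmooth W f"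
  shows "msmooth V f"
  unfolding msmooth_def o_def
proof (intro allI ballI impI)
  fix n U P assume P: "P \<in> plots \<M> n U" "P \<in> U \<rightarrow> V"
  show "smooth_fun n U (\<lambda>x. f (P x))"
  proof (rule smooth_fun_local)
    fix x assume x: "x \<in> U"
    then obtain W where W: "openin T W" "P x \<in> W" "msmooth W f"
      using assms P(2) by blast
    let ?O = "{y \<in> U. P y \<in> W}"
    have o: "openin (Euclidean_space n) ?O"
      using plot_vimage_open[OF P(1) W(1)] .
    have "smooth_fun n ?O (\<lambda>x. f (P x))"
      by (rule msmoothD[OF W(3) plot_subset[OF P(1) o]]) auto
    then show "\<exists>W. openin (Euclidean_space n) W \<and> x \<in> W \<and> W \<subseteq> U \<and> smooth_fun n W (\<lambda>x. f (P x))"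
      using o x W(2) by (intro exI[of _ ?O]) auto
  qed
qed

text \<open>Preimages of open sets are D-open because they are tested on plots, and the D-topology
  is \<open>T\<close>.\<close>

lemma msmooth_continuous:
  assumes "openin T V" "msmooth V f"
  shows "continuous_map (subtopology T V) euclideanreal f"
proof -
  have VT: "V \<subseteq> topspace T"
    using openin_subset[OF assms(1)] .
  have "openin T {x \<in> V. f x \<in> S}" if S: "open S" for S
  proof -
    have "D_open \<M> {x \<in> V. f x \<in> S}"
      unfolding D_open_def
    proof (intro conjI allI ballI)
      fix n U P assume P: "P \<in> plots \<M> n U"
      let ?O = "{y \<in> U. P y \<in> V}"
      have o: "openin (Euclidean_space n) ?O"
        using plot_vimage_open[OF P assms(1)] .
      have "smooth_fun n ?O (\<lambda>x. f (P x))"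
        by (rule msmoothD[OF assms(2) plot_subset[OF P o]]) auto
      then have "continuous_map (subtopology (Euclidean_space n) ?O) euclideanreal (\<lambda>x. f (P x))"
        using Ck_fun_continuous by (auto simp: smooth_fun_def)
      from openin_continuous_map_preimage[OF this] S
      have "openin (subtopology (Euclidean_space n) ?O)
          {x \<in> topspace (subtopology (Euclidean_space n) ?O). f (P x) \<in> S}"
        by simp
      from openin_trans_full[OF this o] have "openin (Euclidean_space n)
          {x \<in> topspace (subtopology (Euclidean_space n) ?O). f (P x) \<in> S}" .
      moreover have "{x \<in> topspace (subtopology (Euclidean_space n) ?O). f (P x) \<in> S} =
          {x \<in> U. P x \<in> {x \<in> V. f x \<in> S}}"
        using openin_subset[OF o] by auto
      ultimately show "openin (Euclidean_space n) {x \<in> U. P x \<in> {x \<in> V. f x \<in> S}}"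
        by simp
    qed (use VT in auto)
    then show ?thesis
      using openin_D_topology[of \<M>] by (simp add: D_topology_manifold)
  qed
  moreover have "topspace (subtopology T V) = V"
    using VT by auto
  ultimately show ?thesis
    using openin_open_subtopology[OF assms(1)] by (auto simp: continuous_map_def)
qed

text \<open>A flat function of the squared distance in a chart, extended by 0. It is smooth across
  the edge of the chart because its support \<open>K\<close> is compact, hence closed in the
  Hausdorff space \<open>T\<close>, so the chart and the complement of \<open>K\<close> form an open
  cover.\<close>

lemma bump_exists:
  assumes "openin T V" "x \<in> V"
  obtains b K where "msmooth UNIV b" "\<And>y. 0 \<le> b y" "0 < b x" "compactin T K" "closedin T K" "K \<subseteq> V"
    "\<And>y. y \<notin> K \<Longrightarrow> b y = 0"
proof -
  have "x \<in> topspace T"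
    using assms openin_subset by blast
  then obtain C \<phi> where C: "(C, \<phi>) \<in> \<A>" "x \<in> C"
    using atlas_cover by blast
  let ?\<kappa> = "inv_into C \<phi>"
  have CT: "C \<subseteq> topspace T" and \<phi>C: "\<phi> ` C \<subseteq> EE m"
    using chart[OF C(1)] openin_subset by auto
  note inj = chart_inj[OF C(1)]
  define c where "c = \<phi> x"
  have eq: "{y \<in> \<phi> ` C. ?\<kappa> y \<in> V} = \<phi> ` (V \<inter> C)"
    using inj by auto
  have o: "openin (Euclidean_space m) (\<phi> ` (V \<inter> C))"
    using plot_vimage_open[OF inv_chart_plot[OF C(1)] assms(1)] eq by simp
  have c: "c \<in> \<phi> ` (V \<inter> C)"
    using assms(2) C(2) by (simp add: c_def)
  obtain e where e: "0 < e" "\<And>y. y \<in> EE m \<Longrightarrow> (\<Sum>i<m. (y i - c i)\<^sup>2) < e \<Longrightarrow> y \<in> \<phi> ` (V \<inter> C)"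
    by (rule Euclidean_ball_subset[OF o c]) blast
  \<comment> \<open>Halving e puts the closed ball inside the open ball that is known to lie in the
    image of V.\<close>
  define B where "B = {y \<in> EE m. (\<Sum>i<m. (y i - c i)\<^sup>2) \<le> e/2}"
  define K where "K = ?\<kappa> ` B"
  have BV: "B \<subseteq> \<phi> ` (V \<inter> C)"
    using e by (force simp: B_def)
  have "compactin (subtopology (Euclidean_space m) (\<phi> ` C)) B"
    using compactin_Euclidean_ball[of m c "e/2"] BV
    unfolding compactin_subtopology B_def[symmetric] by blast
  then have "compactin T K"
    unfolding K_def using chart_inv_continuous[OF C(1)] image_compactin by blast
  then have clK: "compactin T K" "closedin T K"
    using Hausdorff compactin_imp_closedin by auto
  have KV: "K \<subseteq> V \<inter> C"
    using BV inj unfolding K_def by fastforce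
  define b where "b z = (if z \<in> C then flat 0 (e/2 - (\<Sum>i<m. (\<phi> z i - c i)\<^sup>2)) else 0)" for z
  have b0: "b y = 0" if "y \<notin> K" for y
  proof (rule ccontr)
    assume "b y \<noteq> 0"
    then have "y \<in> C" "(\<Sum>i<m. (\<phi> y i - c i)\<^sup>2) < e/2"
      by (auto simp: b_def flat_0 split: if_splits)
    then have "\<phi> y \<in> B"
      using \<phi>C by (auto simp: B_def)
    then have "y \<in> K"
      unfolding K_def using inj \<open>y \<in> C\<close> by (metis image_eqI inv_into_f_f)
    then show False using that by blast
  qed
  have "msmooth UNIV b"
    unfolding msmooth_def o_def
  proof (intro allI ballI impI)
    fix n U P assume P: "P \<in> plots \<M> n U" "P \<in> U \<rightarrow> UNIV"
    let ?O = "{y \<in> U. P y \<in> C}" and ?O' = "{y \<in> U. P y \<in> topspace T - K}"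
    have o: "openin (Euclidean_space n) ?O" "openin (Euclidean_space n) ?O'"
      using plot_vimage_open[OF P(1) chart(1)[OF C(1)]]
        plot_vimage_open[OF P(1) openin_diff[OF openin_topspace clK(2)]] by simp_all
    have "smooth_fun n ?O (\<lambda>x. flat 0 (e/2 - (\<Sum>i<m. (\<phi> (P x) i - c i)*(\<phi> (P x) i - c i))))"
      using plotD(4)[OF P(1) C(1)] o(1)
      by (intro smooth_fun_flat smooth_fun_diff smooth_fun_sum smooth_fun_mult smooth_fun_const)
         (auto simp: smooth_eucl_def)
    then have 1: "smooth_fun n ?O (\<lambda>x. b (P x))"
      by (rule smooth_fun_cong) (simp add: b_def power2_eq_square)
    have 2: "smooth_fun n ?O' (\<lambda>x. b (P x))"
      by (rule smooth_fun_cong[OF smooth_fun_const[OF o(2), of 0]]) (simp add: b0)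
    show "smooth_fun n U (\<lambda>x. b (P x))"
    proof (rule smooth_fun_local)
      fix x assume x: "x \<in> U"
      have "x \<in> ?O \<or> x \<in> ?O'"
        using x KV plotD(3)[OF P(1)] by auto
      then show "\<exists>W. openin (Euclidean_space n) W \<and> x \<in> W \<and> W \<subseteq> U \<and> smooth_fun n W (\<lambda>x. b (P x))"
      proof
        assume "x \<in> ?O"
        with 1 o(1) show ?thesis by (intro exI[of _ ?O]) auto
      next
        assume "x \<in> ?O'"
        with 2 o(2) show ?thesis by (intro exI[of _ ?O']) auto
      qed
    qed
  qed
  moreover have "0 \<le> b y" for y
    by (simp add: b_def flat_0)
  moreover have "0 < b x"
    using C(2) e(1) by (simp add: b_def flat_0 c_def)
  ultimately show ?thesis
    using that clK KV b0 by blast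
qed

end

context manifold begin

subsection \<open>Patching constants\<close>

lemma locally_finite_refinement_in_chart:
  assumes C: "(C, \<phi>) \<in> \<A>" and V: "openin T V" and \<U>: "\<forall>U\<in>\<U>. openin T U" "\<Union>\<U> = V"
  shows "\<exists>\<G>. (\<forall>G\<in>\<G>. openin T G \<and> (\<exists>U\<in>\<U>. G \<subseteq> U)) \<and> \<Union>\<G> = V \<inter> C \<and>
    locally_finite_in (subtopology T (V \<inter> C)) \<G>"
proof -
  let ?\<kappa> = "inv_into C \<phi>"
  have CT: "C \<subseteq> topspace T" and \<phi>C: "\<phi> ` C \<subseteq> EE m"
    using chart[OF C(1)] openin_subset by auto
  note inj = chart_inj[OF C(1)]
  have img: "openin (Euclidean_space m) (\<phi> ` (U \<inter> C))" if "openin T U" for U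
  proof -
    have "{y \<in> \<phi> ` C. ?\<kappa> y \<in> U} = \<phi> ` (U \<inter> C)"
      using inj by auto
    then show ?thesis
      using plot_vimage_open[OF inv_chart_plot[OF C(1)] that] by simp
  qed
  have pre: "openin T {z \<in> V \<inter> C. \<phi> z \<in> S}" if S: "open S" for S
  proof -
    have "continuous_map (subtopology T C) (powertop_real UNIV) \<phi>"
      using homeomorphic_imp_continuous_map[OF chart(3)[OF C]]
      by (simp add: Euclidean_space_def subtopology_subtopology continuous_map_in_subtopology)
    then have "continuous_map (subtopology T C) euclidean \<phi>"
      by (simp add: euclidean_product_topology)
    from openin_continuous_map_preimage[OF this] S
    have "openin (subtopology T C) {z \<in> topspace (subtopology T C). \<phi> z \<in> S}" by simp
    from openin_trans_full[OF this chart(1)[OF C]]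
    have "openin T (V \<inter> {z \<in> topspace (subtopology T C). \<phi> z \<in> S})"
      using V by blast
    moreover have "V \<inter> {z \<in> topspace (subtopology T C). \<phi> z \<in> S} = {z \<in> V \<inter> C. \<phi> z \<in> S}"
      using CT by auto
    ultimately show ?thesis by simp
  qed
  \<comment> \<open>The library theorem on paracompactness refines covers by open sets of the whole
    sequence space, so the images of the cover are replaced by ambient open sets that cut out
    subsets of them on \<open>EE m\<close>.\<close>
  define \<O> where "\<O> = {S. open S \<and> (\<exists>U\<in>\<U>. S \<inter> EE m \<subseteq> \<phi> ` (U \<inter> C))}"
  have cov: "\<phi> ` (V \<inter> C) \<subseteq> \<Union>\<O>"
  proof
    fix y assume "y \<in> \<phi> ` (V \<inter> C)"
    then obtain z U where z: "z \<in> U" "U \<in> \<U>" "z \<in> C" "y = \<phi> z"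
      using \<U>(2) by blast
    have "openin (top_of_set (EE m)) (\<phi> ` (U \<inter> C))"
      using img[OF \<U>(1)[rule_format, OF z(2)]] by (subst Euclidean_space_eq[symmetric])
    then obtain S where S: "open S" "\<phi> ` (U \<inter> C) = EE m \<inter> S"
      by (auto simp: openin_open)
    then have "S \<in> \<O>" "y \<in> S"
      using z by (auto simp: \<O>_def)
    then show "y \<in> \<Union>\<O>" by blast
  qed
  obtain \<O>' where O': "\<phi> ` (V \<inter> C) \<subseteq> \<Union>\<O>'"
    "\<And>S. S \<in> \<O>' \<Longrightarrow> open S \<and> (\<exists>S'. S' \<in> \<O> \<and> S \<subseteq> S')"
    "\<And>y. y \<in> \<phi> ` (V \<inter> C) \<Longrightarrow> \<exists>N. open N \<and> y \<in> N \<and> finite {S. S \<in> \<O>' \<and> (S \<inter> N \<noteq> {})}"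
    by (rule Starlike.paracompact[OF cov]) (auto simp: \<O>_def)
  define pr where "pr S = {z \<in> V \<inter> C. \<phi> z \<in> S}" for S
  show ?thesis
  proof (intro exI conjI ballI)
    fix G assume "G \<in> pr ` \<O>'"
    then obtain S where S: "S \<in> \<O>'" "G = pr S" by blast
    then show "openin T G"
      using pre O'(2) by (auto simp: pr_def)
    obtain S' where "S' \<in> \<O>" "S \<subseteq> S'"
      using O'(2) S by blast
    then obtain U where U: "U \<in> \<U>" "S' \<inter> EE m \<subseteq> \<phi> ` (U \<inter> C)"
      by (auto simp: \<O>_def)
    have "z \<in> U" if "z \<in> G" for z
    proof -
      have z: "z \<in> C" "\<phi> z \<in> S"
        using that S(2) by (auto simp: pr_def)
      then have "\<phi> z \<in> S' \<inter> EE m"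
        using \<open>S \<subseteq> S'\<close> \<phi>C by blast
      then have "\<phi> z \<in> \<phi> ` (U \<inter> C)"
        using U(2) by blast
      then show ?thesis
        using inj_onD[OF inj] z(1) by blast
    qed
    with U(1) show "\<exists>U\<in>\<U>. G \<subseteq> U" by blast
  next
    show "\<Union>(pr ` \<O>') = V \<inter> C"
      using O'(1) by (auto simp: pr_def)
  next
    show "locally_finite_in (subtopology T (V \<inter> C)) (pr ` \<O>')"
      unfolding locally_finite_in_def
    proof (intro conjI ballI)
      show "\<Union>(pr ` \<O>') \<subseteq> topspace (subtopology T (V \<inter> C))"
        using CT by (auto simp: pr_def)
      fix x assume "x \<in> topspace (subtopology T (V \<inter> C))"
      then have x: "x \<in> V \<inter> C" by auto
      then obtain N where N: "open N" "\<phi> x \<in> N" "finite {S. S \<in> \<O>' \<and> S \<inter> N \<noteq> {}}"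
        using O'(3) by blast
      have "{G \<in> pr ` \<O>'. G \<inter> pr N \<noteq> {}} \<subseteq> pr ` {S. S \<in> \<O>' \<and> S \<inter> N \<noteq> {}}"
        by (auto simp: pr_def)
      then have "finite {G \<in> pr ` \<O>'. G \<inter> pr N \<noteq> {}}"
        using N(3) finite_surj by blast
      moreover have "openin (subtopology T (V \<inter> C)) (pr N)"
        unfolding pr_def using pre[OF N(1)] V chart(1)[OF C]
        by (subst openin_open_subtopology) auto
      ultimately show "\<exists>N. openin (subtopology T (V \<inter> C)) N \<and> x \<in> N \<and> finite {G \<in> pr ` \<O>'. G \<inter> N \<noteq> {}}"
        using x N(2) by (intro exI[of _ "pr N"]) (auto simp: pr_def)
    qed
  qed
qed

text \<open>The positivity set of a bump is an open neighbourhood inside its compact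
  support.\<close>

lemma closed_nbhd:
  assumes "openin T V" "x \<in> V"
  obtains W K where "openin T W" "x \<in> W" "W \<subseteq> K" "compactin T K" "closedin T K" "K \<subseteq> V"
proof -
  obtain b K where b: "msmooth UNIV b" "\<And>y. 0 \<le> b y" "0 < b x" "compactin T K" "closedin T K" "K \<subseteq> V"
    "\<And>y. y \<notin> K \<Longrightarrow> b y = 0"
    by (rule bump_exists[OF assms]) blast
  have "continuous_map (subtopology T (topspace T)) euclideanreal b"
    by (rule msmooth_continuous[OF openin_topspace msmooth_subset[OF b(1)]]) simp
  then have "continuous_map T euclideanreal b" by simp
  from openin_continuous_map_preimage[OF this, of "{0<..}"]
  have "openin T {y \<in> topspace T. 0 < b y}" by simp
  moreover have "x \<in> {y \<in> topspace T. 0 < b y}"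
    using b(3) assms openin_subset by auto
  moreover have "{y \<in> topspace T. 0 < b y} \<subseteq> K"
  proof safe
    fix y assume "0 < b y"
    then show "y \<in> K" using b(7)[of y] by (metis less_irrefl)
  qed
  ultimately show ?thesis
    using that b(4-6) by blast
qed

text \<open>Paracompactness passes to open subsets because it holds for open subsets of charts.\<close>

lemma open_subset_paracompact:
  assumes V: "openin T V" and \<U>: "\<forall>U\<in>\<U>. openin T U" "\<Union>\<U> = V"
  shows "\<exists>\<G>. (\<forall>G\<in>\<G>. openin T G \<and> (\<exists>U\<in>\<U>. G \<subseteq> U)) \<and> \<Union>\<G> = V \<and>
    locally_finite_in (subtopology T V) \<G>"
proof -
  have VT: "V \<subseteq> topspace T"
    using openin_subset[OF V] .
  \<comment> \<open>The closed set K between W and the chart is what makes the pieces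
    \<open>G \<inter> W\<close> locally finite at points outside the chart as well: the complement
    of K is a neighbourhood that misses all of them.\<close>
  define \<C> where "\<C> = {W. openin T W \<and> (\<exists>C \<phi> K. (C, \<phi>) \<in> \<A> \<and> closedin T K \<and> W \<subseteq> K \<and> K \<subseteq> C)}"
  have "\<Union>\<C> = topspace T"
  proof
    show "\<Union>\<C> \<subseteq> topspace T"
      unfolding \<C>_def using openin_subset by blast
    show "topspace T \<subseteq> \<Union>\<C>"
    proof
      fix x assume "x \<in> topspace T"
      then obtain C \<phi> where C: "(C, \<phi>) \<in> \<A>" "x \<in> C"
        using atlas_cover by blast
      obtain W K where "openin T W" "x \<in> W" "W \<subseteq> K" "compactin T K" "closedin T K" "K \<subseteq> C"
        by (rule closed_nbhd[OF chart(1)[OF C(1)] C(2)])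
      then show "x \<in> \<Union>\<C>"
        using C(1) unfolding \<C>_def by blast
    qed
  qed
  moreover have "\<forall>U\<in>\<C>. openin T U"
    by (auto simp: \<C>_def)
  ultimately obtain \<W> where W: "\<forall>W\<in>\<W>. openin T W \<and> (\<exists>U\<in>\<C>. W \<subseteq> U)" "\<Union>\<W> = topspace T"
    "locally_finite_in T \<W>"
    using paracompact unfolding paracompact_space_def by meson
  have "\<exists>C K \<G>. openin T C \<and> closedin T K \<and> W \<subseteq> K \<and> K \<subseteq> C \<and>
      (\<forall>G\<in>\<G>. openin T G \<and> (\<exists>U\<in>\<U>. G \<subseteq> U)) \<and> \<Union>\<G> = V \<inter> C \<and>
      locally_finite_in (subtopology T (V \<inter> C)) \<G>" if "W \<in> \<W>" for W
  proof -
    obtain W' where W': "W \<subseteq> W'" "W' \<in> \<C>"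
      using W(1) \<open>W \<in> \<W>\<close> by blast
    then obtain C \<phi> K where C: "(C, \<phi>) \<in> \<A>" "closedin T K" "W' \<subseteq> K" "K \<subseteq> C"
      unfolding \<C>_def by blast
    obtain \<G> where G: "\<forall>G\<in>\<G>. openin T G \<and> (\<exists>U\<in>\<U>. G \<subseteq> U)" "\<Union>\<G> = V \<inter> C"
      "locally_finite_in (subtopology T (V \<inter> C)) \<G>"
      using locally_finite_refinement_in_chart[OF C(1) V \<U>] by (elim exE conjE) (rule that)
    have "W \<subseteq> K"
      using C(3) W'(1) by blast
    then show ?thesis
      using G C(2,4) chart(1)[OF C(1)] by (intro exI[of _ C] exI[of _ K] exI[of _ \<G>] conjI)
  qed
  then obtain C K \<G> where
    CK: "\<And>W. W \<in> \<W> \<Longrightarrow> openin T (C W) \<and> closedin T (K W) \<and> W \<subseteq> K W \<and> K W \<subseteq> C W"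
    and G: "\<And>W. W \<in> \<W> \<Longrightarrow> \<forall>G\<in>\<G> W. openin T G \<and> (\<exists>U\<in>\<U>. G \<subseteq> U)"
      "\<And>W. W \<in> \<W> \<Longrightarrow> \<Union>(\<G> W) = V \<inter> C W"
      "\<And>W. W \<in> \<W> \<Longrightarrow> locally_finite_in (subtopology T (V \<inter> C W)) (\<G> W)"
    by metis
  define \<H> where "\<H> = (\<Union>W\<in>\<W>. (\<lambda>G. G \<inter> W) ` \<G> W)"
  have "openin T H \<and> (\<exists>U\<in>\<U>. H \<subseteq> U)" if H: "H \<in> \<H>" for H
  proof -
    obtain W G' where H': "W \<in> \<W>" "G' \<in> \<G> W" "H = G' \<inter> W"
      using H unfolding \<H>_def by blast
    have "openin T G'" "\<exists>U\<in>\<U>. G' \<subseteq> U" "openin T W"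
      using G(1)[OF H'(1)] H'(2) W(1) H'(1) by simp_all
    then show ?thesis
      unfolding H'(3) by (auto intro: openin_Int)
  qed
  moreover have "\<Union>\<H> = V"
  proof
    show "\<Union>\<H> \<subseteq> V"
      using G(2) by (fastforce simp: \<H>_def)
    show "V \<subseteq> \<Union>\<H>"
    proof
      fix x assume x: "x \<in> V"
      then obtain W where W': "W \<in> \<W>" "x \<in> W"
        using W(2) VT by blast
      then have "x \<in> \<Union>(\<G> W)"
        using x CK[OF W'(1)] G(2)[OF W'(1)] by blast
      then show "x \<in> \<Union>\<H>"
        using W' by (auto simp: \<H>_def)
    qed
  qed
  moreover have "locally_finite_in (subtopology T V) \<H>"
    unfolding locally_finite_in_def
  proof (intro conjI ballI)
    show "\<Union>\<H> \<subseteq> topspace (subtopology T V)"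
      using \<open>\<Union>\<H> = V\<close> VT by simp
    fix x assume "x \<in> topspace (subtopology T V)"
    then have x: "x \<in> V" "x \<in> topspace T" by auto
    obtain Q where Q: "openin T Q" "x \<in> Q" "finite {W \<in> \<W>. W \<inter> Q \<noteq> {}}"
      using W(3) x(2) unfolding locally_finite_in_def by blast
    have "\<exists>N. openin T N \<and> x \<in> N \<and> finite {H \<in> (\<lambda>G. G \<inter> W) ` \<G> W. H \<inter> N \<noteq> {}}" if W': "W \<in> \<W>" for W
    proof (cases "x \<in> C W")
      case True
      then have "x \<in> topspace (subtopology T (V \<inter> C W))"
        using x by simp
      then obtain N where N: "openin (subtopology T (V \<inter> C W)) N" "x \<in> N" "finite {G \<in> \<G> W. G \<inter> N \<noteq> {}}"
        using G(3)[OF W'] unfolding locally_finite_in_def by blast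
      have "{H \<in> (\<lambda>G. G \<inter> W) ` \<G> W. H \<inter> N \<noteq> {}} \<subseteq> (\<lambda>G. G \<inter> W) ` {G \<in> \<G> W. G \<inter> N \<noteq> {}}"
        by auto
      then have "finite {H \<in> (\<lambda>G. G \<inter> W) ` \<G> W. H \<inter> N \<noteq> {}}"
        using N(3) finite_surj by blast
      moreover have "openin T N"
        using openin_trans_full[OF N(1)] V CK[OF W'] by blast
      ultimately show ?thesis
        using N(2) by blast
    next
      case False
      have e: "{H \<in> (\<lambda>G. G \<inter> W) ` \<G> W. H \<inter> (topspace T - K W) \<noteq> {}} = {}"
        using CK[OF W'] by blast
      have "finite {H \<in> (\<lambda>G. G \<inter> W) ` \<G> W. H \<inter> (topspace T - K W) \<noteq> {}}"
        unfolding e by simp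
      moreover have "openin T (topspace T - K W)" "x \<in> topspace T - K W"
        using CK[OF W'] False x(2) by auto
      ultimately show ?thesis
        by (intro exI[of _ "topspace T - K W"] conjI)
    qed
    then have "\<forall>W\<in>\<W>. \<exists>N. openin T N \<and> x \<in> N \<and> finite {H \<in> (\<lambda>G. G \<inter> W) ` \<G> W. H \<inter> N \<noteq> {}}"
      by (rule ballI)
    from bchoice[OF this] obtain N where N: "\<forall>W\<in>\<W>. openin T (N W) \<and> x \<in> N W \<and>
        finite {H \<in> (\<lambda>G. G \<inter> W) ` \<G> W. H \<inter> N W \<noteq> {}}" ..
    define R where "R = V \<inter> Q \<inter> \<Inter>(insert (topspace T) (N ` {W \<in> \<W>. W \<inter> Q \<noteq> {}}))"
    have "openin T (\<Inter>(insert (topspace T) (N ` {W \<in> \<W>. W \<inter> Q \<noteq> {}})))"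
      using N Q(3) by (intro openin_Inter) auto
    then have "openin T R"
      unfolding R_def using V Q(1) by blast
    then have "openin (subtopology T V) R"
      using V by (subst openin_open_subtopology) (auto simp: R_def)
    moreover have "x \<in> R"
      using x Q(2) N by (auto simp: R_def)
    moreover have "{H \<in> \<H>. H \<inter> R \<noteq> {}} \<subseteq>
        (\<Union>W\<in>{W \<in> \<W>. W \<inter> Q \<noteq> {}}. {H \<in> (\<lambda>G. G \<inter> W) ` \<G> W. H \<inter> N W \<noteq> {}})"
      unfolding \<H>_def R_def by blast
    moreover have "finite (\<Union>W\<in>{W \<in> \<W>. W \<inter> Q \<noteq> {}}. {H \<in> (\<lambda>G. G \<inter> W) ` \<G> W. H \<inter> N W \<noteq> {}})"
      using Q(3) N by blast
    ultimately show "\<exists>N. openin (subtopology T V) N \<and> x \<in> N \<and> finite {H \<in> \<H>. H \<inter> N \<noteq> {}}"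
      by (intro exI[of _ R] conjI) (auto intro: finite_subset)
  qed
  ultimately show ?thesis
    by (intro exI[of _ \<H>] conjI ballI) simp_all
qed

text \<open>Finitely many bumps are positive somewhere on each point of F by compactness; their sum
  vanishes off the finite union of their supports.\<close>

lemma compact_bump:
  assumes "compactin T F" "F \<subseteq> G" "openin T G"
  obtains \<psi> L where "msmooth UNIV \<psi>" "\<And>y. 0 \<le> \<psi> y" "\<And>y. y \<in> F \<Longrightarrow> 0 < \<psi> y" "closedin T L" "L \<subseteq> G"
    "\<And>y. y \<notin> L \<Longrightarrow> \<psi> y = 0"
proof -
  have "\<exists>b K. msmooth UNIV b \<and> (\<forall>y. 0 \<le> b y) \<and> 0 < b z \<and> closedin T K \<and> K \<subseteq> G \<and> (\<forall>y. y \<notin> K \<longrightarrow> b y = 0)"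
    if z: "z \<in> F" for z
  proof -
    have "z \<in> G" using z assms(2) by blast
    obtain b K where "msmooth UNIV b" "\<And>y. 0 \<le> b y" "0 < b z" "compactin T K" "closedin T K" "K \<subseteq> G"
      "\<And>y. y \<notin> K \<Longrightarrow> b y = 0"
      by (rule bump_exists[OF assms(3) \<open>z \<in> G\<close>]) blast
    then show ?thesis
      by (intro exI[of _ b] exI[of _ K]) simp
  qed
  then have "\<forall>z\<in>F. \<exists>b. \<exists>K. msmooth UNIV b \<and> (\<forall>y. 0 \<le> b y) \<and> 0 < b z \<and> closedin T K \<and> K \<subseteq> G \<and>
      (\<forall>y. y \<notin> K \<longrightarrow> b y = 0)"
    by (rule ballI)
  from bchoice[OF this] obtain b where "\<forall>z\<in>F. \<exists>K. msmooth UNIV (b z) \<and> (\<forall>y. 0 \<le> b z y) \<and> 0 < b z z \<and>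
      closedin T K \<and> K \<subseteq> G \<and> (\<forall>y. y \<notin> K \<longrightarrow> b z y = 0)" ..
  from bchoice[OF this] obtain K where "\<forall>z\<in>F. msmooth UNIV (b z) \<and> (\<forall>y. 0 \<le> b z y) \<and> 0 < b z z \<and>
      closedin T (K z) \<and> K z \<subseteq> G \<and> (\<forall>y. y \<notin> K z \<longrightarrow> b z y = 0)" ..
  then have b: "\<And>z. z \<in> F \<Longrightarrow> msmooth UNIV (b z)" "\<And>z y. z \<in> F \<Longrightarrow> 0 \<le> b z y"
    "\<And>z. z \<in> F \<Longrightarrow> 0 < b z z" "\<And>z. z \<in> F \<Longrightarrow> closedin T (K z)" "\<And>z. z \<in> F \<Longrightarrow> K z \<subseteq> G"
    "\<And>z y. z \<in> F \<Longrightarrow> y \<notin> K z \<Longrightarrow> b z y = 0"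
    by simp_all
  define B where "B z = {y \<in> topspace T. 0 < b z y}" for z
  have "openin T (B z)" if "z \<in> F" for z
  proof -
    have "continuous_map (subtopology T (topspace T)) euclideanreal (b z)"
      by (rule msmooth_continuous[OF openin_topspace msmooth_subset[OF b(1)[OF that]]]) simp
    then have "continuous_map T euclideanreal (b z)" by simp
    from openin_continuous_map_preimage[OF this, of "{0<..}"] show ?thesis
      by (simp add: B_def)
  qed
  moreover have "F \<subseteq> \<Union>(B ` F)"
    using b(3) compactin_subset_topspace[OF assms(1)] by (auto simp: B_def)
  ultimately obtain \<F> where \<F>: "finite \<F>" "\<F> \<subseteq> B ` F" "F \<subseteq> \<Union>\<F>"
    using compactinD[OF assms(1), of "B ` F"] by auto
  from finite_subset_image[OF \<F>(1,2)] obtain I where "I \<subseteq> F" "finite I" "\<F> = B ` I"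
    by blast
  with \<F>(3) have I: "finite I" "I \<subseteq> F" "F \<subseteq> \<Union>(B ` I)"
    by simp_all
  show thesis
  proof (rule that[of "\<lambda>y. \<Sum>z\<in>I. b z y" "\<Union>(K ` I)"])
    show "msmooth UNIV (\<lambda>y. \<Sum>z\<in>I. b z y)"
      using I(2) b(1) by (intro msmooth_sum) blast
    show "0 \<le> (\<Sum>z\<in>I. b z y)" for y
      using I(2) b(2) by (intro sum_nonneg) blast
    show "0 < (\<Sum>z\<in>I. b z y)" if "y \<in> F" for y
    proof -
      obtain z where z: "z \<in> I" "0 < b z y"
        using I(3) \<open>y \<in> F\<close> by (auto simp: B_def)
      show ?thesis
        by (rule sum_pos2[where i=z, OF I(1) z(1)]) (use I(2) b(2) z(2) in blast)+
    qed
    show "closedin T (\<Union>(K ` I))"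
      using I(1,2) b(4) by (intro closedin_Union) auto
    show "\<Union>(K ` I) \<subseteq> G"
      using I(2) b(5) by blast
    show "(\<Sum>z\<in>I. b z y) = 0" if "y \<notin> \<Union>(K ` I)" for y
      using that I(2) b(6) by (intro sum.neutral) blast
  qed
qed

text \<open>A partition of unity packaged as its only application: the value at y is a convex
  combination of the constants \<open>c x\<close> of points x whose prescribed neighbourhoods
  contain y. It yields the cut-off functions, the smooth approximation of cell coordinates, and the
  height function on M.\<close>

theorem patch_constants:
  fixes c :: "'m \<Rightarrow> nat \<Rightarrow> real"
  assumes V: "openin T V" and U: "\<And>x. x \<in> V \<Longrightarrow> openin T (U x) \<and> x \<in> U x"
  obtains F where "\<And>i. msmooth V (\<lambda>y. F y i)"
    "\<And>y. y \<in> V \<Longrightarrow> \<exists>(I :: 'm set set) a \<xi>. finite I \<and> (\<forall>j\<in>I. \<xi> j \<in> V \<and> y \<in> U (\<xi> j) \<and> 0 \<le> a j) \<and>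
       sum a I = (1::real) \<and> (\<forall>i. F y i = (\<Sum>j\<in>I. a j * c (\<xi> j) i))"
proof -
  have VT: "V \<subseteq> topspace T"
    using openin_subset[OF V] .
  \<comment> \<open>Members sit in compact subsets of \<open>U x \<inter> V\<close>, so that a
    closed subset of a member will be compact and \<open>compact_bump\<close> will apply.\<close>
  define \<U> where "\<U> = {N. openin T N \<and> (\<exists>x\<in>V. \<exists>K. compactin T K \<and> N \<subseteq> K \<and> K \<subseteq> U x \<inter> V)}"
  have "\<Union>\<U> = V"
  proof
    show "V \<subseteq> \<Union>\<U>"
    proof
      fix x assume x: "x \<in> V"
      have "openin T (U x \<inter> V)" "x \<in> U x \<inter> V"
        using U[OF x] V x by auto
      then obtain W K where "openin T W" "x \<in> W" "W \<subseteq> K" "compactin T K" "closedin T K" "K \<subseteq> U x \<inter> V"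
        by (rule closed_nbhd)
      then show "x \<in> \<Union>\<U>"
        using x unfolding \<U>_def by blast
    qed
  qed (auto simp: \<U>_def)
  moreover have "\<forall>N\<in>\<U>. openin T N"
    by (simp add: \<U>_def)
  ultimately have "\<exists>\<G>. (\<forall>G\<in>\<G>. openin T G \<and> (\<exists>N\<in>\<U>. G \<subseteq> N)) \<and> \<Union>\<G> = V \<and> locally_finite_in (subtopology T V) \<G>"
    by (intro open_subset_paracompact[OF V])
  then obtain \<G> where G0: "\<forall>G\<in>\<G>. openin T G \<and> (\<exists>N\<in>\<U>. G \<subseteq> N)" and G2: "\<Union>\<G> = V"
    and G3: "locally_finite_in (subtopology T V) \<G>"
    by (elim exE conjE) (rule that)
  note G = G0[rule_format] G2 G3
  have "\<exists>x K. x \<in> V \<and> compactin T K \<and> G \<subseteq> K \<and> K \<subseteq> U x \<inter> V" if G': "G \<in> \<G>" for G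
  proof -
    obtain N where N: "N \<in> \<U>" "G \<subseteq> N"
      using G(1)[OF G'] by blast
    then obtain x K where "x \<in> V" "compactin T K" "N \<subseteq> K" "K \<subseteq> U x \<inter> V"
      by (auto simp: \<U>_def)
    with N(2) show ?thesis
      by (intro exI[of _ x] exI[of _ K]) auto
  qed
  then obtain \<xi> K where \<xi>: "\<And>G. G \<in> \<G> \<Longrightarrow> \<xi> G \<in> V" and K: "\<And>G. G \<in> \<G> \<Longrightarrow> compactin T (K G)"
    "\<And>G. G \<in> \<G> \<Longrightarrow> G \<subseteq> K G" "\<And>G. G \<in> \<G> \<Longrightarrow> K G \<subseteq> U (\<xi> G) \<inter> V"
    by metis
  \<comment> \<open>A second refinement, by sets that a closed set separates from the complement of
    a member G, shrinks the cover: its pieces assigned to G have closures inside G.\<close>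
  define \<U>' where "\<U>' = {R. openin T R \<and> (\<exists>G\<in>\<G>. \<exists>K. closedin T K \<and> R \<subseteq> K \<and> K \<subseteq> G)}"
  have "\<Union>\<U>' = V"
  proof
    show "\<Union>\<U>' \<subseteq> V"
      using G(2) unfolding \<U>'_def by blast
    show "V \<subseteq> \<Union>\<U>'"
    proof
      fix x assume x: "x \<in> V"
      then obtain G' where G': "G' \<in> \<G>" "x \<in> G'"
        using G(2) by blast
      have "openin T G'" using G(1)[OF G'(1)] by blast
      then obtain W K where "openin T W" "x \<in> W" "W \<subseteq> K" "compactin T K" "closedin T K" "K \<subseteq> G'"
        using G'(2) by (rule closed_nbhd)
      then show "x \<in> \<Union>\<U>'"
        using G'(1) unfolding \<U>'_def by blast
    qed
  qed
  moreover have "\<forall>N\<in>\<U>'. openin T N"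
    by (simp add: \<U>'_def)
  ultimately have "\<exists>\<G>. (\<forall>G\<in>\<G>. openin T G \<and> (\<exists>N\<in>\<U>'. G \<subseteq> N)) \<and> \<Union>\<G> = V \<and> locally_finite_in (subtopology T V) \<G>"
    by (intro open_subset_paracompact[OF V])
  then obtain \<R> where R1: "\<forall>R\<in>\<R>. openin T R \<and> (\<exists>N\<in>\<U>'. R \<subseteq> N)" and R2: "\<Union>\<R> = V"
    and R3: "locally_finite_in (subtopology T V) \<R>"
    by (elim exE conjE) (rule that)
  note R = R1[rule_format] R2 R3
  have "\<exists>G L. G \<in> \<G> \<and> closedin T L \<and> R \<subseteq> L \<and> L \<subseteq> G" if R': "R \<in> \<R>" for R
  proof -
    obtain N where N: "N \<in> \<U>'" "R \<subseteq> N"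
      using R(1)[OF R'] by blast
    then obtain G' L where "G' \<in> \<G>" "closedin T L" "N \<subseteq> L" "L \<subseteq> G'"
      by (auto simp: \<U>'_def)
    with N(2) show ?thesis
      by (intro exI[of _ G'] exI[of _ L]) auto
  qed
  then obtain \<gamma> L where \<gamma>: "\<And>R. R \<in> \<R> \<Longrightarrow> \<gamma> R \<in> \<G>" and L: "\<And>R. R \<in> \<R> \<Longrightarrow> closedin T (L R)"
    "\<And>R. R \<in> \<R> \<Longrightarrow> R \<subseteq> L R" "\<And>R. R \<in> \<R> \<Longrightarrow> L R \<subseteq> \<gamma> R"
    by metis
  let ?TV = "subtopology T V"
  \<comment> \<open>Closed in V although the union may be infinite, because the pieces are locally
    finite; the sets \<open>F G\<close> still cover V.\<close>
  define F where "F G = \<Union>((\<lambda>R. ?TV closure_of R) ` {R \<in> \<R>. \<gamma> R = G})" for G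
  have FG: "F G \<subseteq> G" if "G \<in> \<G>" for G
  proof -
    have "?TV closure_of R \<subseteq> \<gamma> R" if "R \<in> \<R>" for R
    proof -
      have "L R \<subseteq> V"
        using L(3)[OF that] \<gamma>[OF that] G(2) by blast
      then have "closedin ?TV (L R)"
        using L(1)[OF that] by (metis closedin_subtopology inf.absorb1)
      then have "?TV closure_of R \<subseteq> L R"
        by (rule closure_of_minimal[OF L(2)[OF that]])
      then show ?thesis
        using L(3)[OF that] by blast
    qed
    then show ?thesis
      unfolding F_def by blast
  qed
  have Fcomp: "compactin T (F G)" if "G \<in> \<G>" for G
  proof -
    have "locally_finite_in ?TV {R \<in> \<R>. \<gamma> R = G}"
      by (rule locally_finite_in_subset[OF R(3)]) simp
    then have "closedin ?TV (F G)"
      unfolding F_def by (rule closedin_Union_locally_finite_closure)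
    moreover have "compactin ?TV (K G)"
      using K(1,3)[OF that] by (auto simp: compactin_subtopology)
    moreover have "F G \<subseteq> K G"
      using FG[OF that] K(2)[OF that] by blast
    ultimately have "compactin ?TV (F G)"
      using closed_compactin[of ?TV "K G" "F G"] by blast
    then show ?thesis
      by (simp add: compactin_subtopology)
  qed
  have cov: "\<exists>G\<in>\<G>. y \<in> F G" if "y \<in> V" for y
  proof -
    obtain R' where R': "R' \<in> \<R>" "y \<in> R'"
      using R(2) \<open>y \<in> V\<close> by blast
    have "R' \<subseteq> topspace ?TV"
      using R(2) R'(1) VT by auto
    then have "y \<in> F (\<gamma> R')"
      using closure_of_subset[of R' ?TV] R' unfolding F_def by blast
    then show ?thesis
      using \<gamma>[OF R'(1)] by blast
  qed
  have "\<exists>\<psi>. msmooth UNIV \<psi> \<and> (\<forall>y. 0 \<le> \<psi> y) \<and> (\<forall>y\<in>F G. 0 < \<psi> y) \<and> (\<forall>y. y \<notin> G \<longrightarrow> \<psi> y = 0)" if G': "G \<in> \<G>" for G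
  proof -
    have "openin T G"
      using G(1)[OF G'] by blast
    then obtain \<psi> L where "msmooth UNIV \<psi>" "\<And>y. 0 \<le> \<psi> y" "\<And>y. y \<in> F G \<Longrightarrow> 0 < \<psi> y" "closedin T L" "L \<subseteq> G"
      "\<And>y. y \<notin> L \<Longrightarrow> \<psi> y = 0"
      using compact_bump[OF Fcomp[OF G'] FG[OF G']] by blast
    then show ?thesis
      by (intro exI[of _ \<psi>]) auto
  qed
  then obtain \<psi> where \<psi>: "\<And>G. G \<in> \<G> \<Longrightarrow> msmooth UNIV (\<psi> G)" "\<And>G y. G \<in> \<G> \<Longrightarrow> 0 \<le> \<psi> G y"
    "\<And>G y. G \<in> \<G> \<Longrightarrow> y \<in> F G \<Longrightarrow> 0 < \<psi> G y" "\<And>G y. G \<in> \<G> \<Longrightarrow> y \<notin> G \<Longrightarrow> \<psi> G y = 0"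
    by metis
  define I where "I y = {G \<in> \<G>. y \<in> G}" for y
  have Q: "\<exists>Q. openin T Q \<and> y \<in> Q \<and> finite {G \<in> \<G>. G \<inter> Q \<noteq> {}}" if y: "y \<in> V" for y
  proof -
    have "y \<in> topspace ?TV"
      using y VT by auto
    then obtain Q where Q: "openin ?TV Q" "y \<in> Q" "finite {G \<in> \<G>. G \<inter> Q \<noteq> {}}"
      using G(3) unfolding locally_finite_in_def by blast
    then show ?thesis
      using openin_trans_full[OF Q(1) V] by blast
  qed
  have finI: "finite (I y)" if y: "y \<in> V" for y
  proof -
    obtain Q where Q: "y \<in> Q" "finite {G \<in> \<G>. G \<inter> Q \<noteq> {}}"
      using Q[OF y] by blast
    show ?thesis
      by (rule finite_subset[OF _ Q(2)]) (use Q(1) in \<open>auto simp: I_def\<close>)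
  qed
  have sum_smooth: "msmooth V (\<lambda>y. \<Sum>G\<in>I y. \<psi> G y * k G)" for k :: "'m set \<Rightarrow> real"
  proof (rule msmooth_local)
    fix y assume y: "y \<in> V"
    obtain Q where Q: "openin T Q" "y \<in> Q" "finite {G \<in> \<G>. G \<inter> Q \<noteq> {}}"
      using Q[OF y] by blast
    have "msmooth Q (\<lambda>z. \<Sum>G\<in>{G \<in> \<G>. G \<inter> Q \<noteq> {}}. \<psi> G z * k G)"
      by (intro msmooth_sum msmooth_mult msmooth_const msmooth_subset[OF \<psi>(1)]) auto
    moreover have "(\<Sum>G\<in>{G \<in> \<G>. G \<inter> Q \<noteq> {}}. \<psi> G z * k G) = (\<Sum>G\<in>I z. \<psi> G z * k G)" if z: "z \<in> Q" for z
      by (rule sum.mono_neutral_right[OF Q(3)]) (use z \<psi>(4) in \<open>auto simp: I_def\<close>)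
    ultimately have "msmooth Q (\<lambda>z. \<Sum>G\<in>I z. \<psi> G z * k G)"
      by (rule msmooth_cong)
    then show "\<exists>W. openin T W \<and> y \<in> W \<and> msmooth W (\<lambda>y. \<Sum>G\<in>I y. \<psi> G y * k G)"
      using Q by blast
  qed
  define s where "s y = (\<Sum>G\<in>I y. \<psi> G y)" for y
  have s_smooth: "msmooth V s"
    using sum_smooth[of "\<lambda>_. 1"] by (simp add: s_def[abs_def])
  have s_pos: "0 < s y" if y: "y \<in> V" for y
  proof -
    obtain G' where G': "G' \<in> \<G>" "y \<in> F G'"
      using cov[OF y] by blast
    then have "G' \<in> I y"
      using FG by (auto simp: I_def)
    then show ?thesis
      unfolding s_def using \<psi>(2,3) G' finI[OF y]
      by (intro sum_pos2[of _ G']) (auto simp: I_def)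
  qed
  show ?thesis
  proof (rule that[of "\<lambda>y i. (\<Sum>G\<in>I y. \<psi> G y * c (\<xi> G) i) * s y powr (-1)"])
    show "msmooth V (\<lambda>y. (\<Sum>G\<in>I y. \<psi> G y * c (\<xi> G) i) * s y powr (-1))" for i
      by (intro msmooth_mult sum_smooth msmooth_powr s_smooth s_pos)
    fix y assume y: "y \<in> V"
    have "y \<in> U (\<xi> G)" if "G \<in> I y" for G
      using that K(2,3)[of G] by (auto simp: I_def)
    moreover have "sum (\<lambda>G. \<psi> G y / s y) (I y) = 1"
      using s_pos[OF y] by (simp add: sum_divide_distrib[symmetric] s_def)
    moreover have "(\<Sum>G\<in>I y. \<psi> G y * c (\<xi> G) i) * s y powr (-1) = (\<Sum>G\<in>I y. \<psi> G y / s y * c (\<xi> G) i)" for i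
      using s_pos[OF y] by (simp add: sum_divide_distrib powr_minus_divide)
    moreover have "0 \<le> \<psi> G y / s y" if "G \<in> I y" for G
      using that \<psi>(2) s_pos[OF y] by (simp add: I_def)
    moreover have "\<xi> G \<in> V" if "G \<in> I y" for G
      using that \<xi> by (simp add: I_def)
    ultimately have w: "finite (I y) \<and> (\<forall>j\<in>I y. \<xi> j \<in> V \<and> y \<in> U (\<xi> j) \<and> 0 \<le> \<psi> j y / s y) \<and>
       (\<Sum>j\<in>I y. \<psi> j y / s y) = 1 \<and>
       (\<forall>i. (\<Sum>G\<in>I y. \<psi> G y * c (\<xi> G) i) * s y powr (-1) = (\<Sum>j\<in>I y. \<psi> j y / s y * c (\<xi> j) i))"
      using finI[OF y] by simp
    show "\<exists>(I' :: 'm set set) a \<xi>'. finite I' \<and> (\<forall>j\<in>I'. \<xi>' j \<in> V \<and> y \<in> U (\<xi>' j) \<and> 0 \<le> a j) \<and>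
       sum a I' = (1::real) \<and>
       (\<forall>i. (\<Sum>G\<in>I y. \<psi> G y * c (\<xi> G) i) * s y powr (-1) = (\<Sum>j\<in>I'. a j * c (\<xi>' j) i))"
      by (rule exI[of _ "I y"], rule exI[of _ "\<lambda>G. \<psi> G y / s y"], rule exI[of _ \<xi>]) (rule w)
  qed
qed

text \<open>Patch the constant 1 at points of A and 0 elsewhere. Points of A get the neighbourhood V
  - B, the others V - A; hence only constants 1 contribute on A and only constants 0 on B.\<close>

lemma smooth_Urysohn:
  assumes V: "openin T V" and A: "closedin (subtopology T V) A" and B: "closedin (subtopology T V) B"
    and AB: "A \<inter> B = {}"
  obtains \<alpha> where "msmooth V \<alpha>" "\<And>y. y \<in> A \<Longrightarrow> \<alpha> y = 1" "\<And>y. y \<in> B \<Longrightarrow> \<alpha> y = 0"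
proof -
  have VT: "V \<subseteq> topspace T" using openin_subset[OF V] .
  then have tV: "topspace (subtopology T V) = V" by auto
  have op: "openin T (V - S)" if "closedin (subtopology T V) S" for S
  proof (rule openin_trans_full[OF _ V])
    show "openin (subtopology T V) (V - S)"
      using that tV unfolding closedin_def by simp
  qed
  have sub: "A \<subseteq> V" "B \<subseteq> V"
    using closedin_subset[OF A] closedin_subset[OF B] tV by auto
  define U where "U x = (if x \<in> A then V - B else V - A)" for x
  define c :: "'m \<Rightarrow> nat \<Rightarrow> real" where "c x i = (if x \<in> A then 1 else 0)" for x i
  have U: "\<And>x. x \<in> V \<Longrightarrow> openin T (U x) \<and> x \<in> U x"
    using op[OF A] op[OF B] AB by (auto simp: U_def)
  obtain F where F: "\<And>i. msmooth V (\<lambda>y. F y i)"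
    "\<And>y. y \<in> V \<Longrightarrow> \<exists>(I :: 'm set set) a \<xi>. finite I \<and> (\<forall>j\<in>I. \<xi> j \<in> V \<and> y \<in> U (\<xi> j) \<and> 0 \<le> a j) \<and>
       sum a I = (1::real) \<and> (\<forall>i. F y i = (\<Sum>j\<in>I. a j * c (\<xi> j) i))"
    using patch_constants[where U=U and c=c, OF V U] by blast
  have "F y 0 = 1" if y: "y \<in> A" for y
  proof -
    have yV: "y \<in> V" using y sub by blast
    obtain I a \<xi> where I: "\<forall>j\<in>(I :: 'm set set). \<xi> j \<in> V \<and> y \<in> U (\<xi> j)" "sum a I = (1::real)"
      "\<forall>i. F y i = (\<Sum>j\<in>I. a j * c (\<xi> j) i)"
      using F(2)[OF yV] by blast
    have "(\<Sum>j\<in>I. a j * c (\<xi> j) 0) = sum a I"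
      by (rule sum.cong) (use I(1) y in \<open>auto simp: c_def U_def split: if_splits\<close>)
    then show ?thesis using I(2,3) by simp
  qed
  moreover have "F y 0 = 0" if y: "y \<in> B" for y
  proof -
    have yV: "y \<in> V" using y sub by blast
    obtain I a \<xi> where I: "\<forall>j\<in>(I :: 'm set set). \<xi> j \<in> V \<and> y \<in> U (\<xi> j)"
      "\<forall>i. F y i = (\<Sum>j\<in>I. (a j :: real) * c (\<xi> j) i)"
      using F(2)[OF yV] by blast
    have "(\<Sum>j\<in>I. a j * c (\<xi> j) 0) = 0"
      by (rule sum.neutral) (use I(1) y in \<open>auto simp: c_def U_def split: if_splits\<close>)
    then show ?thesis using I(2) by simp
  qed
  ultimately show ?thesis
    using that[of "\<lambda>y. F y 0"] F(1) by blast
qed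

end

section \<open>Attaching cells\<close>

lemma plot_restrict:
  assumes "diffeological_space X" "P \<in> plots X k U" "openin (Euclidean_space k) W" "W \<subseteq> U"
  shows "P \<in> plots X k W"
proof -
  have "W \<subseteq> EE k" "U \<subseteq> EE k"
    using openin_subset[OF assms(3)] openin_subset[OF diffeological_spaceD(1)[OF assms(1,2)]] by auto
  then have "smooth_eucl k W k U (\<lambda>x. x)"
    using assms(3,4) by (auto simp: smooth_eucl_def intro: smooth_fun_coord)
  from diffeological_spaceD(4)[OF assms(1,2) this] show ?thesis
    by (simp add: o_def)
qed

section \<open>Smooth maps and the D-topology\<close>

lemma D_open_points: "diffeological_space X \<Longrightarrow> D_open X (points X)"
  unfolding D_open_def
proof (intro conjI allI ballI)
  fix n U P assume X: "diffeological_space X" and P: "P \<in> plots X n U"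
  have "{x \<in> U. P x \<in> points X} = U"
    using diffeological_spaceD(2)[OF X P] by auto
  then show "openin (Euclidean_space n) {x \<in> U. P x \<in> points X}"
    using diffeological_spaceD(1)[OF X P] by simp
qed simp

lemma topspace_D_topology: "diffeological_space X \<Longrightarrow> topspace (D_topology X) = points X"
proof (rule antisym)
  assume X: "diffeological_space X"
  show "points X \<subseteq> topspace (D_topology X)"
    by (rule openin_subset) (simp add: openin_D_topology D_open_points[OF X])
  have "D_open X (topspace (D_topology X))"
    using openin_topspace openin_D_topology by blast
  then show "topspace (D_topology X) \<subseteq> points X"
    by (simp add: D_open_def)
qed

text \<open>Since Y is D-open, a plot of X restricts on an open set to a plot of the subspace Y.
  This covers maps such as the radial retraction that are smooth only on a D-open part.\<close>

lemma D_open_vimage: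
  assumes "D_open X Y" "smooth_map (sub_diff X Y) Z r" "D_open Z W" "diffeological_space X"
  shows "D_open X {y \<in> Y. r y \<in> W}"
  unfolding D_open_def
proof (intro conjI allI ballI)
  show "{y \<in> Y. r y \<in> W} \<subseteq> points X"
    using assms(1) by (auto simp: D_open_def)
  fix n U P assume P: "P \<in> plots X n U"
  let ?O = "{x \<in> U. P x \<in> Y}"
  have o: "openin (Euclidean_space n) ?O"
    using assms(1) P by (simp add: D_open_def)
  have "P \<in> plots (sub_diff X Y) n ?O"
    using plot_restrict[OF assms(4) P o] by auto
  then have "r \<circ> P \<in> plots Z n ?O"
    using assms(2) by (simp add: smooth_map_def)
  then have "openin (Euclidean_space n) {x \<in> ?O. (r \<circ> P) x \<in> W}"
    using assms(3) unfolding D_open_def by blast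
  moreover have "{x \<in> ?O. (r \<circ> P) x \<in> W} = {x \<in> U. P x \<in> {y \<in> Y. r y \<in> W}}"
    by auto
  ultimately show "openin (Euclidean_space n) {x \<in> U. P x \<in> {y \<in> Y. r y \<in> W}}"
    by simp
qed

lemma smooth_imp_continuous:
  assumes "D_open X Y" "smooth_map (sub_diff X Y) Z r" "diffeological_space X" "diffeological_space Z"
  shows "continuous_map (subtopology (D_topology X) Y) (D_topology Z) r"
proof -
  have YX: "Y \<subseteq> points X"
    using assms(1) by (auto simp: D_open_def)
  then have t: "topspace (subtopology (D_topology X) Y) = Y"
    using topspace_D_topology[OF assms(3)] by auto
  have "r \<in> Y \<rightarrow> points Z"
    using assms(2) YX by (auto simp: smooth_map_def Pi_iff)
  moreover have "openin (subtopology (D_topology X) Y) {y \<in> Y. r y \<in> W}" if "openin (D_topology Z) W" for W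
  proof -
    have "D_open X {y \<in> Y. r y \<in> W}"
      using D_open_vimage[OF assms(1,2) _ assms(3)] that openin_D_topology by blast
    then show ?thesis
      using assms(1) by (subst openin_open_subtopology) (auto simp: openin_D_topology)
  qed
  ultimately show ?thesis
    unfolding continuous_map_def t topspace_D_topology[OF assms(4)] by blast
qed

text \<open>\<open>\<real>\<close> is locally compact, so the D-topology of \<open>Z \<times> \<real>\<close> is the product topology.\<close>

lemma smooth_imp_continuous_prod_real:
  assumes Z: "diffeological_space Z" and Z': "diffeological_space Z'"
    and L: "smooth_map (prod_diff Z real_diff) Z' L"
  shows "continuous_map (prod_topology (D_topology Z) euclideanreal) (D_topology Z') L"
proof -
  have tZ: "topspace (D_topology Z) = points Z" and tZ': "topspace (D_topology Z') = points Z'"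
    by (simp_all add: topspace_D_topology Z Z')
  have LZ: "L \<in> points Z \<times> UNIV \<rightarrow> points Z'"
    using L by (simp add: smooth_map_def prod_diff_def real_diff_def)
  have "openin (prod_topology (D_topology Z) euclideanreal) {p \<in> points Z \<times> UNIV. L p \<in> W}"
    if W: "D_open Z' W" for W
  proof (subst openin_subopen, intro ballI)
    fix p assume p: "p \<in> {p \<in> points Z \<times> (UNIV :: real set). L p \<in> W}"
    obtain z t where zt: "p = (z, t)" "z \<in> points Z" "L (z, t) \<in> W"
      using p by auto
    \<comment> \<open>Coordinate k serves as the real parameter: resetting it to 0 projects the
      (k+1)-dimensional space onto the k-dimensional one, so a plot of \<open>Z\<close> becomes a
      plot of the product with one more variable.\<close>
    have PL: "openin (Euclidean_space (Suc k)) {x \<in> EE (Suc k). x(k := 0) \<in> U \<and> L (P (x(k := 0)), x k) \<in> W}"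
      if P: "P \<in> plots Z k U" for k U P
    proof -
      have U: "openin (Euclidean_space k) U" "U \<subseteq> EE k"
        using diffeological_spaceD(1)[OF Z P] openin_subset by auto
      let ?pr = "\<lambda>x :: nat \<Rightarrow> real. x(k := 0)"
      have sm: "smooth_eucl (Suc k) (EE (Suc k)) k (EE k) ?pr"
        unfolding smooth_eucl_def
      proof (intro conjI allI impI)
        show "?pr \<in> EE (Suc k) \<rightarrow> EE k"
          by (auto simp: topspace_Euclidean_space)
        fix i assume "i < k"
        then show "smooth_fun (Suc k) (EE (Suc k)) (\<lambda>x. ?pr x i)"
          using smooth_fun_coord[of "Suc k" "EE (Suc k)" i] by simp
      qed auto
      let ?V = "{x \<in> EE (Suc k). ?pr x \<in> U}"
      have V: "openin (Euclidean_space (Suc k)) ?V"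
        using smooth_eucl_openin_vimage[OF sm U(1)] .
      have sm': "smooth_eucl (Suc k) ?V k U ?pr"
        by (rule smooth_eucl_subset[OF sm V]) (use U in auto)
      have "P \<circ> ?pr \<in> plots Z (Suc k) ?V"
        by (rule diffeological_spaceD(4)[OF Z P sm'])
      moreover have "smooth_fun (Suc k) ?V (\<lambda>x. x k)"
        by (rule smooth_fun_coord[OF V])
      ultimately have "(\<lambda>x. (P (?pr x), x k)) \<in> plots (prod_diff Z real_diff) (Suc k) ?V"
        by (simp add: prod_diff_def real_diff_def o_def)
      then have "L \<circ> (\<lambda>x. (P (?pr x), x k)) \<in> plots Z' (Suc k) ?V"
        using L by (simp add: smooth_map_def)
      then have "openin (Euclidean_space (Suc k)) {x \<in> ?V. (L \<circ> (\<lambda>x. (P (?pr x), x k))) x \<in> W}"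
        using W unfolding D_open_def by blast
      then show ?thesis
        by (simp add: conj_assoc)
    qed
    have PL': "openin (prod_topology (subtopology (Euclidean_space k) U) euclideanreal)
        {q \<in> U \<times> UNIV. L (P (fst q), snd q) \<in> W}" if P: "P \<in> plots Z k U" for k U P
    proof -
      have U: "U \<subseteq> EE k"
        using diffeological_spaceD(1)[OF Z P] openin_subset by auto
      let ?X = "prod_topology (subtopology (Euclidean_space k) U) euclideanreal"
      have tX: "topspace ?X = U \<times> UNIV"
        using U by auto
      have c1: "continuous_map ?X (Euclidean_space k) fst"
        using continuous_map_fst continuous_map_in_subtopology by blast
      have "continuous_map ?X euclideanreal (\<lambda>q. (fst q) i)" for i
      proof -
        have "continuous_map (Euclidean_space k) euclideanreal (\<lambda>y. y i)"
          unfolding Euclidean_space_def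
          by (intro continuous_map_from_subtopology continuous_map_product_projection UNIV_I)
        from continuous_map_compose[OF c1 this] show ?thesis by (simp add: o_def)
      qed
      moreover have "continuous_map ?X euclideanreal snd"
        by (rule continuous_map_snd)
      ultimately have "continuous_map ?X euclideanreal (\<lambda>q. ((fst q)(k := snd q)) i)" for i
        by (cases "i = k") simp_all
      then have "continuous_map ?X (powertop_real UNIV) (\<lambda>q. (fst q)(k := snd q))"
        by (subst continuous_map_componentwise_UNIV) auto
      moreover have "(\<lambda>q. (fst q)(k := snd q)) \<in> topspace ?X \<rightarrow> {x. \<forall>i\<ge>Suc k. x i = 0}"
        using U tX by (auto simp: topspace_Euclidean_space)
      ultimately have c: "continuous_map ?X (Euclidean_space (Suc k)) (\<lambda>q. (fst q)(k := snd q))"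
        by (auto simp: Euclidean_space_def continuous_map_in_subtopology)
      have up: "x(k := 0) = x" if "x \<in> U" for x
        by (rule ext) (use that U in \<open>auto simp: topspace_Euclidean_space\<close>)
      have "{q \<in> U \<times> UNIV. L (P (fst q), snd q) \<in> W} =
          {q \<in> topspace ?X. (fst q)(k := snd q) \<in> {x \<in> EE (Suc k). x(k := 0) \<in> U \<and> L (P (x(k := 0)), x k) \<in> W}}"
        unfolding tX using U by (auto simp: up topspace_Euclidean_space)
      then show ?thesis
        using openin_continuous_map_preimage[OF c PL[OF P]] by simp
    qed
    \<comment> \<open>Apply the previous fact to the zero-dimensional plot at z.\<close>
    have o_t: "open {s. L (z, s) \<in> W}"
    proof -
      have U0: "openin (Euclidean_space 0) (EE 0)"
        by simp
      have "(\<lambda>_. z) \<in> plots Z 0 (EE 0)"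
        by (rule diffeological_spaceD(3)[OF Z zt(2) U0])
      from PL'[OF this] have o: "openin (prod_topology (Euclidean_space 0) euclideanreal)
          {q \<in> EE 0 \<times> UNIV. L (z, snd q) \<in> W}" by simp
      have "continuous_map euclideanreal (prod_topology (Euclidean_space 0) euclideanreal) (\<lambda>s. (\<lambda>_. 0, s))"
        by (intro continuous_map_pairedI) (auto simp: topspace_Euclidean_space)
      from openin_continuous_map_preimage[OF this o] show ?thesis
        by (simp add: topspace_Euclidean_space)
    qed
    then obtain d where d: "d > 0" "cball t d \<subseteq> {s. L (z, s) \<in> W}"
      using zt(3) open_contains_cball by blast
    \<comment> \<open>Tube lemma: a product neighbourhood of the compact interval over a plot
      parameter shows that A is D-open. The wanted neighbourhood of p is then A times the open
      interval.\<close>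
    define A where "A = {a \<in> points Z. \<forall>s\<in>cball t d. L (a, s) \<in> W}"
    have "D_open Z A"
      unfolding D_open_def
    proof (intro conjI allI ballI)
      fix k U P assume P: "P \<in> plots Z k U"
      have U: "openin (Euclidean_space k) U" "U \<subseteq> EE k" "P \<in> U \<rightarrow> points Z"
        using diffeological_spaceD(1,2)[OF Z P] openin_subset by auto
      show "openin (Euclidean_space k) {x \<in> U. P x \<in> A}"
      proof (subst openin_subopen, intro ballI)
        fix x assume x: "x \<in> {x \<in> U. P x \<in> A}"
        let ?O = "{q \<in> U \<times> UNIV. L (P (fst q), snd q) \<in> W}"
        have c1: "compactin (subtopology (Euclidean_space k) U) {x}"
          using x U(2) by auto
        have c2: "compactin euclideanreal (cball t d)"
          by simp
        have c3: "openin (prod_topology (subtopology (Euclidean_space k) U) euclideanreal) ?O"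
          by (rule PL'[OF P])
        have c4: "{x} \<times> cball t d \<subseteq> ?O"
          using x unfolding A_def by auto
        obtain U' V' where "openin (subtopology (Euclidean_space k) U) U'" "openin euclideanreal V'"
          "{x} \<subseteq> U'" "cball t d \<subseteq> V'" "U' \<times> V' \<subseteq> ?O"
          by (rule Wallace_theorem_prod_topology[OF c1 c2 c3 c4])
        then have U': "openin (subtopology (Euclidean_space k) U) U'" "x \<in> U'"
          "cball t d \<subseteq> V'" "U' \<times> V' \<subseteq> ?O" by auto
        have "openin (Euclidean_space k) U'"
          by (rule openin_trans_full[OF U'(1) U(1)])
        moreover have "U' \<subseteq> {x \<in> U. P x \<in> A}"
        proof
          fix y assume y: "y \<in> U'"
          have "U' \<subseteq> U" using openin_subset[OF U'(1)] by auto
          moreover have "L (P y, s) \<in> W" if "s \<in> cball t d" for s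
          proof -
            have "(y, s) \<in> U' \<times> V'"
              using U'(3) y that by blast
            then have "(y, s) \<in> ?O" using U'(4) by blast
            then show ?thesis by simp
          qed
          ultimately show "y \<in> {x \<in> U. P x \<in> A}"
            using y U(3) unfolding A_def by auto
        qed
        ultimately show "\<exists>S. openin (Euclidean_space k) S \<and> x \<in> S \<and> S \<subseteq> {x \<in> U. P x \<in> A}"
          using U'(2) by blast
      qed
    qed (auto simp: A_def)
    then have "openin (prod_topology (D_topology Z) euclideanreal) (A \<times> ball t d)"
      by (simp add: openin_prod_Times_iff openin_D_topology)
    moreover have "p \<in> A \<times> ball t d"
      using zt d by (auto simp: A_def)
    moreover have "A \<times> ball t d \<subseteq> {p \<in> points Z \<times> (UNIV :: real set). L p \<in> W}"
      by (auto simp: A_def)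
    ultimately show "\<exists>S. openin (prod_topology (D_topology Z) euclideanreal) S \<and> p \<in> S \<and>
        S \<subseteq> {p \<in> points Z \<times> (UNIV :: real set). L p \<in> W}"
      by blast
  qed
  then show ?thesis
    using LZ by (simp add: continuous_map_def tZ tZ' openin_D_topology)
qed

lemma local_plots_vimage:
  assumes "\<And>x. x \<in> U \<Longrightarrow> \<exists>W. openin (Euclidean_space k) W \<and> x \<in> W \<and> W \<subseteq> U \<and> openin (Euclidean_space k) {y \<in> W. P y \<in> A}"
  shows "openin (Euclidean_space k) {y \<in> U. P y \<in> A}"
proof (subst openin_subopen, intro ballI)
  fix x assume x: "x \<in> {y \<in> U. P y \<in> A}"
  then obtain W where W: "openin (Euclidean_space k) W" "x \<in> W" "W \<subseteq> U" "openin (Euclidean_space k) {y \<in> W. P y \<in> A}"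
    using assms by blast
  show "\<exists>S. openin (Euclidean_space k) S \<and> x \<in> S \<and> S \<subseteq> {y \<in> U. P y \<in> A}"
    by (intro exI[of _ "{y \<in> W. P y \<in> A}"]) (use W x in auto)
qed

section \<open>Points and plots of a space with one layer of cells attached\<close>

locale cell_attachment =
  fixes n :: nat and Z Z' :: "'x diffeology" and J :: "'i set"
    and h \<Phi> :: "'i \<times> (nat \<Rightarrow> real) \<Rightarrow> 'x"
  assumes Z: "diffeological_space Z"
    and h: "smooth_map (coprod_diff J (\<lambda>_. sphere_diff n)) Z h"
    and pushout: "is_pushout (coprod_diff J (\<lambda>_. sphere_diff n)) Z
                  (coprod_diff J (\<lambda>_. disk_diff (Suc n))) h id Z' id \<Phi>"
begin

definition nr :: "(nat \<Rightarrow> real) \<Rightarrow> real" where "nr x = L2_set x {..<Suc n}"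

abbreviation dsk :: "(nat \<Rightarrow> real) set" where "dsk \<equiv> {x \<in> EE (Suc n). nr x \<le> 1}"

lemma nr_sq: "(\<Sum>i<Suc n. (x i)\<^sup>2) = (nr x)\<^sup>2"
  by (simp only: nr_def L2_set_def) (simp add: sum_nonneg)

lemma nr_nonneg [simp]: "0 \<le> nr x"
  by (simp add: nr_def)

lemma nr_le_1: "(\<Sum>i<Suc n. (x i)\<^sup>2) \<le> 1 \<longleftrightarrow> nr x \<le> 1"
  unfolding nr_sq abs_square_le_1 by simp

lemma nr_eq_1: "(\<Sum>i<Suc n. (x i)\<^sup>2) = 1 \<longleftrightarrow> nr x = 1"
proof -
  have "nr x \<noteq> -1"
    using nr_nonneg[of x] by linarith
  then show ?thesis
    unfolding nr_sq by (simp add: power2_eq_1_iff)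
qed

lemma nr_scale: "nr (\<lambda>i. c * x i) = \<bar>c\<bar> * nr x"
proof -
  have "(\<Sum>i<Suc n. (c * x i)\<^sup>2) = c\<^sup>2 * (\<Sum>i<Suc n. (x i)\<^sup>2)"
    by (simp only: power_mult_distrib sum_distrib_left)
  then show ?thesis
    by (simp only: nr_def L2_set_def real_sqrt_mult real_sqrt_abs)
qed

lemma nr_triangle: "nr (\<lambda>i. x i + y i) \<le> nr x + nr y"
  by (simp add: nr_def L2_set_triangle_ineq)

lemma points_disk: "points (disk_diff (Suc n)) = dsk"
  using nr_le_1 by (auto simp: disk_diff_def sub_diff_def euclidean_diff_def)

lemma points_sphere: "points (sphere_diff n) = {x \<in> EE (Suc n). nr x = 1}"
proof -
  have "topspace (nsphere n) = EE (Suc n) \<inter> {x. (\<Sum>i<Suc n. (x i)\<^sup>2) = 1}"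
    by (simp add: nsphere_def lessThan_Suc_atMost)
  then show ?thesis
    using nr_eq_1 by (auto simp: sphere_diff_def euclidean_diff_def sub_diff_def)
qed

lemma plots_disk: "Q \<in> plots (disk_diff (Suc n)) k W \<longleftrightarrow>
    openin (Euclidean_space k) W \<and> Q \<in> W \<rightarrow> dsk \<and> (\<forall>i<Suc n. smooth_fun k W (\<lambda>x. Q x i))"
  using nr_le_1 by (auto simp: disk_diff_def sub_diff_def euclidean_diff_def smooth_eucl_def Pi_iff)

lemma plots_sphere: "Q \<in> plots (sphere_diff n) k W \<longleftrightarrow>
    openin (Euclidean_space k) W \<and> Q \<in> W \<rightarrow> {x \<in> EE (Suc n). nr x = 1} \<and> (\<forall>i<Suc n. smooth_fun k W (\<lambda>x. Q x i))"
proof -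
  have "topspace (nsphere n) = EE (Suc n) \<inter> {x. (\<Sum>i<Suc n. (x i)\<^sup>2) = 1}"
    by (simp add: nsphere_def lessThan_Suc_atMost)
  then show ?thesis
    using nr_eq_1 by (auto simp: sphere_diff_def sub_diff_def euclidean_diff_def smooth_eucl_def Pi_iff)
qed

lemma coprod_plot:
  assumes "j \<in> J" "Q \<in> plots D k W" "openin (Euclidean_space k) W" "Q \<in> W \<rightarrow> points D"
  shows "(\<lambda>y. (j, Q y)) \<in> plots (coprod_diff J (\<lambda>_. D)) k W"
  unfolding coprod_diff_def diffeology.simps
proof (rule local_plotsI[OF assms(3)])
  show "(\<lambda>y. (j, Q y)) \<in> W \<rightarrow> J \<times> points D"
    using assms(1,4) by auto
  show "\<exists>i\<in>J. \<exists>Q'\<in>plots D k W. \<forall>y\<in>W. (j, Q y) = (i, Q' y)"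
    using assms(1,2) by blast
qed

abbreviation "SS \<equiv> sum_diff Z (coprod_diff J (\<lambda>_. disk_diff (Suc n)))"
abbreviation "RR \<equiv> pushout_rel (coprod_diff J (\<lambda>_. sphere_diff n)) h id"

lemma Z': "diffeological_space Z'"
  using pushout by (simp add: is_pushout_def)

lemma pushout_iso:
  obtains u g where "smooth_map (quot_diff SS RR) Z' u" "smooth_map Z' (quot_diff SS RR) g"
    "\<And>y. y \<in> points Z' \<Longrightarrow> u (g y) = y"
    "\<And>c. c \<in> points (quot_diff SS RR) \<Longrightarrow> g (u c) = c"
    "\<And>b. b \<in> points Z \<Longrightarrow> u (quot_proj SS RR (Inl b)) = b"
    "\<And>j x. j \<in> J \<Longrightarrow> x \<in> dsk \<Longrightarrow> u (quot_proj SS RR (Inr (j, x))) = \<Phi> (j, x)"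
proof -
  obtain u where u: "diffeomorphism (quot_diff SS RR) Z' u"
    "\<forall>b\<in>points Z. u (quot_proj SS RR (Inl b)) = id b"
    "\<forall>c\<in>points (coprod_diff J (\<lambda>_. disk_diff (Suc n))). u (quot_proj SS RR (Inr c)) = \<Phi> c"
    using pushout unfolding is_pushout_def by blast
  obtain g where g: "smooth_map Z' (quot_diff SS RR) g" "\<forall>x\<in>points (quot_diff SS RR). g (u x) = x"
    "\<forall>y\<in>points Z'. u (g y) = y"
    using u(1) unfolding diffeomorphism_def by blast
  show ?thesis
  proof (rule that[of u g])
    show "smooth_map (quot_diff SS RR) Z' u"
      using u(1) unfolding diffeomorphism_def by blast
    show "u (quot_proj SS RR (Inr (j, x))) = \<Phi> (j, x)" if "j \<in> J" "x \<in> dsk" for j x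
      using u(3) that by (simp add: points_disk)
  qed (use u(2) g in simp_all)
qed

text \<open>The gluing relation preserves \<open>nform\<close>, which therefore separates the points of the pushout.\<close>

definition nform :: "'x + 'i \<times> (nat \<Rightarrow> real) \<Rightarrow> 'x + 'i \<times> (nat \<Rightarrow> real)" where
  "nform s = (case s of Inl b \<Rightarrow> Inl b | Inr p \<Rightarrow> if nr (snd p) = 1 then Inl (h p) else Inr p)"

lemma nform_eq:
  assumes "quot_proj SS RR a = quot_proj SS RR b" "b \<in> points SS"
  shows "nform a = nform b"
proof -
  have "b \<in> quot_proj SS RR b"
    using assms(2) by (simp add: quot_proj_def equiv_gen_def)
  then have "(a, b) \<in> equiv_gen (points SS) RR"
    using assms(1) unfolding quot_proj_def by (metis Image_singleton_iff)
  then have "(a, b) \<in> (RR \<union> RR\<inverse>)\<^sup>*"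
    by (simp add: equiv_gen_def)
  then show ?thesis
  proof (induction rule: rtrancl_induct)
    case (step y z)
    have "nform y = nform z" if "(y, z) \<in> RR" for y z
      using that points_sphere by (auto simp: pushout_rel_def nform_def)
    then show ?case
      using step by auto
  qed simp
qed

lemma nform_eq': 
  assumes "a \<in> points SS" "b \<in> points SS" "g (u (quot_proj SS RR a)) = quot_proj SS RR a"
    "g (u (quot_proj SS RR b)) = quot_proj SS RR b" "u (quot_proj SS RR a) = u (quot_proj SS RR b)"
  shows "nform a = nform b"
  using nform_eq[OF _ assms(2)] assms(3-5) by metis

text \<open>The form in which the pushout is used from here on: as a set it is \<open>Z\<close>
  together with the disjoint open cells, and a plot locally lifts either to \<open>Z\<close> or to a
  single closed disk. The lift is found by passing through the quotient, the sum and the coproduct,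
  shrinking the neighbourhood each time.\<close>

lemma Z_sub: "points Z \<subseteq> points Z'"
  and \<Phi>_in: "j \<in> J \<Longrightarrow> x \<in> dsk \<Longrightarrow> \<Phi> (j, x) \<in> points Z'"
  and \<Phi>_boundary: "j \<in> J \<Longrightarrow> x \<in> dsk \<Longrightarrow> nr x = 1 \<Longrightarrow> \<Phi> (j, x) = h (j, x)"
  and h_in: "j \<in> J \<Longrightarrow> x \<in> dsk \<Longrightarrow> nr x = 1 \<Longrightarrow> h (j, x) \<in> points Z"
  and \<Phi>_interior: "j \<in> J \<Longrightarrow> x \<in> dsk \<Longrightarrow> nr x < 1 \<Longrightarrow> \<Phi> (j, x) \<notin> points Z"
  and \<Phi>_inj: "j \<in> J \<Longrightarrow> x \<in> dsk \<Longrightarrow> nr x < 1 \<Longrightarrow> j' \<in> J \<Longrightarrow> x' \<in> dsk \<Longrightarrow> nr x' < 1 \<Longrightarrow>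
      \<Phi> (j, x) = \<Phi> (j', x') \<Longrightarrow> j = j' \<and> x = x'"
  and cell_cases: "y \<in> points Z' \<Longrightarrow> y \<in> points Z \<or> (\<exists>j\<in>J. \<exists>x\<in>dsk. nr x < 1 \<and> y = \<Phi> (j, x))"
  and Z_plot: "P \<in> plots Z k U \<Longrightarrow> P \<in> plots Z' k U"
  and \<Phi>_plot: "j \<in> J \<Longrightarrow> Q \<in> plots (disk_diff (Suc n)) k W \<Longrightarrow> (\<lambda>y. \<Phi> (j, Q y)) \<in> plots Z' k W"
  and Z'_plot: "P \<in> plots Z' k U \<Longrightarrow> x \<in> U \<Longrightarrow> \<exists>W. openin (Euclidean_space k) W \<and> x \<in> W \<and> W \<subseteq> U \<and>
      (P \<in> plots Z k W \<or> (\<exists>j\<in>J. \<exists>Q\<in>plots (disk_diff (Suc n)) k W. \<forall>y\<in>W. P y = \<Phi> (j, Q y)))"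
proof -
  obtain u g where u: "smooth_map (quot_diff SS RR) Z' u" and g: "smooth_map Z' (quot_diff SS RR) g"
    and ug: "\<And>y. y \<in> points Z' \<Longrightarrow> u (g y) = y"
    and gu: "\<And>c. c \<in> points (quot_diff SS RR) \<Longrightarrow> g (u c) = c"
    and ul: "\<And>b. b \<in> points Z \<Longrightarrow> u (quot_proj SS RR (Inl b)) = b"
    and ur: "\<And>j x. j \<in> J \<Longrightarrow> x \<in> dsk \<Longrightarrow> u (quot_proj SS RR (Inr (j, x))) = \<Phi> (j, x)"
    using pushout_iso by blast
  have inl: "Inl b \<in> points SS" if "b \<in> points Z" for b
    using that by auto
  have inr: "Inr (j, x) \<in> points SS" if "j \<in> J" "x \<in> dsk" for j x
    using that by (auto simp: points_disk)
  have q: "quot_proj SS RR s \<in> points (quot_diff SS RR)" if "s \<in> points SS" for s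
    using quot_proj_in[OF that] by simp
  have uq: "u (quot_proj SS RR s) \<in> points Z'" if "s \<in> points SS" for s
    using u q[OF that] unfolding smooth_map_def by blast
  \<comment> \<open>Different normal forms give different points: this is the source of the
    injectivity and disjointness claims.\<close>
  have nf: "nform a = nform b" if "a \<in> points SS" "b \<in> points SS" "u (quot_proj SS RR a) = u (quot_proj SS RR b)" for a b
    by (rule nform_eq'[OF that(1,2) gu[OF q[OF that(1)]] gu[OF q[OF that(2)]] that(3)])
  show "points Z \<subseteq> points Z'"
  proof
    fix b assume "b \<in> points Z"
    then show "b \<in> points Z'"
      using uq[OF inl] ul by metis
  qed
  show \<Phi>1: "\<Phi> (j, x) \<in> points Z'" if "j \<in> J" "x \<in> dsk" for j x
    using uq[OF inr[OF that]] ur[OF that] by simp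
  show h1: "h (j, x) \<in> points Z" if "j \<in> J" "x \<in> dsk" "nr x = 1" for j x
  proof -
    have "(j, x) \<in> points (coprod_diff J (\<lambda>_. sphere_diff n))"
      using that by (simp add: points_sphere)
    then show ?thesis
      using h unfolding smooth_map_def by blast
  qed
  show \<Phi>2: "\<Phi> (j, x) = h (j, x)" if "j \<in> J" "x \<in> dsk" "nr x = 1" for j x
  proof -
    have "(Inl (h (j, x)), Inr (j, x)) \<in> RR"
      using that by (force simp: pushout_rel_def points_sphere)
    then have "quot_proj SS RR (Inl (h (j, x))) = quot_proj SS RR (Inr (j, x))"
      using quot_proj_eq inl[OF h1[OF that]] inr[OF that(1,2)] by metis
    then show ?thesis
      using ul[OF h1[OF that]] ur[OF that(1,2)] by simp
  qed
  show "\<Phi> (j, x) \<notin> points Z" if "j \<in> J" "x \<in> dsk" "nr x < 1" for j x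
  proof
    assume Z: "\<Phi> (j, x) \<in> points Z"
    have "nform (Inl (\<Phi> (j, x))) = nform (Inr (j, x))"
      by (rule nf[OF inl[OF Z] inr[OF that(1,2)]]) (simp only: ul[OF Z] ur[OF that(1,2)])
    then show False
      using that(3) by (simp add: nform_def)
  qed
  show "j = j' \<and> x = x'" if "j \<in> J" "x \<in> dsk" "nr x < 1" "j' \<in> J" "x' \<in> dsk" "nr x' < 1"
    "\<Phi> (j, x) = \<Phi> (j', x')" for j j' x x'
  proof -
    have "nform (Inr (j, x)) = nform (Inr (j', x'))"
      by (rule nf[OF inr[OF that(1,2)] inr[OF that(4,5)]]) (simp only: ur[OF that(1,2)] ur[OF that(4,5)] that(7))
    then show ?thesis
      using that(3,6) by (simp add: nform_def)
  qed
  show "y \<in> points Z \<or> (\<exists>j\<in>J. \<exists>x\<in>dsk. nr x < 1 \<and> y = \<Phi> (j, x))" if y: "y \<in> points Z'" for y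
  proof -
    have "g y \<in> points SS // equiv_gen (points SS) RR"
      using g y unfolding smooth_map_def points_quot_diff by blast
    then obtain s where s: "s \<in> points SS" "g y = quot_proj SS RR s"
      unfolding quot_proj_def by (rule quotientE)
    have us: "u (quot_proj SS RR s) = y"
      using ug[OF y] s(2) by simp
    consider b where "s = Inl b" "b \<in> points Z" | j x where "s = Inr (j, x)" "j \<in> J" "x \<in> dsk"
      using s(1) by (auto simp: points_disk)
    then show ?thesis
    proof cases
      case 1
      then show ?thesis using us ul by auto
    next
      case 2
      then have y': "y = \<Phi> (j, x)"
        using us ur by simp
      show ?thesis
      proof (cases "nr x = 1")
        case True
        then show ?thesis using y' \<Phi>2 h1 2 by simp
      next
        case False
        then have "nr x < 1" using 2(3) by simp
        then show ?thesis using y' 2 by blast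
      qed
    qed
  qed
  have uS: "(\<lambda>y. u (quot_proj SS RR (s y))) \<in> plots Z' k U" if "s \<in> plots SS k U" "openin (Euclidean_space k) U" "s \<in> U \<rightarrow> points SS" for s k U
  proof -
    have "(\<lambda>y. quot_proj SS RR (s y)) \<in> plots (quot_diff SS RR) k U"
      unfolding quot_diff_def diffeology.simps
    proof (rule local_plotsI[OF that(2)])
      show "(\<lambda>y. quot_proj SS RR (s y)) \<in> U \<rightarrow> points SS // equiv_gen (points SS) RR"
        using that(3) quot_proj_in by fast
      show "\<exists>Q\<in>plots SS k U. \<forall>y\<in>U. quot_proj SS RR (s y) = quot_proj SS RR (Q y)"
        using that(1) by blast
    qed
    then have "u \<circ> (\<lambda>y. quot_proj SS RR (s y)) \<in> plots Z' k U"
      using u unfolding smooth_map_def by blast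
    then show ?thesis by (simp add: o_def)
  qed
  show "P \<in> plots Z' k U" if P: "P \<in> plots Z k U" for P k U
  proof -
    have U: "openin (Euclidean_space k) U" "P \<in> U \<rightarrow> points Z"
      using diffeological_spaceD(1,2)[OF Z P] by auto
    have "(\<lambda>y. Inl (P y)) \<in> plots SS k U"
      using smooth_Inl[OF Z] P unfolding smooth_map_def o_def by blast
    moreover have "(\<lambda>y. Inl (P y)) \<in> U \<rightarrow> points SS"
      using U(2) by auto
    ultimately have "(\<lambda>y. u (quot_proj SS RR (Inl (P y)))) \<in> plots Z' k U"
      using uS U(1) by blast
    then show ?thesis
      by (rule diffeological_spaceD(5)[OF Z']) (use U(2) ul in auto)
  qed
  show "(\<lambda>y. \<Phi> (j, Q y)) \<in> plots Z' k W" if j: "j \<in> J" and Q: "Q \<in> plots (disk_diff (Suc n)) k W" for j Q k W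
  proof -
    have W: "openin (Euclidean_space k) W" "Q \<in> W \<rightarrow> dsk"
      using Q by (simp_all add: plots_disk)
    have c: "(\<lambda>y. (j, Q y)) \<in> plots (coprod_diff J (\<lambda>_. disk_diff (Suc n))) k W"
      by (rule coprod_plot[OF j Q W(1)]) (use W(2) points_disk in simp)
    have in': "(\<lambda>y. Inr (j, Q y)) \<in> W \<rightarrow> points SS"
      using W(2) j by (auto simp: points_disk)
    have "(\<lambda>y. Inr (j, Q y)) \<in> plots SS k W"
      unfolding sum_diff_def diffeology.simps
    proof (rule local_plotsI[OF W(1)])
      show "(\<lambda>y. Inr (j, Q y)) \<in> W \<rightarrow> points Z <+> points (coprod_diff J (\<lambda>_. disk_diff (Suc n)))"
        using in' by simp
    qed (rule disjI2, rule bexI[OF _ c], simp)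
    then have "(\<lambda>y. u (quot_proj SS RR (Inr (j, Q y)))) \<in> plots Z' k W"
      using uS[OF _ W(1) in'] by blast
    then show ?thesis
      by (rule diffeological_spaceD(5)[OF Z']) (use W(2) ur j in auto)
  qed
  show "\<exists>W. openin (Euclidean_space k) W \<and> x \<in> W \<and> W \<subseteq> U \<and>
      (P \<in> plots Z k W \<or> (\<exists>j\<in>J. \<exists>Q\<in>plots (disk_diff (Suc n)) k W. \<forall>y\<in>W. P y = \<Phi> (j, Q y)))"
    if P: "P \<in> plots Z' k U" and x: "x \<in> U" for P k U x
  proof -
    have PZ': "P \<in> U \<rightarrow> points Z'"
      using diffeological_spaceD(2)[OF Z' P] .
    have "g \<circ> P \<in> plots (quot_diff SS RR) k U"
      using g P unfolding smooth_map_def by blast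
    then obtain W1 where W1: "openin (Euclidean_space k) W1" "x \<in> W1" "W1 \<subseteq> U"
      and ex1: "\<exists>Q\<in>plots SS k W1. \<forall>y\<in>W1. (g \<circ> P) y = quot_proj SS RR (Q y)"
      unfolding quot_diff_def diffeology.simps by (rule local_plotsE[OF _ x])
    then obtain s where s: "s \<in> plots SS k W1" "\<forall>y\<in>W1. g (P y) = quot_proj SS RR (s y)"
      by auto
    have Ps: "P y = u (quot_proj SS RR (s y))" if "y \<in> W1" for y
    proof -
      have "P y \<in> points Z'" using that W1(3) PZ' by blast
      from ug[OF this] show ?thesis using s(2) that by simp
    qed
    from s(1) obtain W2 where W2: "openin (Euclidean_space k) W2" "x \<in> W2" "W2 \<subseteq> W1"
      and ex2: "(\<exists>Q\<in>plots Z k W2. \<forall>y\<in>W2. s y = Inl (Q y)) \<or>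
        (\<exists>Q\<in>plots (coprod_diff J (\<lambda>_. disk_diff (Suc n))) k W2. \<forall>y\<in>W2. s y = Inr (Q y))"
      unfolding sum_diff_def diffeology.simps by (rule local_plotsE[OF _ W1(2)])
    from ex2 show ?thesis
    proof
      assume "\<exists>Q\<in>plots Z k W2. \<forall>y\<in>W2. s y = Inl (Q y)"
      then obtain Q where Q: "Q \<in> plots Z k W2" "\<forall>y\<in>W2. s y = Inl (Q y)" by blast
      have "Q y = P y" if "y \<in> W2" for y
      proof -
        have "Q y \<in> points Z" using diffeological_spaceD(2)[OF Z Q(1)] that by blast
        then show ?thesis using Ps[of y] that W2(3) Q(2) ul by auto
      qed
      then have "P \<in> plots Z k W2"
        by (rule diffeological_spaceD(5)[OF Z Q(1)])
      then show ?thesis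
        using W1 W2 by (intro exI[of _ W2]) auto
    next
      assume "\<exists>Q\<in>plots (coprod_diff J (\<lambda>_. disk_diff (Suc n))) k W2. \<forall>y\<in>W2. s y = Inr (Q y)"
      then obtain c where c: "c \<in> plots (coprod_diff J (\<lambda>_. disk_diff (Suc n))) k W2" "\<forall>y\<in>W2. s y = Inr (c y)" by blast
      from c(1) obtain W3 where W3: "openin (Euclidean_space k) W3" "x \<in> W3" "W3 \<subseteq> W2"
        and ex3: "\<exists>j\<in>J. \<exists>Q\<in>plots (disk_diff (Suc n)) k W3. \<forall>y\<in>W3. c y = (j, Q y)"
        unfolding coprod_diff_def diffeology.simps by (rule local_plotsE[OF _ W2(2)])
      then obtain j Q where Q: "j \<in> J" "Q \<in> plots (disk_diff (Suc n)) k W3" "\<forall>y\<in>W3. c y = (j, Q y)"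
        by blast
      have "P y = \<Phi> (j, Q y)" if y: "y \<in> W3" for y
      proof -
        have "Q y \<in> dsk" using Q(2) y unfolding plots_disk by blast
        moreover have "s y = Inr (j, Q y)" "y \<in> W1"
          using y W3(3) W2(3) c(2) Q(3) by auto
        ultimately show ?thesis using Ps[of y] ur[OF Q(1)] by simp
      qed
      then show ?thesis
        using Q(1,2) W1 W2 W3 by (intro exI[of _ W3]) blast
    qed
  qed
qed

end

lemma D_openD: "D_open X W \<Longrightarrow> P \<in> plots X n U \<Longrightarrow> openin (Euclidean_space n) {x \<in> U. P x \<in> W}"
  by (simp add: D_open_def)

context cell_attachment begin

subsection \<open>The collar of the lower skeleton\<close>

text \<open>Meaningful for points of \<open>Z'\<close> off \<open>points Z\<close>, where the
  injectivity of the characteristic maps on open cells makes the choice unique.\<close>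

definition coords :: "'x \<Rightarrow> 'i \<times> (nat \<Rightarrow> real)" where
  "coords y = (SOME p. fst p \<in> J \<and> snd p \<in> dsk \<and> nr (snd p) < 1 \<and> y = \<Phi> p)"

definition ci :: "'x \<Rightarrow> 'i" where "ci y = fst (coords y)"

definition cx :: "'x \<Rightarrow> nat \<Rightarrow> real" where "cx y = snd (coords y)"

lemma cell_point:
  assumes "y \<in> points Z'" "y \<notin> points Z"
  shows "ci y \<in> J" "cx y \<in> dsk" "cx y \<in> EE (Suc n)" "nr (cx y) < 1" "\<Phi> (ci y, cx y) = y"
proof -
  obtain j x where "j \<in> J" "x \<in> dsk" "nr x < 1" "y = \<Phi> (j, x)"
    using cell_cases[OF assms(1)] assms(2) by blast
  then have "\<exists>p. fst p \<in> J \<and> snd p \<in> dsk \<and> nr (snd p) < 1 \<and> y = \<Phi> p"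
    by (intro exI[of _ "(j, x)"]) simp
  from someI_ex[OF this] have "fst (coords y) \<in> J \<and> snd (coords y) \<in> dsk \<and> nr (snd (coords y)) < 1 \<and> y = \<Phi> (coords y)"
    unfolding coords_def .
  then show "ci y \<in> J" "cx y \<in> dsk" "cx y \<in> EE (Suc n)" "nr (cx y) < 1" "\<Phi> (ci y, cx y) = y"
    by (simp_all add: ci_def cx_def)
qed

lemma coords_\<Phi>:
  assumes "j \<in> J" "x \<in> dsk" "nr x < 1"
  shows "ci (\<Phi> (j, x)) = j" "cx (\<Phi> (j, x)) = x"
proof -
  note c = cell_point[OF \<Phi>_in[OF assms(1,2)] \<Phi>_interior[OF assms]]
  show "ci (\<Phi> (j, x)) = j" "cx (\<Phi> (j, x)) = x"
    using \<Phi>_inj[OF c(1,2,4) assms c(5)] by auto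
qed

text \<open>The radius inside the cell. The value 1 on the lower skeleton matches the boundary
  spheres and makes the function continuous on all of \<open>Z'\<close>.\<close>

definition N :: "'x \<Rightarrow> real" where "N y = (if y \<in> points Z then 1 else nr (cx y))"

lemma N_Z: "y \<in> points Z \<Longrightarrow> N y = 1"
  by (simp add: N_def)

lemma \<Phi>_boundary_Z: "j \<in> J \<Longrightarrow> x \<in> dsk \<Longrightarrow> nr x = 1 \<Longrightarrow> \<Phi> (j, x) \<in> points Z"
  using \<Phi>_boundary h_in by simp

lemma N_\<Phi>: "j \<in> J \<Longrightarrow> x \<in> dsk \<Longrightarrow> N (\<Phi> (j, x)) = nr x"
  using \<Phi>_boundary_Z[of j x] \<Phi>_interior[of j x] coords_\<Phi>[of j x] by (cases "nr x = 1") (auto simp: N_def)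

lemma N_less_1: "y \<in> points Z' \<Longrightarrow> N y < 1 \<longleftrightarrow> y \<notin> points Z"
  using cell_point(4) by (auto simp: N_def)

lemma disk_plot_in: "Q \<in> plots (disk_diff (Suc n)) k W \<Longrightarrow> y \<in> W \<Longrightarrow> Q y \<in> dsk"
  by (auto simp: plots_disk)

lemma disk_plot_smooth_eucl:
  "Q \<in> plots (disk_diff (Suc n)) k W \<Longrightarrow> smooth_eucl k W (Suc n) (EE (Suc n)) Q"
  by (auto simp: plots_disk smooth_eucl_def)

text \<open>By \<open>Z'_plot\<close>, every plot of \<open>Z'\<close> is locally of one of the two
  kinds tested here.\<close>

lemma D_openI:
  assumes "A \<subseteq> points Z'"
    and "\<And>k W P. P \<in> plots Z k W \<Longrightarrow> openin (Euclidean_space k) {y \<in> W. P y \<in> A}"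
    and "\<And>k W j Q. j \<in> J \<Longrightarrow> Q \<in> plots (disk_diff (Suc n)) k W \<Longrightarrow> openin (Euclidean_space k) {y \<in> W. \<Phi> (j, Q y) \<in> A}"
  shows "D_open Z' A"
  unfolding D_open_def
proof (intro conjI assms(1) allI ballI)
  fix k U P assume P: "P \<in> plots Z' k U"
  show "openin (Euclidean_space k) {x \<in> U. P x \<in> A}"
  proof (rule local_plots_vimage)
    fix x assume x: "x \<in> U"
    obtain W where W: "openin (Euclidean_space k) W" "x \<in> W" "W \<subseteq> U"
      "P \<in> plots Z k W \<or> (\<exists>j\<in>J. \<exists>Q\<in>plots (disk_diff (Suc n)) k W. \<forall>y\<in>W. P y = \<Phi> (j, Q y))"
      using Z'_plot[OF P x] by (elim exE conjE) (rule that)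
    from W(4) have "openin (Euclidean_space k) {y \<in> W. P y \<in> A}"
    proof
      assume "\<exists>j\<in>J. \<exists>Q\<in>plots (disk_diff (Suc n)) k W. \<forall>y\<in>W. P y = \<Phi> (j, Q y)"
      then obtain j Q where Q: "j \<in> J" "Q \<in> plots (disk_diff (Suc n)) k W" "\<forall>y\<in>W. P y = \<Phi> (j, Q y)" by blast
      have "{y \<in> W. P y \<in> A} = {y \<in> W. \<Phi> (j, Q y) \<in> A}"
        using Q(3) by auto
      then show ?thesis using assms(3)[OF Q(1,2)] by simp
    qed (rule assms(2))
    with W(1-3) show "\<exists>W. openin (Euclidean_space k) W \<and> x \<in> W \<and> W \<subseteq> U \<and> openin (Euclidean_space k) {y \<in> W. P y \<in> A}"
      by blast
  qed
qed

lemma continuous_map_nr: "continuous_map (Euclidean_space (Suc n)) euclideanreal nr"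
proof -
  have "continuous_map (Euclidean_space (Suc n)) euclideanreal (\<lambda>x. sqrt (\<Sum>i<Suc n. (x i - 0)\<^sup>2))"
    using continuous_map_compose[OF continuous_map_sumsq[where m="Suc n" and k="Suc n" and c="\<lambda>_. 0"],
        where g=sqrt and X''=euclideanreal]
    by (simp add: o_def continuous_on_real_sqrt)
  then show ?thesis
    by (simp only: diff_zero nr_def[abs_def] L2_set_def[abs_def])
qed

lemma openin_nr: "open S \<Longrightarrow> openin (Euclidean_space (Suc n)) {x \<in> EE (Suc n). nr x \<in> S}"
  using openin_continuous_map_preimage[OF continuous_map_nr, of S] by simp

lemma topspace_D: "topspace (D_topology Z) = points Z" "topspace (D_topology Z') = points Z'"
  using topspace_D_topology Z Z' by auto

lemma continuous_map_N: "continuous_map (D_topology Z') euclideanreal N"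
proof -
  have "D_open Z' {y \<in> points Z'. N y \<in> S}" if S: "open S" for S
  proof (rule D_openI)
    fix k W P assume P: "P \<in> plots Z k W"
    have "P y \<in> points Z" if "y \<in> W" for y
      using diffeological_spaceD(2)[OF Z P] that by blast
    then have "{y \<in> W. P y \<in> {y \<in> points Z'. N y \<in> S}} = (if 1 \<in> S then W else {})"
      using Z_sub by (auto simp: N_Z)
    then show "openin (Euclidean_space k) {y \<in> W. P y \<in> {y \<in> points Z'. N y \<in> S}}"
      using diffeological_spaceD(1)[OF Z P] by simp
  next
    fix k W j Q assume Q: "j \<in> J" "Q \<in> plots (disk_diff (Suc n)) k W"
    have "{y \<in> W. \<Phi> (j, Q y) \<in> {y \<in> points Z'. N y \<in> S}} = {y \<in> W. Q y \<in> {x \<in> EE (Suc n). nr x \<in> S}}"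
      using N_\<Phi>[OF Q(1)] \<Phi>_in[OF Q(1)] disk_plot_in[OF Q(2)] by auto
    then show "openin (Euclidean_space k) {y \<in> W. \<Phi> (j, Q y) \<in> {y \<in> points Z'. N y \<in> S}}"
      using smooth_eucl_openin_vimage[OF disk_plot_smooth_eucl[OF Q(2)] openin_nr[OF S]] by simp
  qed auto
  then show ?thesis
    by (auto simp: continuous_map_def topspace_D openin_D_topology)
qed

lemma nr_sq': "(\<Sum>i<Suc n. x i * x i) = (nr x)\<^sup>2"
  unfolding nr_sq[symmetric] by (simp only: power2_eq_square)

lemma powr_nr: "0 < nr x \<Longrightarrow> (nr x)\<^sup>2 powr (-1/2) = 1 / nr x"
  using powr_half_sqrt[of "(nr x)\<^sup>2"] powr_minus_divide[of "(nr x)\<^sup>2" "1/2"] by simp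

lemma normalize:
  assumes "x \<in> EE (Suc n)" "0 < nr x"
  shows "(\<lambda>i. 1 / nr x * x i) \<in> dsk" "nr (\<lambda>i. 1 / nr x * x i) = 1"
proof -
  show n: "nr (\<lambda>i. 1 / nr x * x i) = 1"
    unfolding nr_scale using assms(2) by simp
  have "(\<lambda>i. 1 / nr x * x i) \<in> EE (Suc n)"
    using assms(1) by (simp add: topspace_Euclidean_space)
  with n show "(\<lambda>i. 1 / nr x * x i) \<in> dsk"
    by simp
qed

text \<open>Radial retraction onto the lower skeleton. At the centre of a cell the division by 0
  produces an irrelevant value; the map is meant for \<open>collar\<close>.\<close>

definition rt :: "'x \<Rightarrow> 'x" where
  "rt y = (if y \<in> points Z then y else h (ci y, \<lambda>i. 1 / nr (cx y) * cx y i))"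

lemma rt_Z: "y \<in> points Z \<Longrightarrow> rt y = y"
  by (simp add: rt_def)

lemma rt_\<Phi>: "j \<in> J \<Longrightarrow> x \<in> dsk \<Longrightarrow> rt (\<Phi> (j, x)) = h (j, \<lambda>i. 1 / nr x * x i)"
  using \<Phi>_boundary_Z[of j x] \<Phi>_interior[of j x] coords_\<Phi>[of j x] \<Phi>_boundary[of j x]
  by (cases "nr x = 1") (auto simp: rt_def)

lemma nr_sum_smooth: "Q \<in> plots (disk_diff (Suc n)) k W \<Longrightarrow> smooth_fun k W (\<lambda>y. (nr (Q y))\<^sup>2)"
  unfolding nr_sq'[symmetric] by (intro smooth_fun_sum smooth_fun_mult) (auto simp: plots_disk)

text \<open>Writing the inverse norm as the power -1/2 of the squared norm makes it smooth away from
  the origin; the normalized map is a plot of the sphere and can be followed by the attaching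
  map.\<close>

lemma radial_plot:
  assumes j: "j \<in> J" and Q: "Q \<in> plots (disk_diff (Suc n)) k W" and pos: "\<And>y. y \<in> W \<Longrightarrow> 0 < nr (Q y)"
  shows "(\<lambda>y. h (j, \<lambda>i. 1 / nr (Q y) * Q y i)) \<in> plots Z k W"
proof -
  have W: "openin (Euclidean_space k) W" and Qs: "\<And>i. i < Suc n \<Longrightarrow> smooth_fun k W (\<lambda>y. Q y i)"
    using Q by (auto simp: plots_disk)
  let ?q = "\<lambda>y i. 1 / nr (Q y) * Q y i"
  have q: "?q y \<in> {x \<in> EE (Suc n). nr x = 1}" if "y \<in> W" for y
    using normalize[of "Q y"] disk_plot_in[OF Q that] pos[OF that] by blast
  have sm: "smooth_fun k W (\<lambda>y. ((nr (Q y))\<^sup>2) powr (-1/2) * Q y i)" if "i < Suc n" for i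
    by (intro smooth_fun_mult smooth_fun_powr nr_sum_smooth[OF Q] Qs[OF that]) (use pos in force)
  have "smooth_fun k W (\<lambda>y. ?q y i)" if "i < Suc n" for i
    by (rule smooth_fun_cong[OF sm[OF that]]) (simp only: powr_nr[OF pos])
  then have qp: "?q \<in> plots (sphere_diff n) k W"
    unfolding plots_sphere using W q by blast
  have "(\<lambda>y. (j, ?q y)) \<in> plots (coprod_diff J (\<lambda>_. sphere_diff n)) k W"
    by (rule coprod_plot[OF j qp W]) (use q in \<open>simp only: points_sphere Pi_iff; blast\<close>)
  then have "h \<circ> (\<lambda>y. (j, ?q y)) \<in> plots Z k W"
    using h unfolding smooth_map_def by blast
  then show ?thesis by (simp add: o_def)
qed

text \<open>From radius 1/2 on, \<open>nu\<close> is exactly the inverse norm, so on this set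
  \<open>push\<close> ends at \<open>rt\<close>.\<close>

definition collar :: "'x set" where "collar = {y \<in> points Z'. 1/2 < N y}"

lemma D_open_collar: "D_open Z' collar"
proof -
  have "openin (D_topology Z') {y \<in> topspace (D_topology Z'). N y \<in> {1/2<..}}"
    by (rule openin_continuous_map_preimage[OF continuous_map_N]) simp
  then show ?thesis
    by (simp add: topspace_D openin_D_topology collar_def)
qed

lemma Z_collar: "points Z \<subseteq> collar"
  using Z_sub by (auto simp: collar_def N_Z)

lemma rt_smooth: "smooth_map (sub_diff Z' collar) Z rt"
  unfolding smooth_map_def
proof (intro conjI allI ballI)
  show "rt \<in> points (sub_diff Z' collar) \<rightarrow> points Z"
  proof
    fix y assume "y \<in> points (sub_diff Z' collar)"
    then have y: "y \<in> points Z'" "1/2 < N y" by (auto simp: collar_def)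
    show "rt y \<in> points Z"
    proof (cases "y \<in> points Z")
      case False
      note c = cell_point[OF y(1) False]
      have "0 < nr (cx y)" using y(2) False by (simp add: N_def)
      then have "(\<lambda>i. 1 / nr (cx y) * cx y i) \<in> dsk" "nr (\<lambda>i. 1 / nr (cx y) * cx y i) = 1"
        using normalize[OF c(3)] by blast+
      then show ?thesis
        using h_in[OF c(1)] False by (simp add: rt_def)
    qed (simp add: rt_Z)
  qed
  fix k U P assume "P \<in> plots (sub_diff Z' collar) k U"
  then have P: "P \<in> plots Z' k U" "P \<in> U \<rightarrow> collar" by auto
  show "rt \<circ> P \<in> plots Z k U"
  proof (rule diffeological_space_local[OF Z])
    fix x assume x: "x \<in> U"
    obtain W where W: "openin (Euclidean_space k) W" "x \<in> W" "W \<subseteq> U"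
      "P \<in> plots Z k W \<or> (\<exists>j\<in>J. \<exists>Q\<in>plots (disk_diff (Suc n)) k W. \<forall>y\<in>W. P y = \<Phi> (j, Q y))"
      using Z'_plot[OF P(1) x] by (elim exE conjE) (rule that)
    from W(4) have "rt \<circ> P \<in> plots Z k W"
    proof
      assume PZ: "P \<in> plots Z k W"
      show ?thesis
        by (rule diffeological_spaceD(5)[OF Z PZ]) (use diffeological_spaceD(2)[OF Z PZ] rt_Z in force)
    next
      assume "\<exists>j\<in>J. \<exists>Q\<in>plots (disk_diff (Suc n)) k W. \<forall>y\<in>W. P y = \<Phi> (j, Q y)"
      then obtain j Q where Q: "j \<in> J" "Q \<in> plots (disk_diff (Suc n)) k W" "\<forall>y\<in>W. P y = \<Phi> (j, Q y)" by blast
      have "0 < nr (Q y)" if "y \<in> W" for y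
      proof -
        have "P y \<in> collar"
          using P(2) W(3) that by blast
        then have "\<Phi> (j, Q y) \<in> collar"
          using Q(3) that by simp
        then show ?thesis
          using N_\<Phi>[OF Q(1) disk_plot_in[OF Q(2) that]] by (simp add: collar_def)
      qed
      from radial_plot[OF Q(1,2) this] show ?thesis
      proof (rule diffeological_spaceD(5)[OF Z])
        fix y assume y: "y \<in> W"
        show "h (j, \<lambda>i. 1 / nr (Q y) * Q y i) = (rt \<circ> P) y"
          using rt_\<Phi>[OF Q(1) disk_plot_in[OF Q(2) y]] Q(3) y by simp
      qed
    qed
    with W(1-3) show "\<exists>W. openin (Euclidean_space k) W \<and> x \<in> W \<and> W \<subseteq> U \<and> rt \<circ> P \<in> plots Z k W"
      by blast
  qed
qed

lemma rt_continuous: "continuous_map (subtopology (D_topology Z') collar) (D_topology Z) rt"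
  by (rule smooth_imp_continuous[OF D_open_collar rt_smooth Z' Z])

text \<open>Preimages under the retraction of the collar extend D-open sets, so the topology of
  \<open>Z\<close> is induced from \<open>Z'\<close>.\<close>

lemma D_open_extend:
  assumes "D_open Z W"
  shows "\<exists>W'. D_open Z' W' \<and> W' \<inter> points Z = W"
proof (intro exI conjI)
  show "D_open Z' {y \<in> collar. rt y \<in> W}"
    by (rule D_open_vimage[OF D_open_collar rt_smooth assms Z'])
  show "{y \<in> collar. rt y \<in> W} \<inter> points Z = W"
    using assms Z_collar by (auto simp: rt_Z D_open_def)
qed

text \<open>Composing with \<open>rt\<close> does not change such a map and lands in the plots of
  \<open>Z\<close>: the diffeology of \<open>Z\<close> is induced from \<open>Z'\<close>, which the
  definition of a pushout does not assert.\<close>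

lemma plot_into_Z:
  assumes "P \<in> plots Z' k U" "P \<in> U \<rightarrow> points Z"
  shows "P \<in> plots Z k U"
proof -
  have "P \<in> plots (sub_diff Z' collar) k U"
    using assms Z_collar by auto
  then have "rt \<circ> P \<in> plots Z k U"
    using rt_smooth unfolding smooth_map_def by blast
  then show ?thesis
    by (rule diffeological_spaceD(5)[OF Z]) (use assms(2) rt_Z in auto)
qed

subsection \<open>Pushing the collar to the boundary\<close>

text \<open>Scaling by \<open>nu\<close> is the radial retraction outside the ball of radius \<open>1/2\<close>; the summand
  \<open>flat\<close> keeps it smooth at the origin.\<close>

definition nu :: "(nat \<Rightarrow> real) \<Rightarrow> real" where
  "nu x = ((nr x)\<^sup>2 + flat 0 (1/4 - (nr x)\<^sup>2)) powr (-1/2)"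

definition scl :: "real \<Rightarrow> (nat \<Rightarrow> real) \<Rightarrow> real" where
  "scl s x = 1 + smooth_step s * (nu x - 1)"

lemma nu_base_pos: "0 < (nr x)\<^sup>2 + flat 0 (1/4 - (nr x)\<^sup>2)"
proof (cases "(nr x)\<^sup>2 < 1/4")
  case True
  then have "0 < flat 0 (1/4 - (nr x)\<^sup>2)" by (simp add: flat_0)
  then show ?thesis by (simp add: add_nonneg_pos)
next
  case False
  then have "0 < (nr x)\<^sup>2" by linarith
  then show ?thesis by (simp add: flat_0 add_pos_nonneg)
qed

lemma nu_collar: "1/2 \<le> nr x \<Longrightarrow> nu x = 1 / nr x"
proof -
  assume a: "1/2 \<le> nr x"
  then have "1/4 \<le> (nr x)\<^sup>2"
    using power_mono[of "1/2" "nr x" 2] by (simp add: power2_eq_square)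
  then show ?thesis
    using powr_nr[of x] a by (simp add: nu_def flat_0)
qed

text \<open>The nonnegative flat term in the base can only shorten the scaled vector, so scaling by
  \<open>nu\<close> stays in the closed disk.\<close>

lemma nu_bounds: "0 \<le> nu x" "nu x * nr x \<le> 1"
proof -
  show "0 \<le> nu x" by (simp add: nu_def)
  have "(nu x * nr x)\<^sup>2 = (nr x)\<^sup>2 / ((nr x)\<^sup>2 + flat 0 (1/4 - (nr x)\<^sup>2))"
  proof -
    let ?b = "(nr x)\<^sup>2 + flat 0 (1/4 - (nr x)\<^sup>2)"
    have "(?b powr (-1/2))\<^sup>2 = ?b powr (-1)"
      using nu_base_pos[of x] by (simp add: powr_power)
    then have "(nu x)\<^sup>2 = 1 / ?b"
      using nu_base_pos[of x] by (simp add: nu_def powr_minus_divide)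
    then show ?thesis
      unfolding power_mult_distrib by simp
  qed
  also have "\<dots> \<le> 1"
    using nu_base_pos[of x] by (simp add: flat_0 divide_le_eq)
  finally show "nu x * nr x \<le> 1"
    by (metis abs_le_D1 abs_square_le_1)
qed

lemma scl_dsk: "x \<in> dsk \<Longrightarrow> (\<lambda>i. scl s x * x i) \<in> dsk"
proof -
  assume x: "x \<in> dsk"
  let ?c = "smooth_step s"
  have s: "scl s x = (1 - ?c) + ?c * nu x"
    by (simp add: scl_def algebra_simps)
  have "0 \<le> scl s x"
    unfolding s using smooth_step_bounds[of s] nu_bounds(1) by (simp add: add_nonneg_nonneg)
  moreover have "scl s x * nr x \<le> 1"
  proof -
    have "scl s x * nr x = (1 - ?c) * nr x + ?c * (nu x * nr x)"
      unfolding s by (simp add: algebra_simps)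
    also have "\<dots> \<le> 1"
      using x nu_bounds(2)[of x] smooth_step_bounds[of s] by (intro convex_bound_le) auto
    finally show ?thesis .
  qed
  ultimately show ?thesis
    using x by (auto simp: topspace_Euclidean_space nr_scale)
qed

definition push :: "'x \<times> real \<Rightarrow> 'x" where
  "push p = (if fst p \<in> points Z then fst p else \<Phi> (ci (fst p), \<lambda>i. scl (snd p) (cx (fst p)) * cx (fst p) i))"

text \<open>Compatibility with the gluing: on the boundary sphere \<open>nu\<close> is 1, hence so
  is every scaling factor, and the point stays fixed as it does in \<open>Z\<close>.\<close>

lemma push_\<Phi>:
  assumes "j \<in> J" "x \<in> dsk"
  shows "push (\<Phi> (j, x), s) = \<Phi> (j, \<lambda>i. scl s x * x i)"
proof (cases "nr x = 1")
  case True
  then have "scl s x = 1"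
    by (simp add: scl_def nu_collar)
  then show ?thesis
    using \<Phi>_boundary_Z[OF assms True] by (simp add: push_def)
next
  case False
  then have x: "nr x < 1" using assms(2) by simp
  show ?thesis
    using coords_\<Phi>[OF assms x] \<Phi>_interior[OF assms x] by (simp add: push_def)
qed

lemma push_Z: "y \<in> points Z \<Longrightarrow> push (y, s) = y"
  by (simp add: push_def)

lemma push_id: "y \<in> points Z' \<Longrightarrow> s \<le> 1/3 \<Longrightarrow> push (y, s) = y"
  using cell_point(5)[of y] by (auto simp: push_def scl_def smooth_step_0)

lemma push_rt: "y \<in> collar \<Longrightarrow> 2/3 \<le> s \<Longrightarrow> push (y, s) = rt y"
proof (cases "y \<in> points Z")
  case False
  assume y: "y \<in> collar" and s: "2/3 \<le> s"
  then have yZ: "y \<in> points Z'" "1/2 < nr (cx y)"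
    using False by (auto simp: collar_def N_def)
  note c = cell_point[OF yZ(1) False]
  let ?x = "\<lambda>i. 1 / nr (cx y) * cx y i"
  have "scl s (cx y) = 1 / nr (cx y)"
    using yZ(2) s by (simp add: scl_def nu_collar smooth_step_1)
  moreover have "?x \<in> dsk" "nr ?x = 1"
    using yZ(2) normalize[OF c(3)] by simp_all
  ultimately show ?thesis
    using \<Phi>_boundary[OF c(1), of ?x] False by (simp add: push_def rt_def)
qed (simp add: push_Z rt_Z)

text \<open>On plots of \<open>Z\<close> the map is the projection to the first factor. On a disk it
  is scaling by \<open>scl\<close>, which is smooth at the origin and on the boundary alike, so
  points of the attaching spheres need no separate treatment.\<close>

lemma push_smooth: "smooth_map (prod_diff Z' real_diff) Z' push"
  unfolding smooth_map_def
proof (intro conjI allI ballI)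
  have "push (y, s) \<in> points Z'" if y: "y \<in> points Z'" for y s
  proof (cases "y \<in> points Z")
    case False
    show ?thesis
      using \<Phi>_in[OF cell_point(1)[OF y False] scl_dsk[OF cell_point(2)[OF y False]]] False by (simp add: push_def)
  qed (use Z_sub in \<open>auto simp: push_Z\<close>)
  then show "push \<in> points (prod_diff Z' real_diff) \<rightarrow> points Z'"
    by (auto simp: prod_diff_def)
next
  fix k U P assume "P \<in> plots (prod_diff Z' real_diff) k U"
  then have P: "fst \<circ> P \<in> plots Z' k U" "smooth_fun k U (snd \<circ> P)"
    by (simp_all add: prod_diff_def)
  show "push \<circ> P \<in> plots Z' k U"
  proof (rule diffeological_space_local[OF Z'])
    fix x assume x: "x \<in> U"
    obtain W where W: "openin (Euclidean_space k) W" "x \<in> W" "W \<subseteq> U"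
      "fst \<circ> P \<in> plots Z k W \<or> (\<exists>j\<in>J. \<exists>Q\<in>plots (disk_diff (Suc n)) k W. \<forall>y\<in>W. (fst \<circ> P) y = \<Phi> (j, Q y))"
      using Z'_plot[OF P(1) x] by (elim exE conjE) (rule that)
    from W(4) have "push \<circ> P \<in> plots Z' k W"
    proof
      assume PZ: "fst \<circ> P \<in> plots Z k W"
      show ?thesis
        by (rule diffeological_spaceD(5)[OF Z' Z_plot[OF PZ]])
           (use diffeological_spaceD(2)[OF Z PZ] in \<open>force simp: push_def\<close>)
    next
      assume "\<exists>j\<in>J. \<exists>Q\<in>plots (disk_diff (Suc n)) k W. \<forall>y\<in>W. (fst \<circ> P) y = \<Phi> (j, Q y)"
      then obtain j Q where Q: "j \<in> J" "Q \<in> plots (disk_diff (Suc n)) k W" "\<forall>y\<in>W. fst (P y) = \<Phi> (j, Q y)" by auto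
      have sn: "smooth_fun k W (\<lambda>y. snd (P y))"
        using smooth_fun_subset[OF P(2) W(1,3)] by (simp add: o_def)
      let ?q = "\<lambda>y i. scl (snd (P y)) (Q y) * Q y i"
      have "smooth_fun k W (\<lambda>y. ?q y i)" if "i < Suc n" for i
        unfolding scl_def nu_def
        by (intro smooth_fun_mult smooth_fun_add smooth_fun_diff smooth_fun_const smooth_fun_smooth_step
            smooth_fun_powr smooth_fun_flat nr_sum_smooth[OF Q(2)] sn W(1) nu_base_pos)
           (use Q(2) that plots_disk in auto)
      then have "?q \<in> plots (disk_diff (Suc n)) k W"
        unfolding plots_disk using W(1) scl_dsk disk_plot_in[OF Q(2)] by blast
      from \<Phi>_plot[OF Q(1) this] show ?thesis
      proof (rule diffeological_spaceD(5)[OF Z'])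
        fix y assume y: "y \<in> W"
        then have "P y = (\<Phi> (j, Q y), snd (P y))"
          using Q(3) by (metis prod.collapse)
        then show "\<Phi> (j, ?q y) = (push \<circ> P) y"
          using push_\<Phi>[OF Q(1) disk_plot_in[OF Q(2) y], of "snd (P y)"] by simp
      qed
    qed
    with W(1-3) show "\<exists>W. openin (Euclidean_space k) W \<and> x \<in> W \<and> W \<subseteq> U \<and> push \<circ> P \<in> plots Z' k W"
      by blast
  qed
qed

lemma push_continuous: "continuous_map (prod_topology (D_topology Z') euclideanreal) (D_topology Z') push"
  by (rule smooth_imp_continuous_prod_real[OF Z' Z' push_smooth])

subsection \<open>Coordinates of the open cells\<close>

definition oball :: "(nat \<Rightarrow> real) set" where "oball = {x \<in> EE (Suc n). nr x < 1}"

lemma openin_oball: "openin (Euclidean_space (Suc n)) oball"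
  using openin_nr[of "{..<1}"] by (simp add: oball_def)

lemma oball_dsk: "oball \<subseteq> dsk"
  by (auto simp: oball_def)

lemma \<Phi>_continuous:
  assumes j: "j \<in> J"
  shows "continuous_map (subtopology (Euclidean_space (Suc n)) oball) (D_topology Z') (\<lambda>x. \<Phi> (j, x))"
proof -
  have "(\<lambda>x. x) \<in> plots (disk_diff (Suc n)) (Suc n) oball"
    unfolding plots_disk using openin_oball oball_dsk by (auto intro: smooth_fun_coord)
  then have p: "(\<lambda>x. \<Phi> (j, x)) \<in> plots Z' (Suc n) oball"
    using \<Phi>_plot[OF j, of "\<lambda>x. x"] by simp
  have t: "topspace (subtopology (Euclidean_space (Suc n)) oball) = oball"
    using openin_subset[OF openin_oball] by auto
  have "openin (subtopology (Euclidean_space (Suc n)) oball) {x \<in> oball. \<Phi> (j, x) \<in> W}"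
    if "openin (D_topology Z') W" for W
  proof -
    have "openin (Euclidean_space (Suc n)) {x \<in> oball. \<Phi> (j, x) \<in> W}"
      using that p unfolding openin_D_topology by (rule D_openD)
    then show ?thesis
      using openin_oball by (subst openin_open_subtopology) auto
  qed
  then show ?thesis
    unfolding continuous_map_def t topspace_D using \<Phi>_in[OF j] oball_dsk by blast
qed

text \<open>In the disk with index j the preimage is the intersection of B with the open ball; in
  every other disk and in \<open>Z\<close> it is empty.\<close>

lemma openin_cell:
  assumes B: "openin (Euclidean_space (Suc n)) B"
  shows "openin (D_topology Z') {y \<in> points Z' - points Z. ci y = j \<and> cx y \<in> B}"
  unfolding openin_D_topology
proof (rule D_openI)
  fix k W P assume P: "P \<in> plots Z k W"
  have "{y \<in> W. P y \<in> {y \<in> points Z' - points Z. ci y = j \<and> cx y \<in> B}} = {}"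
    using diffeological_spaceD(2)[OF Z P] by auto
  then show "openin (Euclidean_space k) {y \<in> W. P y \<in> {y \<in> points Z' - points Z. ci y = j \<and> cx y \<in> B}}"
    by (simp only: openin_empty)
next
  fix k W j' Q assume Q: "j' \<in> J" "Q \<in> plots (disk_diff (Suc n)) k W"
  have "\<Phi> (j', Q y) \<in> {y \<in> points Z' - points Z. ci y = j \<and> cx y \<in> B} \<longleftrightarrow> j' = j \<and> Q y \<in> B \<inter> oball"
    if y: "y \<in> W" for y
  proof (cases "nr (Q y) = 1")
    case True
    then show ?thesis
      using \<Phi>_boundary_Z[OF Q(1) disk_plot_in[OF Q(2) y]] by (simp add: oball_def)
  next
    case False
    note d = disk_plot_in[OF Q(2) y]
    then have "nr (Q y) < 1" using False by simp
    then show ?thesis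
      using coords_\<Phi>[OF Q(1) d] \<Phi>_interior[OF Q(1) d] \<Phi>_in[OF Q(1) d] d by (auto simp: oball_def)
  qed
  then have "{y \<in> W. \<Phi> (j', Q y) \<in> {y \<in> points Z' - points Z. ci y = j \<and> cx y \<in> B}} =
      (if j' = j then {y \<in> W. Q y \<in> B \<inter> oball} else {})"
    by auto
  then show "openin (Euclidean_space k) {y \<in> W. \<Phi> (j', Q y) \<in> {y \<in> points Z' - points Z. ci y = j \<and> cx y \<in> B}}"
    using smooth_eucl_openin_vimage[OF disk_plot_smooth_eucl[OF Q(2)] openin_Int[OF B openin_oball]] by simp
qed auto

text \<open>Off \<open>Z\<close> a plot locally lifts to one disk, and by uniqueness of coordinates
  the lift is \<open>cx \<circ> P\<close>.\<close>

lemma cx_smooth: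
  assumes P: "P \<in> plots Z' k U" and int: "\<And>y. y \<in> U \<Longrightarrow> P y \<notin> points Z" and i: "i < Suc n"
  shows "smooth_fun k U (\<lambda>y. cx (P y) i)"
proof (rule smooth_fun_local)
  fix x assume x: "x \<in> U"
  obtain W where W: "openin (Euclidean_space k) W" "x \<in> W" "W \<subseteq> U"
    "P \<in> plots Z k W \<or> (\<exists>j\<in>J. \<exists>Q\<in>plots (disk_diff (Suc n)) k W. \<forall>y\<in>W. P y = \<Phi> (j, Q y))"
    using Z'_plot[OF P x] by (elim exE conjE) (rule that)
  have "P \<notin> plots Z k W"
    using diffeological_spaceD(2)[OF Z] int[OF x] W(2) by blast
  then obtain j Q where Q: "j \<in> J" "Q \<in> plots (disk_diff (Suc n)) k W" "\<forall>y\<in>W. P y = \<Phi> (j, Q y)"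
    using W(4) by blast
  have "cx (P y) = Q y" if y: "y \<in> W" for y
  proof -
    have d: "Q y \<in> dsk" by (rule disk_plot_in[OF Q(2) y])
    have "nr (Q y) \<noteq> 1"
      using \<Phi>_boundary_Z[OF Q(1) d] int[of y] Q(3) y W(3) by auto
    then show ?thesis
      using coords_\<Phi>(2)[OF Q(1) d] d Q(3) y by auto
  qed
  moreover have "smooth_fun k W (\<lambda>y. Q y i)"
    using Q(2) i by (simp add: plots_disk)
  ultimately have "smooth_fun k W (\<lambda>y. cx (P y) i)"
    by (auto elim: smooth_fun_cong)
  with W(1-3) show "\<exists>W. openin (Euclidean_space k) W \<and> x \<in> W \<and> W \<subseteq> U \<and> smooth_fun k W (\<lambda>y. cx (P y) i)"
    by blast
qed

end

section \<open>Homotopies and smooth maps on open subsets of a manifold\<close>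

lemma continuous_map_local:
  assumes "\<And>x. x \<in> topspace X \<Longrightarrow> \<exists>U. openin X U \<and> x \<in> U \<and> continuous_map (subtopology X U) Y f"
  shows "continuous_map X Y f"
proof -
  have "\<forall>x\<in>topspace X. \<exists>U. openin X U \<and> x \<in> U \<and> continuous_map (subtopology X U) Y f"
    using assms by (rule ballI)
  from bchoice[OF this] obtain U where
    U: "\<forall>x\<in>topspace X. openin X (U x) \<and> x \<in> U x \<and> continuous_map (subtopology X (U x)) Y f" ..
  show ?thesis
    by (rule pasting_lemma[where I="topspace X" and T=U and f="\<lambda>_. f"]) (use U in auto)
qed

definition clamp01 :: "real \<Rightarrow> real" where "clamp01 t = max 0 (min 1 t)"

lemma clamp01_simps: "0 \<le> clamp01 t" "clamp01 t \<le> 1" "t \<le> 0 \<Longrightarrow> clamp01 t = 0" "1 \<le> t \<Longrightarrow> clamp01 t = 1"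
  by (auto simp: clamp01_def)

lemma continuous_map_clamp01:
  "continuous_map X euclideanreal f \<Longrightarrow> continuous_map X euclideanreal (\<lambda>x. clamp01 (f x))"
  unfolding clamp01_def by (intro continuous_map_real_max continuous_map_real_min continuous_map_const[THEN iffD2]) auto

context manifold begin

text \<open>The time is an arbitrary real number and the homotopy is constant before 0 and after 1,
  which makes concatenation a case distinction. The intervals near 0 and 1 demanded by
  \<open>continuous_homotopy\<close> come from a final change of time.\<close>

definition homot :: "'m set \<Rightarrow> 'y topology \<Rightarrow> 'm set \<Rightarrow> ('m \<Rightarrow> 'y) \<Rightarrow> ('m \<Rightarrow> 'y) \<Rightarrow> bool" where
  "homot V Y A f g \<longleftrightarrow>
     (\<exists>H. continuous_map (prod_topology (subtopology T V) euclideanreal) Y H \<and>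
        (\<forall>x\<in>V. \<forall>t. (t \<le> 0 \<longrightarrow> H (x, t) = f x) \<and> (1 \<le> t \<longrightarrow> H (x, t) = g x)) \<and>
        (\<forall>x\<in>A. \<forall>t. x \<in> V \<longrightarrow> H (x, t) = f x))"

lemma homotI:
  assumes "continuous_map (prod_topology (subtopology T V) euclideanreal) Y H"
    "\<And>x t. x \<in> V \<Longrightarrow> t \<le> 0 \<Longrightarrow> H (x, t) = f x" "\<And>x t. x \<in> V \<Longrightarrow> 1 \<le> t \<Longrightarrow> H (x, t) = g x"
    "\<And>x t. x \<in> A \<Longrightarrow> x \<in> V \<Longrightarrow> H (x, t) = f x"
  shows "homot V Y A f g"
  unfolding homot_def using assms by (intro exI[of _ H]) simp

lemma homotE:
  assumes "homot V Y A f g"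
  obtains H where "continuous_map (prod_topology (subtopology T V) euclideanreal) Y H"
    "\<And>x t. x \<in> V \<Longrightarrow> t \<le> 0 \<Longrightarrow> H (x, t) = f x" "\<And>x t. x \<in> V \<Longrightarrow> 1 \<le> t \<Longrightarrow> H (x, t) = g x"
    "\<And>x t. x \<in> A \<Longrightarrow> x \<in> V \<Longrightarrow> H (x, t) = f x"
proof -
  obtain H where H: "continuous_map (prod_topology (subtopology T V) euclideanreal) Y H"
    "\<forall>x\<in>V. \<forall>t. (t \<le> 0 \<longrightarrow> H (x, t) = f x) \<and> (1 \<le> t \<longrightarrow> H (x, t) = g x)"
    "\<forall>x\<in>A. \<forall>t. x \<in> V \<longrightarrow> H (x, t) = f x"
    using assms unfolding homot_def by blast
  show ?thesis
    by (rule that[OF H(1)]) (use H(2,3) in blast)+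
qed

lemma continuous_map_slice:
  assumes "continuous_map (prod_topology X euclideanreal) Y H"
  shows "continuous_map X Y (\<lambda>x. H (x, t))"
proof -
  have "continuous_map X (prod_topology X euclideanreal) (\<lambda>x. (x, t))"
    by (intro continuous_map_pairedI) auto
  from continuous_map_compose[OF this assms] show ?thesis by (simp add: o_def)
qed

lemma topspace_sub: "openin T V \<Longrightarrow> topspace (subtopology T V) = V"
  using openin_subset by auto

lemma homot_continuous:
  assumes "openin T V" "homot V Y A f g"
  shows "continuous_map (subtopology T V) Y f" "continuous_map (subtopology T V) Y g"
proof -
  obtain H where H: "continuous_map (prod_topology (subtopology T V) euclideanreal) Y H"
    "\<And>x t. x \<in> V \<Longrightarrow> t \<le> 0 \<Longrightarrow> H (x, t) = f x" "\<And>x t. x \<in> V \<Longrightarrow> 1 \<le> t \<Longrightarrow> H (x, t) = g x"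
    by (rule homotE[OF assms(2)]) blast
  note t = topspace_sub[OF assms(1)]
  show "continuous_map (subtopology T V) Y f"
    by (rule continuous_map_eq[OF continuous_map_slice[OF H(1), of 0]]) (simp only: t H(2))
  show "continuous_map (subtopology T V) Y g"
    by (rule continuous_map_eq[OF continuous_map_slice[OF H(1), of 1]]) (simp only: t H(3))
qed

lemma homot_subset: "homot V Y A f g \<Longrightarrow> B \<subseteq> A \<Longrightarrow> homot V Y B f g"
  by (erule homotE, rule homotI) blast+

lemma homot_agree: "homot V Y A f g \<Longrightarrow> x \<in> A \<Longrightarrow> x \<in> V \<Longrightarrow> g x = f x"
  by (erule homotE) (metis order_refl)

lemma homot_trans:
  assumes V: "openin T V" and fg: "homot V Y A f g" and gk: "homot V Y A g k"
  shows "homot V Y A f k"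
proof -
  obtain H where H: "continuous_map (prod_topology (subtopology T V) euclideanreal) Y H"
    "\<And>x t. x \<in> V \<Longrightarrow> t \<le> 0 \<Longrightarrow> H (x, t) = f x" "\<And>x t. x \<in> V \<Longrightarrow> 1 \<le> t \<Longrightarrow> H (x, t) = g x"
    "\<And>x t. x \<in> A \<Longrightarrow> x \<in> V \<Longrightarrow> H (x, t) = f x"
    by (rule homotE[OF fg]) blast
  obtain K where K: "continuous_map (prod_topology (subtopology T V) euclideanreal) Y K"
    "\<And>x t. x \<in> V \<Longrightarrow> t \<le> 0 \<Longrightarrow> K (x, t) = g x" "\<And>x t. x \<in> V \<Longrightarrow> 1 \<le> t \<Longrightarrow> K (x, t) = k x"
    "\<And>x t. x \<in> A \<Longrightarrow> x \<in> V \<Longrightarrow> K (x, t) = g x"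
    by (rule homotE[OF gk]) blast
  let ?X = "prod_topology (subtopology T V) euclideanreal"
  have tX: "topspace ?X = V \<times> UNIV"
    using topspace_sub[OF V] by simp
  have rep: "continuous_map ?X ?X (\<lambda>p. (fst p, a * snd p + b))" for a b :: real
    by (intro continuous_map_pairedI continuous_map_fst continuous_map_add continuous_map_real_mult
        continuous_map_snd) auto
  have c1: "continuous_map ?X Y (\<lambda>p. H (fst p, 2 * snd p + 0))"
    using continuous_map_compose[OF rep H(1), of 2 0] by (simp add: o_def)
  have c2: "continuous_map ?X Y (\<lambda>p. K (fst p, 2 * snd p + (-1)))"
    using continuous_map_compose[OF rep K(1), of 2 "-1"] by (simp add: o_def)
  have "continuous_map ?X Y (\<lambda>p. if snd p \<le> 1/2 then H (fst p, 2 * snd p + 0) else K (fst p, 2 * snd p + (-1)))"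
    by (rule continuous_map_cases_le[OF continuous_map_snd continuous_map_const[THEN iffD2]
          continuous_map_from_subtopology[OF c1] continuous_map_from_subtopology[OF c2]])
       (auto simp: tX H(3) K(2))
  then show ?thesis
    by (rule homotI) (use H K homot_agree[OF fg] in auto)
qed

lemma homot_target:
  assumes "homot V Y A f g" "continuous_map Y Y' (\<lambda>y. y)"
  shows "homot V Y' A f g"
  using assms(1)
proof (rule homotE)
  fix H assume H: "continuous_map (prod_topology (subtopology T V) euclideanreal) Y H"
    "\<And>x t. x \<in> V \<Longrightarrow> t \<le> 0 \<Longrightarrow> H (x, t) = f x" "\<And>x t. x \<in> V \<Longrightarrow> 1 \<le> t \<Longrightarrow> H (x, t) = g x"
    "\<And>x t. x \<in> A \<Longrightarrow> x \<in> V \<Longrightarrow> H (x, t) = f x"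
  have "continuous_map (prod_topology (subtopology T V) euclideanreal) Y' H"
    using continuous_map_compose[OF H(1) assms(2)] by (simp add: o_def)
  then show ?thesis
    by (rule homotI) (use H in auto)
qed

lemma homot_cong:
  assumes "homot V Y A f g" "\<And>x. x \<in> V \<Longrightarrow> f x = f' x" "\<And>x. x \<in> V \<Longrightarrow> g x = g' x"
  shows "homot V Y A f' g'"
  using assms(1)
proof (rule homotE)
  fix H assume H: "continuous_map (prod_topology (subtopology T V) euclideanreal) Y H"
    "\<And>x t. x \<in> V \<Longrightarrow> t \<le> 0 \<Longrightarrow> H (x, t) = f x" "\<And>x t. x \<in> V \<Longrightarrow> 1 \<le> t \<Longrightarrow> H (x, t) = g x"
    "\<And>x t. x \<in> A \<Longrightarrow> x \<in> V \<Longrightarrow> H (x, t) = f x"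
  show ?thesis
    by (rule homotI[OF H(1)]) (simp_all add: H(2-4) assms(2,3))
qed

text \<open>The cutoff stops the homotopy at \<open>x\<close> at time \<open>c x\<close>.\<close>

lemma continuous_map_cutoff_extension:
  assumes V: "openin T V" and V': "openin T V'" "V' \<subseteq> V" and f: "continuous_map (subtopology T V) Y f"
    and H: "continuous_map (prod_topology (subtopology T V') euclideanreal) Y H"
    and c: "continuous_map (subtopology T V) euclideanreal c"
    and N: "closedin (subtopology T V) N" "N \<subseteq> V'"
    and off: "\<And>x t. x \<in> V' \<Longrightarrow> x \<notin> N \<Longrightarrow> 0 \<le> t \<Longrightarrow> H (x, t * c x) = f x"
  shows "continuous_map (prod_topology (subtopology T V) euclideanreal) Y
           (\<lambda>p. if fst p \<in> V' then H (fst p, clamp01 (snd p) * c (fst p)) else f (fst p))"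
    (is "continuous_map ?X Y ?K")
proof (rule continuous_map_local)
  have tX: "topspace ?X = V \<times> UNIV"
    using topspace_sub[OF V] by simp
  fix p assume "p \<in> topspace ?X"
  then have p: "fst p \<in> V" using tX by auto
  show "\<exists>U. openin ?X U \<and> p \<in> U \<and> continuous_map (subtopology ?X U) Y ?K"
  proof (cases "fst p \<in> V'")
    case True
    let ?U = "V' \<times> (UNIV :: real set)"
    have "openin (subtopology T V) V'"
      using V V' by (simp add: openin_open_subtopology)
    then have o: "openin ?X ?U"
      by (simp add: openin_prod_Times_iff)
    have e: "subtopology ?X ?U = prod_topology (subtopology T V') euclideanreal"
      by (simp only: subtopology_Times subtopology_subtopology Int_absorb1[OF V'(2)] subtopology_UNIV)
    have "continuous_map (subtopology T V') euclideanreal c"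
      using continuous_map_from_subtopology_mono[OF c V'(2)] .
    from continuous_map_compose[OF continuous_map_fst this]
    have "continuous_map (prod_topology (subtopology T V') euclideanreal) euclideanreal (\<lambda>p. c (fst p))"
      by (simp add: o_def)
    then have "continuous_map (prod_topology (subtopology T V') euclideanreal)
        (prod_topology (subtopology T V') euclideanreal) (\<lambda>p. (fst p, clamp01 (snd p) * c (fst p)))"
      by (intro continuous_map_pairedI continuous_map_fst continuous_map_real_mult continuous_map_clamp01 continuous_map_snd)
    from continuous_map_compose[OF this H]
    have "continuous_map (subtopology ?X ?U) Y (\<lambda>p. H (fst p, clamp01 (snd p) * c (fst p)))"
      by (simp add: e o_def)
    then have "continuous_map (subtopology ?X ?U) Y ?K"
      by (rule continuous_map_eq) auto
    then show ?thesis
      using o True by (intro exI[of _ ?U]) (auto simp: mem_Times_iff)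
  next
    case False
    let ?U = "(V - N) \<times> (UNIV :: real set)"
    have "openin (subtopology T V) (V - N)"
      using N(1) topspace_sub[OF V] by (metis openin_diff openin_topspace)
    then have o: "openin ?X ?U"
      by (simp add: openin_prod_Times_iff)
    have "continuous_map ?X Y (\<lambda>p. f (fst p))"
      using continuous_map_compose[OF continuous_map_fst f] by (simp add: o_def)
    then have "continuous_map (subtopology ?X ?U) Y ?K"
    proof (rule continuous_map_eq[OF continuous_map_from_subtopology])
      fix q assume "q \<in> topspace (subtopology ?X ?U)"
      then have "fst q \<notin> N" by auto
      then show "f (fst q) = ?K q"
        using off[of "fst q" "clamp01 (snd q)"] clamp01_simps(1) by simp
    qed
    then show ?thesis
      using o False p N(2) by (intro exI[of _ ?U]) (auto simp: mem_Times_iff)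
  qed
qed

text \<open>N is closed in V and contains every point that moves, so V' and V - N are an open cover
  of V; on the second set the homotopy is constant and extends by f.\<close>

lemma homot_extend:
  assumes V: "openin T V" and V': "openin T V'" "V' \<subseteq> V" and f: "continuous_map (subtopology T V) Y f"
    and h: "homot V' Y A f g" and N: "closedin (subtopology T V) N" "N \<subseteq> V'" "V' - A \<subseteq> N"
  shows "homot V Y (V - (V' - A)) f (\<lambda>x. if x \<in> V' then g x else f x)"
proof -
  obtain H where H: "continuous_map (prod_topology (subtopology T V') euclideanreal) Y H"
    "\<And>x t. x \<in> V' \<Longrightarrow> t \<le> 0 \<Longrightarrow> H (x, t) = f x" "\<And>x t. x \<in> V' \<Longrightarrow> 1 \<le> t \<Longrightarrow> H (x, t) = g x"
    "\<And>x t. x \<in> A \<Longrightarrow> x \<in> V' \<Longrightarrow> H (x, t) = f x"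
    by (rule homotE[OF h]) blast
  have c: "continuous_map (subtopology T V) euclideanreal (\<lambda>_. 1)"
    by simp
  have off: "\<And>x t. x \<in> V' \<Longrightarrow> x \<notin> N \<Longrightarrow> 0 \<le> t \<Longrightarrow> H (x, t * 1) = f x"
    using H(4) N(3) by blast
  show ?thesis
    by (rule homotI[OF continuous_map_cutoff_extension[OF V V' f H(1) c N(1,2) off]])
       (auto simp: clamp01_simps H)
qed

subsection \<open>Smooth maps into diffeological spaces\<close>

definition msmap :: "'m set \<Rightarrow> 'y diffeology \<Rightarrow> ('m \<Rightarrow> 'y) \<Rightarrow> bool" where
  "msmap V Y f \<longleftrightarrow> smooth_map (sub_diff \<M> V) Y f"

lemma msmap_plot: "msmap V Y f \<Longrightarrow> P \<in> plots \<M> n U \<Longrightarrow> P \<in> U \<rightarrow> V \<Longrightarrow> (\<lambda>x. f (P x)) \<in> plots Y n U"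
  unfolding msmap_def smooth_map_def by (simp add: o_def)

lemma msmap_points: "msmap V Y f \<Longrightarrow> x \<in> V \<Longrightarrow> x \<in> topspace T \<Longrightarrow> f x \<in> points Y"
  unfolding msmap_def smooth_map_def by auto

lemma msmapI:
  assumes "\<And>x. x \<in> V \<Longrightarrow> x \<in> topspace T \<Longrightarrow> f x \<in> points Y"
    "\<And>n U P. P \<in> plots \<M> n U \<Longrightarrow> P \<in> U \<rightarrow> V \<Longrightarrow> (\<lambda>x. f (P x)) \<in> plots Y n U"
  shows "msmap V Y f"
  unfolding msmap_def smooth_map_def using assms by (auto simp: o_def)

lemma msmap_subset: "msmap V Y f \<Longrightarrow> W \<subseteq> V \<Longrightarrow> msmap W Y f"
  by (rule msmapI) (auto intro: msmap_points msmap_plot)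

lemma msmap_cong:
  assumes Y: "diffeological_space Y" and f: "msmap V Y f" and eq: "\<And>x. x \<in> V \<Longrightarrow> f x = g x"
  shows "msmap V Y g"
proof (rule msmapI)
  show "\<And>x. x \<in> V \<Longrightarrow> x \<in> topspace T \<Longrightarrow> g x \<in> points Y"
    using msmap_points[OF f] eq by metis
  fix n U P assume P: "P \<in> plots \<M> n U" "P \<in> U \<rightarrow> V"
  from msmap_plot[OF f P] show "(\<lambda>x. g (P x)) \<in> plots Y n U"
    by (rule diffeological_spaceD(5)[OF Y]) (use P(2) eq in auto)
qed

lemma msmap_local:
  assumes Y: "diffeological_space Y"
    and loc: "\<And>x. x \<in> V \<Longrightarrow> \<exists>W. openin T W \<and> x \<in> W \<and> msmap W Y f"
  shows "msmap V Y f"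
proof (rule msmapI)
  fix x assume x: "x \<in> V" "x \<in> topspace T"
  obtain W where "x \<in> W" "msmap W Y f"
    using loc[OF x(1)] by blast
  then show "f x \<in> points Y"
    using msmap_points x(2) by blast
next
  fix n U P assume P: "P \<in> plots \<M> n U" "P \<in> U \<rightarrow> V"
  show "(\<lambda>x. f (P x)) \<in> plots Y n U"
  proof (rule diffeological_space_local[OF Y])
    fix x assume x: "x \<in> U"
    then have "P x \<in> V" using P(2) by blast
    from loc[OF this] obtain W where W: "openin T W" "P x \<in> W" "msmap W Y f" by blast
    let ?O = "{y \<in> U. P y \<in> W}"
    have o: "openin (Euclidean_space n) ?O"
      using plot_vimage_open[OF P(1) W(1)] .
    have "(\<lambda>x. f (P x)) \<in> plots Y n ?O"
      by (rule msmap_plot[OF W(3) plot_subset[OF P(1) o]]) auto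
    then show "\<exists>W. openin (Euclidean_space n) W \<and> x \<in> W \<and> W \<subseteq> U \<and> (\<lambda>x. f (P x)) \<in> plots Y n W"
      using o x W(2) by (intro exI[of _ ?O]) auto
  qed
qed

lemma msmap_continuous:
  assumes V: "openin T V" and Y: "diffeological_space Y" and f: "msmap V Y f"
  shows "continuous_map (subtopology T V) (D_topology Y) f"
proof -
  have VT: "V \<subseteq> topspace T"
    using openin_subset[OF V] .
  have "openin T {x \<in> V. f x \<in> S}" if S: "D_open Y S" for S
  proof -
    have "D_open \<M> {x \<in> V. f x \<in> S}"
      unfolding D_open_def
    proof (intro conjI allI ballI)
      fix n U P assume P: "P \<in> plots \<M> n U"
      let ?O = "{y \<in> U. P y \<in> V}"
      have o: "openin (Euclidean_space n) ?O"
        using plot_vimage_open[OF P V] .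
      have "(\<lambda>x. f (P x)) \<in> plots Y n ?O"
        by (rule msmap_plot[OF f plot_subset[OF P o]]) auto
      from D_openD[OF S this]
      have "openin (Euclidean_space n) {x \<in> ?O. f (P x) \<in> S}" .
      moreover have "{x \<in> ?O. f (P x) \<in> S} = {x \<in> U. P x \<in> {x \<in> V. f x \<in> S}}"
        by auto
      ultimately show "openin (Euclidean_space n) {x \<in> U. P x \<in> {x \<in> V. f x \<in> S}}"
        by simp
    qed (use VT in auto)
    then show ?thesis
      using openin_D_topology[of \<M>] by (simp add: D_topology_manifold)
  qed
  moreover have "f x \<in> points Y" if "x \<in> V" for x
    using msmap_points[OF f that] VT that by blast
  ultimately show ?thesis
    unfolding continuous_map_def topspace_sub[OF V] topspace_D_topology[OF Y]
    using openin_open_subtopology[OF V] by (auto simp: openin_D_topology)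
qed

lemma openin_level:
  assumes "openin T V" "continuous_map (subtopology T V) euclideanreal a" "open S"
  shows "openin T {x \<in> V. a x \<in> S}"
proof -
  have "openin (subtopology T V) {x \<in> V. a x \<in> S}"
    using openin_continuous_map_preimage[OF assms(2), of S, unfolded topspace_sub[OF assms(1)]] assms(3)
    by simp
  from openin_trans_full[OF this assms(1)] show ?thesis .
qed

lemma closedin_level:
  assumes "openin T V" "continuous_map (subtopology T V) euclideanreal a" "closed S"
  shows "closedin (subtopology T V) {x \<in> V. a x \<in> S}"
  using closedin_continuous_map_preimage[OF assms(2), of S, unfolded topspace_sub[OF assms(1)]] assms(3)
  by simp

end

section \<open>Smoothing across one layer of cells\<close>

text \<open>\<alpha> separates A from the complement of the set where f is smooth; \<beta> separates
  the inner part of the cells from a neighbourhood of the lower skeleton; w is a smooth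
  approximation of the cell coordinates of f. The error 1/8 matches the radius 7/8 from which
  \<beta> vanishes.\<close>

locale cell_map = manifold m T \<A> + cell_attachment n Z Z' J h \<Phi>
  for m :: nat and T :: "'m topology" and \<A> and n and Z Z' :: "'x diffeology" and J :: "'i set" and h \<Phi> +
  fixes V A Om :: "'m set" and f :: "'m \<Rightarrow> 'x" and \<alpha> \<beta> :: "'m \<Rightarrow> real" and w :: "'m \<Rightarrow> nat \<Rightarrow> real"
  assumes V: "openin T V" and f: "continuous_map (subtopology T V) (D_topology Z') f"
    and Om: "openin T Om" "Om \<subseteq> V" "A \<subseteq> Om" and f_smooth: "msmap Om Z' f"
    and \<alpha>: "msmooth V \<alpha>" "\<And>x. x \<in> V \<Longrightarrow> x \<notin> Om \<Longrightarrow> \<alpha> x = 0" "\<And>x. x \<in> A \<Longrightarrow> \<alpha> x = 1"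
    and \<beta>: "msmooth V \<beta>" "\<And>x. x \<in> V \<Longrightarrow> N (f x) \<le> 3/4 \<Longrightarrow> \<beta> x = 1" "\<And>x. x \<in> V \<Longrightarrow> 7/8 \<le> N (f x) \<Longrightarrow> \<beta> x = 0"
    and w: "\<And>i. msmooth {x \<in> V. f x \<notin> points Z} (\<lambda>x. w x i)"
      "\<And>x. x \<in> V \<Longrightarrow> f x \<notin> points Z \<Longrightarrow> w x \<in> EE (Suc n)"
      "\<And>x. x \<in> V \<Longrightarrow> f x \<notin> points Z \<Longrightarrow> nr (\<lambda>i. w x i - cx (f x) i) \<le> 1/8"
begin

definition V1 :: "'m set" where "V1 = {x \<in> V. f x \<notin> points Z}"

text \<open>The share of w in the new coordinates. \<open>smooth_step\<close> bounds it between 0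
  and 1, which \<alpha> and \<beta> need not be, and makes it constant near the places where they
  are 0 or 1.\<close>

definition \<theta> :: "'m \<Rightarrow> real" where "\<theta> x = smooth_step (\<beta> x) * (1 - smooth_step (\<alpha> x))"

definition mix :: "'m \<Rightarrow> real \<Rightarrow> nat \<Rightarrow> real" where
  "mix x s i = cx (f x) i + s * (w x i - cx (f x) i)"

text \<open>\<open>f1\<close> is smooth where \<open>f\<close> stays well inside the cells or is smooth already; away from \<open>A\<close>,
  \<open>f2\<close> sends everything else into the lower skeleton.\<close>

definition f1 :: "'m \<Rightarrow> 'x" where "f1 x = (if x \<in> V1 then \<Phi> (ci (f x), mix x (\<theta> x)) else f x)"

definition f2 :: "'m \<Rightarrow> 'x" where "f2 x = push (f1 x, 1 - \<alpha> x)"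

lemma f_points: "x \<in> V \<Longrightarrow> f x \<in> points Z'"
  using f topspace_sub[OF V] topspace_D unfolding continuous_map_def by auto

lemma V1_sub: "V1 \<subseteq> V"
  by (auto simp: V1_def)

lemma V1_iff: "x \<in> V \<Longrightarrow> x \<in> V1 \<longleftrightarrow> N (f x) < 1"
  using N_less_1[OF f_points] by (simp add: V1_def)

lemma openin_V1_cell:
  assumes "openin (Euclidean_space (Suc n)) B"
  shows "openin T {x \<in> V1. ci (f x) = j \<and> cx (f x) \<in> B}"
proof -
  have "openin (subtopology T V) {x \<in> topspace (subtopology T V). f x \<in> {y \<in> points Z' - points Z. ci y = j \<and> cx y \<in> B}}"
    by (rule openin_continuous_map_preimage[OF f openin_cell[OF assms]])
  from openin_trans_full[OF this V] have
    "openin T {x \<in> V. f x \<in> {y \<in> points Z' - points Z. ci y = j \<and> cx y \<in> B}}"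
    unfolding topspace_sub[OF V] .
  moreover have "{x \<in> V. f x \<in> {y \<in> points Z' - points Z. ci y = j \<and> cx y \<in> B}} = {x \<in> V1. ci (f x) = j \<and> cx (f x) \<in> B}"
    using f_points by (auto simp: V1_def)
  ultimately show ?thesis by simp
qed

lemma V1_cell: "x \<in> V1 \<Longrightarrow> ci (f x) \<in> J" "x \<in> V1 \<Longrightarrow> cx (f x) \<in> EE (Suc n)" "x \<in> V1 \<Longrightarrow> nr (cx (f x)) < 1"
  "x \<in> V1 \<Longrightarrow> \<Phi> (ci (f x), cx (f x)) = f x" "x \<in> V1 \<Longrightarrow> N (f x) = nr (cx (f x))"
  using cell_point f_points by (auto simp: V1_def N_def)

lemma openin_V1_index: "openin T {x \<in> V1. ci (f x) = j}"
proof -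
  have "{x \<in> V1. ci (f x) = j} = {x \<in> V1. ci (f x) = j \<and> cx (f x) \<in> EE (Suc n)}"
    using V1_cell(2) by auto
  then show ?thesis using openin_V1_cell[OF openin_topspace] by simp
qed

lemma openin_V1: "openin T V1"
proof (subst openin_subopen, intro ballI)
  fix x assume "x \<in> V1"
  then show "\<exists>S. openin T S \<and> x \<in> S \<and> S \<subseteq> V1"
    by (intro exI[of _ "{y \<in> V1. ci (f y) = ci (f x)}"]) (simp add: openin_V1_index)
qed

lemma cx_continuous: "continuous_map (subtopology T V1) euclideanreal (\<lambda>x. cx (f x) i)"
proof -
  have "openin (subtopology T V1) {x \<in> V1. cx (f x) \<in> B}" if B: "openin (Euclidean_space (Suc n)) B" for B
  proof -
    have "{x \<in> V1. cx (f x) \<in> B} = \<Union>((\<lambda>j. {x \<in> V1. ci (f x) = j \<and> cx (f x) \<in> B}) ` UNIV)"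
      by auto
    moreover have "openin T (\<Union>((\<lambda>j. {x \<in> V1. ci (f x) = j \<and> cx (f x) \<in> B}) ` UNIV))"
      using openin_V1_cell[OF B] by (intro openin_Union) auto
    ultimately have "openin T {x \<in> V1. cx (f x) \<in> B}"
      by simp
    then show ?thesis
      using openin_V1 by (subst openin_open_subtopology) auto
  qed
  then have "continuous_map (subtopology T V1) (Euclidean_space (Suc n)) (\<lambda>x. cx (f x))"
    unfolding continuous_map_def topspace_sub[OF openin_V1] using V1_cell(2) by auto
  moreover have "continuous_map (Euclidean_space (Suc n)) euclideanreal (\<lambda>y. y i)"
    unfolding Euclidean_space_def
    by (intro continuous_map_from_subtopology continuous_map_product_projection UNIV_I)
  ultimately show ?thesis
    using continuous_map_compose[of _ _ "\<lambda>x. cx (f x)" euclideanreal "\<lambda>y. y i"] by (simp add: o_def)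
qed

lemma w_V1: "msmooth V1 (\<lambda>x. w x i)" "x \<in> V1 \<Longrightarrow> w x \<in> EE (Suc n)" "x \<in> V1 \<Longrightarrow> nr (\<lambda>i. w x i - cx (f x) i) \<le> 1/8"
  using w unfolding V1_def by auto

lemma \<theta>_smooth: "msmooth V \<theta>"
  unfolding \<theta>_def[abs_def]
  by (intro msmooth_mult msmooth_diff msmooth_const msmooth_smooth_step \<alpha>(1) \<beta>(1))

lemma \<theta>_bounds: "0 \<le> \<theta> x" "\<theta> x \<le> 1"
  using smooth_step_bounds[of "\<beta> x"] smooth_step_bounds[of "\<alpha> x"] by (auto simp: \<theta>_def mult_le_one)

lemma \<theta>_0: "\<beta> x \<le> 1/3 \<Longrightarrow> \<theta> x = 0" "x \<in> A \<Longrightarrow> \<theta> x = 0"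
  by (simp_all add: \<theta>_def smooth_step_0 \<alpha>(3) smooth_step_1)

lemma \<theta>_1: "2/3 \<le> \<beta> x \<Longrightarrow> \<alpha> x \<le> 1/3 \<Longrightarrow> \<theta> x = 1"
  by (simp add: \<theta>_def smooth_step_0 smooth_step_1)

text \<open>Coordinates move by at most 1/8, and only when their radius is below 7/8.\<close>

lemma mix_in:
  assumes x: "x \<in> V1" and s: "0 \<le> s" "s \<le> \<theta> x"
  shows "mix x s \<in> oball"
proof -
  have E: "mix x s \<in> EE (Suc n)"
    using V1_cell(2)[OF x] w_V1(2)[OF x] by (simp add: topspace_Euclidean_space mix_def)
  have "nr (mix x s) \<le> nr (cx (f x)) + nr (\<lambda>i. s * (w x i - cx (f x) i))"
    using nr_triangle[of "cx (f x)" "\<lambda>i. s * (w x i - cx (f x) i)"] by (simp add: mix_def[abs_def])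
  also have "\<dots> \<le> nr (cx (f x)) + s * (1/8)"
    unfolding nr_scale abs_of_nonneg[OF s(1)] using mult_left_mono[OF w_V1(3)[OF x] s(1)]
    by (rule add_left_mono)
  also have "\<dots> < 1"
  proof (cases "s = 0")
    case True
    then show ?thesis using V1_cell(3)[OF x] by simp
  next
    case False
    then have "\<theta> x \<noteq> 0" using s by linarith
    then have "\<not> \<beta> x \<le> 1/3" using \<theta>_0(1) by blast
    then have "N (f x) < 7/8"
      using \<beta>(3) x V1_sub by force
    moreover have "s \<le> 1" using s \<theta>_bounds(2)[of x] by linarith
    ultimately show ?thesis using V1_cell(5)[OF x] by simp
  qed
  finally show ?thesis using E by (simp add: oball_def)
qed

text \<open>The cell index is locally constant on \<open>V1\<close>, so the straight-line homotopy
  of coordinates can locally be followed by a single characteristic map.\<close>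

lemma f1_homotopy_V1:
  "continuous_map (prod_topology (subtopology T V1) euclideanreal) (D_topology Z')
     (\<lambda>p. \<Phi> (ci (f (fst p)), mix (fst p) (clamp01 (snd p) * \<theta> (fst p))))"
  (is "continuous_map ?X _ ?H")
proof (rule continuous_map_local)
  have tX: "topspace ?X = V1 \<times> UNIV"
    using topspace_sub[OF openin_V1] by simp
  fix p assume "p \<in> topspace ?X"
  then have p: "fst p \<in> V1" using tX by auto
  define j where "j = ci (f (fst p))"
  define W where "W = {x \<in> V1. ci (f x) = j}"
  have W: "openin T W" "W \<subseteq> V1"
    using openin_V1_index by (auto simp: W_def)
  let ?Y = "prod_topology (subtopology T W) euclideanreal"
  have tY: "topspace ?Y = W \<times> UNIV"
    using topspace_sub[OF W(1)] by simp
  have e: "subtopology ?X (W \<times> UNIV) = ?Y"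
    by (simp only: subtopology_Times subtopology_subtopology Int_absorb1[OF W(2)] subtopology_UNIV)
  have pull: "continuous_map ?Y euclideanreal (\<lambda>q. a (fst q))"
    if "continuous_map (subtopology T V1) euclideanreal a" for a
    using continuous_map_compose[OF continuous_map_fst continuous_map_from_subtopology_mono[OF that W(2)]]
    by (simp add: o_def)
  have c\<theta>: "continuous_map (subtopology T V1) euclideanreal \<theta>"
    by (rule msmooth_continuous[OF openin_V1 msmooth_subset[OF \<theta>_smooth V1_sub]])
  have cw: "continuous_map (subtopology T V1) euclideanreal (\<lambda>x. w x i)" for i
    by (rule msmooth_continuous[OF openin_V1 w_V1(1)])
  let ?q = "\<lambda>q. mix (fst q) (clamp01 (snd q) * \<theta> (fst q))"
  have "continuous_map ?Y euclideanreal (\<lambda>q. ?q q i)" for i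
    unfolding mix_def
    by (intro continuous_map_add continuous_map_real_mult continuous_map_diff continuous_map_clamp01
        continuous_map_snd pull c\<theta> cw cx_continuous)
  then have "continuous_map ?Y (powertop_real UNIV) ?q"
    by (subst continuous_map_componentwise_UNIV) blast
  moreover have ball: "?q q \<in> oball" if "q \<in> W \<times> UNIV" for q
  proof -
    have x: "fst q \<in> V1" using that W(2) by auto
    show ?thesis
      by (rule mix_in[OF x]) (use clamp01_simps(1,2)[of "snd q"] \<theta>_bounds[of "fst q"] in \<open>auto intro: mult_left_le_one_le\<close>)
  qed
  ultimately have "continuous_map ?Y (subtopology (Euclidean_space (Suc n)) oball) ?q"
    unfolding Euclidean_space_def continuous_map_in_subtopology tY
    using oball_def topspace_Euclidean_space by blast
  moreover have j: "j \<in> J"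
    using V1_cell(1)[OF p] by (simp add: j_def)
  ultimately have "continuous_map ?Y (D_topology Z') (\<lambda>q. \<Phi> (j, ?q q))"
    using continuous_map_compose[OF _ \<Phi>_continuous[OF j], of ?Y ?q] by (simp add: o_def)
  then have "continuous_map ?Y (D_topology Z') ?H"
    by (rule continuous_map_eq) (auto simp: tY W_def)
  then have "continuous_map (subtopology ?X (W \<times> UNIV)) (D_topology Z') ?H"
    unfolding e .
  moreover have "openin ?X (W \<times> UNIV)"
    using W openin_V1 by (simp add: openin_prod_Times_iff openin_open_subtopology)
  moreover have "p \<in> W \<times> UNIV"
    using p by (simp add: mem_Times_iff W_def j_def)
  ultimately show "\<exists>U. openin ?X U \<and> p \<in> U \<and> continuous_map (subtopology ?X U) (D_topology Z') ?H"
    by blast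
qed

lemma mix_0: "mix x 0 = cx (f x)"
  by (simp add: mix_def[abs_def])

lemma \<alpha>_continuous: "continuous_map (subtopology T V) euclideanreal \<alpha>"
  by (rule msmooth_continuous[OF V \<alpha>(1)])

lemma \<beta>_continuous: "continuous_map (subtopology T V) euclideanreal \<beta>"
  by (rule msmooth_continuous[OF V \<beta>(1)])

lemma homot_f_f1: "homot V (D_topology Z') A f f1"
proof -
  let ?A1 = "{x \<in> V1. \<theta> x = 0}"
  have "homot V1 (D_topology Z') ?A1 f (\<lambda>x. \<Phi> (ci (f x), mix x (\<theta> x)))"
    by (rule homotI[OF f1_homotopy_V1]) (simp_all add: clamp01_simps mix_0 V1_cell(4))
  then have "homot V (D_topology Z') (V - (V1 - ?A1)) f (\<lambda>x. if x \<in> V1 then \<Phi> (ci (f x), mix x (\<theta> x)) else f x)"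
  proof (rule homot_extend[OF V openin_V1 V1_sub f])
    \<comment> \<open>\<theta> vanishes where \<beta> is at most 1/3, so all movement takes place in
      this closed set; it lies in \<open>V1\<close> because \<beta> vanishes near and on the
      preimage of \<open>Z\<close>.\<close>
    show "closedin (subtopology T V) {x \<in> V. \<beta> x \<in> {1/3..}}"
      by (rule closedin_level[OF V \<beta>_continuous]) simp
    show "{x \<in> V. \<beta> x \<in> {1/3..}} \<subseteq> V1"
      using \<beta>(3) V1_iff by force
    show "V1 - ?A1 \<subseteq> {x \<in> V. \<beta> x \<in> {1/3..}}"
      using V1_sub \<theta>_0(1) by force
  qed
  then have "homot V (D_topology Z') (V - (V1 - ?A1)) f f1"
    by (simp add: f1_def[abs_def])
  then show ?thesis
    by (rule homot_subset) (use \<theta>_0(2) Om in auto)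
qed

lemma f1_continuous: "continuous_map (subtopology T V) (D_topology Z') f1"
  by (rule homot_continuous(2)[OF V homot_f_f1])

lemma f1_points: "x \<in> V \<Longrightarrow> f1 x \<in> points Z'"
  using f1_continuous topspace_sub[OF V] topspace_D unfolding continuous_map_def by auto

text \<open>Turns a bound on the radius of \<open>f1\<close>, which governs the collapsing, into one
  on the radius of f, which governs \<beta>.\<close>

lemma N_f1: "x \<in> V \<Longrightarrow> N (f x) \<le> N (f1 x) + 1/8"
proof (cases "x \<in> V1")
  case True
  have b: "mix x (\<theta> x) \<in> dsk"
    using mix_in[OF True] \<theta>_bounds(1)[of x] oball_dsk by blast
  have "nr (cx (f x)) \<le> nr (mix x (\<theta> x)) + nr (\<lambda>i. (- \<theta> x) * (w x i - cx (f x) i))"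
    using nr_triangle[of "mix x (\<theta> x)" "\<lambda>i. (- \<theta> x) * (w x i - cx (f x) i)"] by (simp add: mix_def[abs_def] algebra_simps)
  also have "\<dots> \<le> nr (mix x (\<theta> x)) + 1 * (1/8)"
    unfolding nr_scale using w_V1(3)[OF True] \<theta>_bounds[of x] by (intro add_left_mono mult_mono) auto
  finally show ?thesis
    using V1_cell(5)[OF True] True N_\<Phi>[OF V1_cell(1)[OF True] b] by (simp add: f1_def)
next
  case False
  then show ?thesis by (simp add: f1_def)
qed

lemma msmap_cell:
  assumes j: "j \<in> J" and q: "\<And>i. i < Suc n \<Longrightarrow> msmooth W (\<lambda>x. q x i)" "\<And>x. x \<in> W \<Longrightarrow> q x \<in> dsk"
  shows "msmap W Z' (\<lambda>x. \<Phi> (j, q x))"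
proof (rule msmapI)
  show "\<And>x. x \<in> W \<Longrightarrow> x \<in> topspace T \<Longrightarrow> \<Phi> (j, q x) \<in> points Z'"
    using \<Phi>_in[OF j] q(2) by blast
  fix k U P assume P: "P \<in> plots \<M> k U" "P \<in> U \<rightarrow> W"
  have "(\<lambda>y. q (P y)) \<in> plots (disk_diff (Suc n)) k U"
    unfolding plots_disk using plotD(1)[OF P(1)] q(2) P(2) msmoothD[OF q(1) P] by blast
  from \<Phi>_plot[OF j this] show "(\<lambda>x. \<Phi> (j, q (P x))) \<in> plots Z' k U" .
qed

lemma cx_msmooth: "i < Suc n \<Longrightarrow> msmooth (Om \<inter> V1) (\<lambda>x. cx (f x) i)"
  unfolding msmooth_def o_def
proof (intro allI ballI impI)
  fix k U P assume i: "i < Suc n" and P: "P \<in> plots \<M> k U" "P \<in> U \<rightarrow> Om \<inter> V1"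
  have "(\<lambda>x. f (P x)) \<in> plots Z' k U"
    by (rule msmap_plot[OF f_smooth P(1)]) (use P(2) in auto)
  then show "smooth_fun k U (\<lambda>x. cx (f (P x)) i)"
    by (rule cx_smooth[OF _ _ i]) (use P(2) in \<open>auto simp: V1_def\<close>)
qed

text \<open>The open set on which \<theta> is forced to be 1, so that the coordinates of
  \<open>f1\<close> are those of w.\<close>

definition G :: "'m set" where "G = {x \<in> V. \<alpha> x < 1/3} \<inter> {x \<in> V. 2/3 < \<beta> x}"

lemma openin_G: "openin T G"
  using openin_level[OF V \<alpha>_continuous, of "{..<1/3}"] openin_level[OF V \<beta>_continuous, of "{2/3<..}"]
  by (simp add: G_def openin_Int)

lemma G_V1: "G \<subseteq> V1"
proof
  fix x assume x: "x \<in> G"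
  then have "\<beta> x \<noteq> 0" "x \<in> V" by (auto simp: G_def)
  then show "x \<in> V1"
    using \<beta>(3)[of x] V1_iff[of x] by force
qed

text \<open>On \<open>G\<close> the coordinates of \<open>f1\<close> are w. On
  \<open>Om \<inter> V1\<close> they mix w with the coordinates of f, which are smooth there. Around
  a point of \<open>Om\<close> sent to \<open>Z\<close>, \<beta> is small, \<theta> is 0 and
  \<open>f1\<close> is f.\<close>

lemma f1_smooth: "msmap (Om \<union> G) Z' f1"
proof (rule msmap_local[OF Z'])
  fix x assume x: "x \<in> Om \<union> G"
  have mixd: "mix y (\<theta> y) \<in> dsk" if "y \<in> V1" for y
    using mix_in[OF that] \<theta>_bounds(1)[of y] oball_dsk by blast
  consider "x \<in> G" | "x \<in> Om" "x \<in> V1" | "x \<in> Om" "x \<notin> V1"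
    using x by blast
  then show "\<exists>W. openin T W \<and> x \<in> W \<and> msmap W Z' f1"
  proof cases
    case 1
    let ?W = "G \<inter> {y \<in> V1. ci (f y) = ci (f x)}"
    have xV1: "x \<in> V1" using G_V1 1 by blast
    have "msmap ?W Z' (\<lambda>y. \<Phi> (ci (f x), mix y (\<theta> y)))"
    proof (rule msmap_cell[OF V1_cell(1)[OF xV1]])
      show "msmooth ?W (\<lambda>y. mix y (\<theta> y) i)" for i
      proof (rule msmooth_cong)
        show "msmooth ?W (\<lambda>y. w y i)"
          by (rule msmooth_subset[OF w_V1(1)]) blast
        show "w y i = mix y (\<theta> y) i" if "y \<in> ?W" for y
          using that \<theta>_1[of y] by (simp add: mix_def G_def)
      qed
    qed (use mixd in blast)
    then have "msmap ?W Z' f1"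
      by (rule msmap_cong[OF Z']) (auto simp: f1_def)
    moreover have "openin T ?W"
      using openin_G openin_V1_index by blast
    ultimately show ?thesis
      using 1 xV1 by (intro exI[of _ ?W]) auto
  next
    case 2
    let ?W = "Om \<inter> {y \<in> V1. ci (f y) = ci (f x)}"
    have "msmap ?W Z' (\<lambda>y. \<Phi> (ci (f x), mix y (\<theta> y)))"
    proof (rule msmap_cell[OF V1_cell(1)[OF 2(2)]])
      fix i assume i: "i < Suc n"
      show "msmooth ?W (\<lambda>y. mix y (\<theta> y) i)"
        unfolding mix_def
        by (intro msmooth_add msmooth_mult msmooth_diff msmooth_subset[OF cx_msmooth[OF i]]
            msmooth_subset[OF w_V1(1)] msmooth_subset[OF \<theta>_smooth]) (use V1_sub in auto)
    qed (use mixd in blast)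
    then have "msmap ?W Z' f1"
      by (rule msmap_cong[OF Z']) (auto simp: f1_def)
    moreover have "openin T ?W"
      using Om(1) openin_V1_index by blast
    ultimately show ?thesis
      using 2 by (intro exI[of _ ?W]) auto
  next
    case 3
    let ?W = "Om \<inter> {y \<in> V. \<beta> y \<in> {..<1/3}}"
    have "\<beta> x = 0"
      using 3 Om(2) \<beta>(3)[of x] V1_iff[of x] by force
    moreover have "msmap ?W Z' f1"
    proof (rule msmap_cong[OF Z' msmap_subset[OF f_smooth]])
      fix y assume y: "y \<in> ?W"
      then have "\<theta> y = 0" using \<theta>_0(1)[of y] by auto
      then show "f y = f1 y"
        using V1_cell(4)[of y] by (simp add: f1_def mix_0)
    qed blast
    moreover have "openin T ?W"
      by (intro openin_Int Om(1) openin_level[OF V \<beta>_continuous]) simp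
    ultimately show ?thesis
      using 3(1) Om(2) by (intro exI[of _ ?W]) auto
  qed
qed

text \<open>Run \<open>push\<close> up to the parameter 1 - \<alpha>; on A this parameter is 0,
  where \<open>push\<close> is the identity.\<close>

lemma homot_f1_f2: "homot V (D_topology Z') A f1 f2"
proof (rule homotI)
  let ?X = "prod_topology (subtopology T V) euclideanreal"
  have "continuous_map ?X (D_topology Z') (\<lambda>p. f1 (fst p))"
    using continuous_map_compose[OF continuous_map_fst f1_continuous] by (simp add: o_def)
  moreover have "continuous_map ?X euclideanreal (\<lambda>p. \<alpha> (fst p))"
    using continuous_map_compose[OF continuous_map_fst \<alpha>_continuous] by (simp add: o_def)
  then have "continuous_map ?X euclideanreal (\<lambda>p. clamp01 (snd p) * (1 - \<alpha> (fst p)))"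
    by (intro continuous_map_real_mult continuous_map_clamp01 continuous_map_snd continuous_map_diff) auto
  ultimately have "continuous_map ?X (prod_topology (D_topology Z') euclideanreal)
      (\<lambda>p. (f1 (fst p), clamp01 (snd p) * (1 - \<alpha> (fst p))))"
    by (rule continuous_map_pairedI)
  from continuous_map_compose[OF this push_continuous]
  show "continuous_map ?X (D_topology Z') (\<lambda>p. push (f1 (fst p), clamp01 (snd p) * (1 - \<alpha> (fst p))))"
    by (simp add: o_def)
qed (auto simp: clamp01_simps push_id f1_points f2_def \<alpha>(3))

lemma f2_continuous: "continuous_map (subtopology T V) (D_topology Z') f2"
  by (rule homot_continuous(2)[OF V homot_f1_f2])

lemma f2_smooth: "msmap (Om \<union> G) Z' f2"
proof (rule msmapI)
  have OGV: "Om \<union> G \<subseteq> V" using Om(2) G_V1 V1_sub by blast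
  show "f2 x \<in> points Z'" if "x \<in> Om \<union> G" for x
    using f2_continuous topspace_sub[OF V] topspace_D OGV that unfolding continuous_map_def by blast
  fix k U P assume P: "P \<in> plots \<M> k U" "P \<in> U \<rightarrow> Om \<union> G"
  have "(\<lambda>x. f1 (P x)) \<in> plots Z' k U"
    by (rule msmap_plot[OF f1_smooth P])
  moreover have "smooth_fun k U (\<lambda>x. 1 - \<alpha> (P x))"
    by (rule msmoothD[OF msmooth_diff[OF msmooth_const msmooth_subset[OF \<alpha>(1) OGV]] P])
  ultimately have "(\<lambda>x. (f1 (P x), 1 - \<alpha> (P x))) \<in> plots (prod_diff Z' real_diff) k U"
    by (simp add: prod_diff_def o_def)
  then have "push \<circ> (\<lambda>x. (f1 (P x), 1 - \<alpha> (P x))) \<in> plots Z' k U"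
    using push_smooth unfolding smooth_map_def by blast
  then show "(\<lambda>x. f2 (P x)) \<in> plots Z' k U"
    by (simp add: o_def f2_def)
qed

text \<open>Here the parameter of \<open>push\<close> exceeds 2/3 and \<open>f1\<close> is in the
  collar, so \<open>f2\<close> is \<open>rt\<close> after \<open>f1\<close> and takes values in
  \<open>Z\<close>: the induction hypothesis applies to this open set.\<close>

definition V2 :: "'m set" where "V2 = {x \<in> V. \<alpha> x < 1/3 \<and> 1/2 < N (f1 x)}"

text \<open>The part of \<open>V2\<close> close to its complement in V. The margins 1/4 < 1/3 and
  9/16 > 1/2 make the closure in V of \<open>V2 - A2\<close> stay inside \<open>V2\<close>, which
  allows gluing.\<close>

definition A2 :: "'m set" where "A2 = V2 \<inter> {x \<in> V. 1/4 \<le> \<alpha> x \<or> N (f1 x) \<le> 9/16}"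

lemma Nf1_continuous: "continuous_map (subtopology T V) euclideanreal (\<lambda>x. N (f1 x))"
  using continuous_map_compose[OF f1_continuous continuous_map_N] by (simp add: o_def)

lemma openin_V2: "openin T V2"
proof -
  have "V2 = {x \<in> V. \<alpha> x \<in> {..<1/3}} \<inter> {x \<in> V. N (f1 x) \<in> {1/2<..}}"
    by (auto simp: V2_def)
  then show ?thesis
    using openin_Int[OF openin_level[OF V \<alpha>_continuous, of "{..<1/3}"] openin_level[OF V Nf1_continuous, of "{1/2<..}"]]
    by simp
qed

lemma V2_sub: "V2 \<subseteq> V"
  by (auto simp: V2_def)

lemma V2_collar: "x \<in> V2 \<Longrightarrow> f1 x \<in> collar"
  using f1_points by (auto simp: V2_def collar_def)

lemma f2_V2: "x \<in> V2 \<Longrightarrow> f2 x = rt (f1 x)"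
  using push_rt[OF V2_collar] by (simp add: f2_def V2_def)

text \<open>If x is not in \<open>Om\<close>, then \<alpha> is 0, so the radius of \<open>f1\<close>
  is at most 9/16 and that of f at most 9/16 + 1/8 < 3/4; hence \<beta> is 1 and x is in
  \<open>G\<close>.\<close>

lemma near_A2: "x \<in> V \<Longrightarrow> 1/4 \<le> \<alpha> x \<or> N (f1 x) \<le> 9/16 \<Longrightarrow> x \<in> Om \<union> G"
proof (rule ccontr)
  assume x: "x \<in> V" "1/4 \<le> \<alpha> x \<or> N (f1 x) \<le> 9/16" and no: "x \<notin> Om \<union> G"
  then have \<alpha>0: "\<alpha> x = 0" using \<alpha>(2) by blast
  then have "N (f x) \<le> 3/4"
    using N_f1[OF x(1)] x(2) by simp
  then have "\<beta> x = 1" using \<beta>(2) x(1) by blast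
  then have "x \<in> G" using \<alpha>0 x(1) by (simp add: G_def)
  then show False using no by blast
qed

lemma rt_f1_continuous: "continuous_map (subtopology T V2) (D_topology Z) (\<lambda>x. rt (f1 x))"
proof -
  have "continuous_map (subtopology T V2) (subtopology (D_topology Z') collar) f1"
    using continuous_map_from_subtopology_mono[OF f1_continuous V2_sub] V2_collar topspace_sub[OF openin_V2]
    by (auto simp: continuous_map_in_subtopology)
  from continuous_map_compose[OF this rt_continuous] show ?thesis by (simp add: o_def)
qed

lemma rt_f1_smooth: "msmap (V2 \<inter> (Om \<union> G)) Z (\<lambda>x. rt (f1 x))"
proof (rule msmapI)
  show "rt (f1 x) \<in> points Z" if "x \<in> V2 \<inter> (Om \<union> G)" for x
    using rt_f1_continuous topspace_sub[OF openin_V2] topspace_D that unfolding continuous_map_def by blast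
  fix k U P assume P: "P \<in> plots \<M> k U" "P \<in> U \<rightarrow> V2 \<inter> (Om \<union> G)"
  have "(\<lambda>x. f1 (P x)) \<in> plots Z' k U"
    by (rule msmap_plot[OF f1_smooth P(1)]) (use P(2) in blast)
  then have "(\<lambda>x. f1 (P x)) \<in> plots (sub_diff Z' collar) k U"
    using P(2) V2_collar by auto
  then have "rt \<circ> (\<lambda>x. f1 (P x)) \<in> plots Z k U"
    using rt_smooth unfolding smooth_map_def by blast
  then show "(\<lambda>x. rt (f1 (P x))) \<in> plots Z k U"
    by (simp add: o_def)
qed

lemma A2_closed: "closedin (subtopology T V2) A2"
proof -
  have "closedin (subtopology T V) ({x \<in> V. \<alpha> x \<in> {1/4..}} \<union> {x \<in> V. N (f1 x) \<in> {..9/16}})"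
    by (intro closedin_Un closedin_level[OF V \<alpha>_continuous] closedin_level[OF V Nf1_continuous]) auto
  moreover have "{x \<in> V. \<alpha> x \<in> {1/4..}} \<union> {x \<in> V. N (f1 x) \<in> {..9/16}} = {x \<in> V. 1/4 \<le> \<alpha> x \<or> N (f1 x) \<le> 9/16}"
    by auto
  ultimately have "closedin (subtopology (subtopology T V) V2) A2"
    unfolding A2_def closedin_subtopology by (metis Int_commute)
  then show ?thesis
    by (simp only: subtopology_subtopology Int_absorb1[OF V2_sub])
qed

lemma id_continuous: "continuous_map (D_topology Z) (D_topology Z') (\<lambda>y. y)"
proof -
  have "smooth_map (sub_diff Z (points Z)) Z' (\<lambda>y. y)"
    unfolding smooth_map_def using Z_sub Z_plot by (auto simp: o_def)
  from smooth_imp_continuous[OF D_open_points[OF Z] this Z Z'] show ?thesis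
    by (metis topspace_D(1) subtopology_topspace)
qed

text \<open>Glue the map g from the induction hypothesis with \<open>f2\<close>. Both agree on
  \<open>A2\<close>, so the homotopy extends by a constant one and the glued map is locally g or
  \<open>f2\<close>, each where it is smooth.\<close>

lemma extend_smoothing:
  assumes g: "msmap V2 Z g" and hg: "homot V2 (D_topology Z) A2 (\<lambda>x. rt (f1 x)) g"
  shows "\<exists>g. msmap V Z' g \<and> homot V (D_topology Z') A f g"
proof (intro exI conjI)
  let ?g = "\<lambda>x. if x \<in> V2 then g x else f2 x"
  have gA2: "g x = f2 x" if "x \<in> A2" for x
  proof -
    have "x \<in> V2" using that by (simp add: A2_def)
    then show ?thesis
      using homot_agree[OF hg that] f2_V2 by simp
  qed
  have "homot V2 (D_topology Z') A2 f2 g"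
    by (rule homot_cong[OF homot_target[OF hg id_continuous]]) (simp_all add: f2_V2)
  then have "homot V (D_topology Z') (V - (V2 - A2)) f2 ?g"
  proof (rule homot_extend[OF V openin_V2 V2_sub f2_continuous])
    show "closedin (subtopology T V) ({x \<in> V. \<alpha> x \<in> {..1/4}} \<inter> {x \<in> V. N (f1 x) \<in> {9/16..}})"
      by (intro closedin_Int closedin_level[OF V \<alpha>_continuous] closedin_level[OF V Nf1_continuous]) auto
    show "{x \<in> V. \<alpha> x \<in> {..1/4}} \<inter> {x \<in> V. N (f1 x) \<in> {9/16..}} \<subseteq> V2"
      by (auto simp: V2_def)
    show "V2 - A2 \<subseteq> {x \<in> V. \<alpha> x \<in> {..1/4}} \<inter> {x \<in> V. N (f1 x) \<in> {9/16..}}"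
      by (auto simp: A2_def V2_def)
  qed
  then have "homot V (D_topology Z') A f2 ?g"
  proof (rule homot_subset)
    \<comment> \<open>\<alpha> = 1 on A keeps A out of \<open>V2\<close>, so the second homotopy
      does not move it.\<close>
    show "A \<subseteq> V - (V2 - A2)"
      using Om(2,3) \<alpha>(3) by (force simp: V2_def)
  qed
  then show "homot V (D_topology Z') A f ?g"
    using homot_trans[OF V homot_f_f1 homot_trans[OF V homot_f1_f2]] by blast
  show "msmap V Z' ?g"
  proof (rule msmap_local[OF Z'])
    fix x assume x: "x \<in> V"
    show "\<exists>W. openin T W \<and> x \<in> W \<and> msmap W Z' ?g"
    proof (cases "x \<in> V2")
      case True
      have "msmap V2 Z' g"
        by (rule msmapI) (use msmap_points[OF g] Z_sub Z_plot msmap_plot[OF g] in blast)+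
      then have "msmap V2 Z' ?g"
        by (rule msmap_cong[OF Z']) simp
      then show ?thesis using True openin_V2 by blast
    next
      case False
      \<comment> \<open>A neighbourhood of x in which every point of \<open>V2\<close> already
        belongs to \<open>A2\<close>, so the glued map is \<open>f2\<close> throughout.\<close>
      let ?W = "{x \<in> V. \<alpha> x \<in> {1/4<..}} \<union> {x \<in> V. N (f1 x) \<in> {..<9/16}}"
      have "openin T ?W"
        by (intro openin_Un openin_level[OF V \<alpha>_continuous] openin_level[OF V Nf1_continuous]) auto
      moreover have "x \<in> ?W"
        using False x by (auto simp: V2_def)
      moreover have "msmap ?W Z' ?g"
      proof (rule msmap_cong[OF Z' msmap_subset[OF f2_smooth]])
        show "?W \<subseteq> Om \<union> G"
          using near_A2 by force
        fix y assume "y \<in> ?W"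
        then have "y \<in> V2 \<Longrightarrow> y \<in> A2" by (auto simp: A2_def)
        then show "f2 y = ?g y" using gA2 by simp
      qed
      ultimately show ?thesis by blast
    qed
  qed
qed

end

section \<open>The induction over the skeleta: discrete base and cell step\<close>

lemma D_open_discrete:
  assumes "A \<subseteq> S"
  shows "D_open (discrete_diff S) A"
  unfolding D_open_def
proof (intro conjI allI ballI)
  fix n U P assume P: "P \<in> plots (discrete_diff S) n U"
  show "openin (Euclidean_space n) {x \<in> U. P x \<in> A}"
  proof (rule local_plots_vimage)
    fix x assume x: "x \<in> U"
    obtain W where W: "openin (Euclidean_space n) W" "x \<in> W" "W \<subseteq> U" "\<exists>s\<in>S. \<forall>y\<in>W. P y = s"
      using P unfolding discrete_diff_def diffeology.simps by (rule local_plotsE[OF _ x])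
    then obtain s where s: "\<forall>y\<in>W. P y = s" by blast
    then have "{y \<in> W. P y \<in> A} = (if s \<in> A then W else {})" by auto
    then show "\<exists>W. openin (Euclidean_space n) W \<and> x \<in> W \<and> W \<subseteq> U \<and> openin (Euclidean_space n) {y \<in> W. P y \<in> A}"
      using W(1-3) by (intro exI[of _ W]) simp
  qed
qed (use assms in \<open>simp add: discrete_diff_def\<close>)

context manifold begin

text \<open>The quantification over all open \<open>V\<close> is needed for the induction over the skeleta, which
  passes from \<open>V\<close> to the points of \<open>V\<close> that are sent into a collar of the lower skeleton.\<close>

definition smoothable :: "'y diffeology \<Rightarrow> bool" where
  "smoothable Y \<longleftrightarrow> (\<forall>V A Om f. openin T V \<longrightarrow> closedin (subtopology T V) A \<longrightarrow> openin T Om \<longrightarrow> A \<subseteq> Om \<longrightarrow>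
     Om \<subseteq> V \<longrightarrow> continuous_map (subtopology T V) (D_topology Y) f \<longrightarrow> msmap Om Y f \<longrightarrow>
     (\<exists>g. msmap V Y g \<and> homot V (D_topology Y) A f g))"

lemma smoothableD:
  assumes "smoothable Y" "openin T V" "closedin (subtopology T V) A" "openin T Om" "A \<subseteq> Om" "Om \<subseteq> V"
    "continuous_map (subtopology T V) (D_topology Y) f" "msmap Om Y f"
  obtains g where "msmap V Y g" "homot V (D_topology Y) A f g"
proof -
  have "\<exists>g. msmap V Y g \<and> homot V (D_topology Y) A f g"
    using assms unfolding smoothable_def by simp
  then show ?thesis using that by (elim exE conjE)
qed

text \<open>Supplies the data of \<open>cell_map\<close>: \<alpha> and \<beta> from
  \<open>smooth_Urysohn\<close>, w by patching the constant coordinate vectors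
  \<open>cx (f x)\<close>. The induction hypothesis is then applied to \<open>rt\<close> after
  \<open>f1\<close> on \<open>V2\<close>, relative to \<open>A2\<close>.\<close>

lemma smoothable_cell:
  fixes Z Z' :: "'x diffeology"
  assumes ca: "cell_attachment n Z Z' J h \<Phi>" and IH: "smoothable Z"
  shows "smoothable Z'"
  unfolding smoothable_def
proof (intro allI impI)
  interpret cell_attachment n Z Z' J h \<Phi> by (rule ca)
  fix V A Om :: "'m set" and f
  assume V: "openin T V" and A: "closedin (subtopology T V) A" and Om: "openin T Om" "A \<subseteq> Om" "Om \<subseteq> V"
    and f: "continuous_map (subtopology T V) (D_topology Z') f" and fs: "msmap Om Z' f"
  note tV = topspace_sub[OF V]
  have fZ: "f x \<in> points Z'" if "x \<in> V" for x
    using f that unfolding continuous_map_def tV topspace_D by blast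
  have Nf: "continuous_map (subtopology T V) euclideanreal (\<lambda>x. N (f x))"
    using continuous_map_compose[OF f continuous_map_N] by (simp add: o_def)
  have "openin (subtopology T V) Om"
    using V Om by (simp add: openin_open_subtopology)
  then have "closedin (subtopology T V) (V - Om)"
    by (rule closedin_diff[OF closedin_topspace, of "subtopology T V" Om, unfolded tV])
  moreover have "A \<inter> (V - Om) = {}"
    using Om by blast
  ultimately obtain \<alpha> where \<alpha>: "msmooth V \<alpha>" "\<And>y. y \<in> A \<Longrightarrow> \<alpha> y = 1" "\<And>y. y \<in> V - Om \<Longrightarrow> \<alpha> y = 0"
    by (rule smooth_Urysohn[OF V A]) blast
  have "closedin (subtopology T V) {x \<in> V. N (f x) \<in> {..3/4}}" "closedin (subtopology T V) {x \<in> V. N (f x) \<in> {7/8..}}"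
    by (rule closedin_level[OF V Nf]; simp)+
  moreover have "{x \<in> V. N (f x) \<in> {..3/4}} \<inter> {x \<in> V. N (f x) \<in> {7/8..}} = {}"
    by auto
  ultimately obtain \<beta> where \<beta>: "msmooth V \<beta>" "\<And>y. y \<in> {x \<in> V. N (f x) \<in> {..3/4}} \<Longrightarrow> \<beta> y = 1"
    "\<And>y. y \<in> {x \<in> V. N (f x) \<in> {7/8..}} \<Longrightarrow> \<beta> y = 0"
    by (rule smooth_Urysohn[OF V]) blast
  define V1 where "V1 = {x \<in> V. f x \<notin> points Z}"
  have V1: "openin T V1"
  proof -
    have "V1 = {x \<in> V. N (f x) \<in> {..<1}}"
      using N_less_1[OF fZ] by (auto simp: V1_def)
    then show ?thesis
      using openin_level[OF V Nf, of "{..<1}"] by simp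
  qed
  \<comment> \<open>Within \<open>U x\<close> the cell index is fixed and coordinates vary by less
    than 1/8, so an average of the patched constants is within 1/8 of f.\<close>
  define B where "B x = {z \<in> EE (Suc n). nr (\<lambda>i. z i - cx (f x) i) < 1/8}" for x
  define U where "U x = {y \<in> V. f y \<in> {z \<in> points Z' - points Z. ci z = ci (f x) \<and> cx z \<in> B x}}" for x
  have B: "openin (Euclidean_space (Suc n)) (B x)" for x
  proof -
    have "continuous_map (Euclidean_space (Suc n)) euclideanreal (\<lambda>z. nr (\<lambda>i. z i - cx (f x) i))"
      using continuous_map_compose[OF continuous_map_sumsq[where m="Suc n" and k="Suc n" and c="cx (f x)"],
          where g=sqrt and X''=euclideanreal]
      unfolding nr_def[abs_def] L2_set_def[abs_def] by (simp add: o_def continuous_on_real_sqrt)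
    from openin_continuous_map_preimage[OF this, of "{..<1/8}"] show ?thesis
      by (simp add: B_def)
  qed
  have U: "openin T (U x) \<and> x \<in> U x" if x: "x \<in> V1" for x
  proof
    have "openin (subtopology T V) (U x)"
      unfolding U_def
      using openin_continuous_map_preimage[OF f openin_cell[OF B[of x], of "ci (f x)"]] unfolding tV .
    then show "openin T (U x)"
      using V by (rule openin_trans_full)
    have "nr (\<lambda>i. cx (f x) i - cx (f x) i) = 0"
      using nr_scale[of 0 "\<lambda>_. 0"] by simp
    then show "x \<in> U x"
      using x fZ[of x] cell_point(3)[of "f x"] by (simp add: U_def V1_def B_def)
  qed
  obtain w where w: "\<And>i. msmooth V1 (\<lambda>y. w y i)"
    "\<And>y. y \<in> V1 \<Longrightarrow> \<exists>(I :: 'm set set) a \<xi>. finite I \<and> (\<forall>j\<in>I. \<xi> j \<in> V1 \<and> y \<in> U (\<xi> j) \<and> 0 \<le> a j) \<and>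
       sum a I = (1::real) \<and> (\<forall>i. w y i = (\<Sum>j\<in>I. a j * cx (f (\<xi> j)) i))"
    using patch_constants[where U=U and c="\<lambda>x. cx (f x)", OF V1 U] by blast
  have nr_sum: "nr (\<lambda>i. \<Sum>j\<in>I. a j * v j i) \<le> (\<Sum>j\<in>I. a j * nr (v j))" if "finite I" "\<forall>j\<in>I. 0 \<le> a j"
    for I :: "'m set set" and a and v :: "'m set \<Rightarrow> nat \<Rightarrow> real"
    using that
  proof (induction I rule: finite_induct)
    case empty
    show ?case using nr_scale[of 0 "\<lambda>_. 0"] by simp
  next
    case (insert j I)
    have "nr (\<lambda>i. \<Sum>j\<in>insert j I. a j * v j i) = nr (\<lambda>i. a j * v j i + (\<Sum>j\<in>I. a j * v j i))"
      using insert.hyps by simp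
    also have "\<dots> \<le> nr (\<lambda>i. a j * v j i) + nr (\<lambda>i. \<Sum>j\<in>I. a j * v j i)"
      by (rule nr_triangle)
    also have "\<dots> \<le> a j * nr (v j) + (\<Sum>j\<in>I. a j * nr (v j))"
      using insert by (simp add: nr_scale)
    finally show ?case using insert.hyps by simp
  qed
  have w2: "w y \<in> EE (Suc n)" and w3: "nr (\<lambda>i. w y i - cx (f y) i) \<le> 1/8" if y: "y \<in> V1" for y
  proof -
    obtain I :: "'m set set" and a \<xi> where I: "finite I" "\<forall>j\<in>I. \<xi> j \<in> V1 \<and> y \<in> U (\<xi> j) \<and> 0 \<le> a j"
       "sum a I = (1::real)" "\<forall>i. w y i = (\<Sum>j\<in>I. a j * cx (f (\<xi> j)) i)"
      using w(2)[OF y] by (elim exE conjE) (rule that)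
    have "cx (f (\<xi> j)) \<in> EE (Suc n)" if "j \<in> I" for j
      using I(2) that cell_point(3)[of "f (\<xi> j)"] fZ by (simp add: V1_def)
    then show "w y \<in> EE (Suc n)"
      using I(4) by (auto simp: topspace_Euclidean_space intro!: sum.neutral)
    \<comment> \<open>The weights add up to 1, so the error is the weighted average of the
      individual errors, and convexity of the norm bounds it.\<close>
    have "w y i - cx (f y) i = (\<Sum>j\<in>I. a j * (cx (f (\<xi> j)) i - cx (f y) i))" for i
    proof -
      have "(\<Sum>j\<in>I. a j * cx (f y) i) = cx (f y) i"
        using I(3) by (simp flip: sum_distrib_right)
      then show ?thesis
        using I(4) by (simp add: right_diff_distrib sum_subtractf)
    qed
    then have "nr (\<lambda>i. w y i - cx (f y) i) = nr (\<lambda>i. \<Sum>j\<in>I. a j * (cx (f (\<xi> j)) i - cx (f y) i))"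
      by simp
    also have "\<dots> \<le> (\<Sum>j\<in>I. a j * nr (\<lambda>i. cx (f (\<xi> j)) i - cx (f y) i))"
      by (rule nr_sum) (use I in auto)
    also have "\<dots> \<le> (\<Sum>j\<in>I. a j * (1/8))"
    proof (intro sum_mono mult_left_mono)
      fix j assume j: "j \<in> I"
      have "nr (\<lambda>i. cx (f y) i - cx (f (\<xi> j)) i) < 1/8"
        using I(2) j by (simp add: U_def B_def)
      moreover have "nr (\<lambda>i. cx (f (\<xi> j)) i - cx (f y) i) = nr (\<lambda>i. cx (f y) i - cx (f (\<xi> j)) i)"
        using nr_scale[of "-1" "\<lambda>i. cx (f y) i - cx (f (\<xi> j)) i"] by simp
      ultimately show "nr (\<lambda>i. cx (f (\<xi> j)) i - cx (f y) i) \<le> 1/8" by simp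
    qed (use I in auto)
    also have "\<dots> = 1/8"
      using I(3) by (simp flip: sum_distrib_right sum_divide_distrib)
    finally show "nr (\<lambda>i. w y i - cx (f y) i) \<le> 1/8" .
  qed
  interpret cell_map m T \<A> n Z Z' J h \<Phi> V A Om f \<alpha> \<beta> w
  proof
    show "msmooth {x \<in> V. f x \<notin> points Z} (\<lambda>x. w x i)" for i
      using w(1) by (simp add: V1_def)
    show "\<And>x. x \<in> V \<Longrightarrow> f x \<notin> points Z \<Longrightarrow> w x \<in> EE (Suc n)"
      "\<And>x. x \<in> V \<Longrightarrow> f x \<notin> points Z \<Longrightarrow> nr (\<lambda>i. w x i - cx (f x) i) \<le> 1/8"
      using w2 w3 by (simp_all add: V1_def)
  qed (use V f Om fs \<alpha> \<beta> in auto)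
  have o: "openin T (V2 \<inter> (Om \<union> G))"
    using openin_V2 openin_G Om(1) by (intro openin_Int openin_Un)
  have s: "A2 \<subseteq> V2 \<inter> (Om \<union> G)"
    using near_A2 by (auto simp: A2_def)
  obtain g where "msmap V2 Z g" "homot V2 (D_topology Z) A2 (\<lambda>x. rt (f1 x)) g"
    by (rule smoothableD[OF IH openin_V2 A2_closed o s _ rt_f1_continuous rt_f1_smooth]) blast
  then show "\<exists>g. msmap V Z' g \<and> homot V (D_topology Z') A f g"
    by (rule extend_smoothing)
qed

lemma homot_refl:
  assumes "continuous_map (subtopology T V) Y f"
  shows "homot V Y A f f"
proof (rule homotI)
  show "continuous_map (prod_topology (subtopology T V) euclideanreal) Y (\<lambda>p. f (fst p))"
    using continuous_map_compose[OF continuous_map_fst assms] by (simp add: o_def)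
qed auto

lemma msmap_const:
  assumes "diffeological_space Y" "c \<in> points Y"
  shows "msmap V Y (\<lambda>_. c)"
  by (rule msmapI) (use assms diffeological_spaceD(3)[OF assms] plotD(1) in auto)

text \<open>A continuous map to a discrete space is locally constant, hence smooth already; the
  constant homotopy works for every A.\<close>

lemma smoothable_discrete: "smoothable (discrete_diff S)"
  unfolding smoothable_def
proof (intro allI impI)
  fix V A Om :: "'m set" and f
  assume V: "openin T V" and f: "continuous_map (subtopology T V) (D_topology (discrete_diff S)) f"
  note D = diffeological_space_discrete[of S]
  have pS: "points (discrete_diff S) = S" by (simp add: discrete_diff_def)
  have fS: "f x \<in> S" if "x \<in> V" for x
    using f that topspace_D_topology[OF D] pS unfolding continuous_map_def topspace_sub[OF V] by blast
  have sing: "D_open (discrete_diff S) {s}" if "s \<in> S" for s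
    using that by (intro D_open_discrete) simp
  have "msmap V (discrete_diff S) f"
  proof (rule msmap_local[OF D])
    fix x assume x: "x \<in> V"
    let ?W = "{y \<in> V. f y \<in> {f x}}"
    have "openin (subtopology T V) ?W"
      using openin_continuous_map_preimage[OF f, of "{f x}"] sing[OF fS[OF x]]
      unfolding topspace_sub[OF V] openin_D_topology by blast
    then have "openin T ?W"
      using V by (rule openin_trans_full)
    moreover have "msmap ?W (discrete_diff S) f"
      by (rule msmap_cong[OF D msmap_const[OF D]]) (use fS[OF x] pS in auto)
    ultimately show "\<exists>W. openin T W \<and> x \<in> W \<and> msmap W (discrete_diff S) f"
      using x by (intro exI[of _ ?W]) simp
  qed
  then show "\<exists>g. msmap V (discrete_diff S) g \<and> homot V (D_topology (discrete_diff S)) A f g"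
    using homot_refl[OF f] by blast
qed

end

section \<open>Closedness of points\<close>

context cell_attachment begin

text \<open>For s in \<open>Z\<close>, the complement is the union of the open cells and the
  preimage under \<open>rt\<close> of the complement in \<open>Z\<close>. For s inside a cell, its
  preimage in each disk is at most one point.\<close>

lemma D_open_complement_point:
  assumes IH: "\<And>s. D_open Z (points Z - {s})"
  shows "D_open Z' (points Z' - {s})"
proof (cases "s \<in> points Z")
  case True
  have "openin (D_topology Z') {y \<in> topspace (D_topology Z'). N y \<in> {..<1}}"
    by (rule openin_continuous_map_preimage[OF continuous_map_N]) simp
  moreover have "openin (D_topology Z') {y \<in> collar. rt y \<in> points Z - {s}}"
    unfolding openin_D_topology by (rule D_open_vimage[OF D_open_collar rt_smooth IH Z'])
  ultimately have "openin (D_topology Z') ({y \<in> topspace (D_topology Z'). N y \<in> {..<1}} \<union> {y \<in> collar. rt y \<in> points Z - {s}})"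
    by (rule openin_Un)
  moreover have "{y \<in> topspace (D_topology Z'). N y \<in> {..<1}} \<union> {y \<in> collar. rt y \<in> points Z - {s}} = points Z' - {s}"
  proof (rule set_eqI)
    fix y
    show "y \<in> {y \<in> topspace (D_topology Z'). N y \<in> {..<1}} \<union> {y \<in> collar. rt y \<in> points Z - {s}} \<longleftrightarrow> y \<in> points Z' - {s}"
    proof (cases "y \<in> points Z")
      case True
      then show ?thesis
        using Z_collar Z_sub by (auto simp: topspace_D N_Z rt_Z)
    next
      case False
      then show ?thesis
        using N_less_1[of y] \<open>s \<in> points Z\<close> by (auto simp: topspace_D collar_def)
    qed
  qed
  ultimately show ?thesis
    by (simp add: openin_D_topology)
next
  case False
  show ?thesis
  proof (rule D_openI)
    fix k W P assume P: "P \<in> plots Z k W"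
    have "{y \<in> W. P y \<in> points Z' - {s}} = W"
      using diffeological_spaceD(2)[OF Z P] False Z_sub by blast
    then show "openin (Euclidean_space k) {y \<in> W. P y \<in> points Z' - {s}}"
      using diffeological_spaceD(1)[OF Z P] by simp
  next
    fix k W j Q assume Q: "j \<in> J" "Q \<in> plots (disk_diff (Suc n)) k W"
    have W: "openin (Euclidean_space k) W"
      using Q(2) by (simp add: plots_disk)
    have ne: "\<Phi> (j, Q y) = s \<Longrightarrow> ci s = j \<and> cx s = Q y" if y: "y \<in> W" for y
    proof -
      assume s: "\<Phi> (j, Q y) = s"
      note d = disk_plot_in[OF Q(2) y]
      have "nr (Q y) \<noteq> 1"
        using \<Phi>_boundary_Z[OF Q(1) d] s False by auto
      then have "nr (Q y) < 1" using d by simp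
      then show ?thesis
        using coords_\<Phi>[OF Q(1) d] s by simp
    qed
    show "openin (Euclidean_space k) {y \<in> W. \<Phi> (j, Q y) \<in> points Z' - {s}}"
    proof (cases "s \<in> points Z' \<and> ci s = j")
      case True
      have "closedin (Euclidean_space (Suc n)) {cx s}"
        using cell_point(3)[of s] True False by (simp add: closedin_Euclidean_space_iff)
      then have o: "openin (Euclidean_space (Suc n)) (EE (Suc n) - {cx s})"
        by (rule openin_diff[OF openin_topspace])
      have "{y \<in> W. \<Phi> (j, Q y) \<in> points Z' - {s}} = {y \<in> W. Q y \<in> EE (Suc n) - {cx s}}"
      proof (intro Collect_cong conj_cong refl)
        fix y assume y: "y \<in> W"
        note d = disk_plot_in[OF Q(2) y]
        have "Q y = cx s \<Longrightarrow> \<Phi> (j, Q y) = s"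
          using cell_point(5)[of s] True False by simp
        then show "\<Phi> (j, Q y) \<in> points Z' - {s} \<longleftrightarrow> Q y \<in> EE (Suc n) - {cx s}"
          using ne[OF y] d \<Phi>_in[OF Q(1) d] by auto
      qed
      then show ?thesis
        using smooth_eucl_openin_vimage[OF disk_plot_smooth_eucl[OF Q(2)] o] by (simp only:)
    next
      case no: False
      have "{y \<in> W. \<Phi> (j, Q y) \<in> points Z' - {s}} = W"
        using ne no \<Phi>_in[OF Q(1) disk_plot_in[OF Q(2)]] by blast
      then show ?thesis using W by simp
    qed
  qed auto
qed

end

section \<open>Skeleta of a smooth CW complex\<close>

locale smooth_CW_complex =
  fixes X :: "'x diffeology" and sk :: "nat \<Rightarrow> 'x diffeology" and J :: "nat \<Rightarrow> 'i set"
    and h :: "nat \<Rightarrow> 'i \<times> (nat \<Rightarrow> real) \<Rightarrow> 'x"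
  assumes CW: "smooth_CW X sk J h"
begin

lemma sk_0: "\<exists>S. sk 0 = discrete_diff S"
  and attaching: "smooth_map (coprod_diff (J n) (\<lambda>_. sphere_diff n)) (sk n) (h n)"
  and sk_pushout: "\<exists>\<Phi>. is_pushout (coprod_diff (J n) (\<lambda>_. sphere_diff n)) (sk n)
                  (coprod_diff (J n) (\<lambda>_. disk_diff (Suc n))) (h n) id (sk (Suc n)) id \<Phi>"
  and colimit: "is_seq_colimit sk (\<lambda>_. id) X (\<lambda>_. id)"
  using CW by (simp_all add: smooth_CW_def)

lemma sk_diff: "diffeological_space (sk n)"
proof (cases n)
  case 0
  then show ?thesis using sk_0 diffeological_space_discrete by metis
next
  case (Suc l)
  then show ?thesis using sk_pushout[of l] by (auto simp: is_pushout_def)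
qed

lemma X_diff: "diffeological_space X"
  using colimit by (simp add: is_seq_colimit_def)

lemma cell: "\<exists>\<Phi>. cell_attachment n (sk n) (sk (Suc n)) (J n) (h n) \<Phi>"
proof -
  obtain \<Phi> where "is_pushout (coprod_diff (J n) (\<lambda>_. sphere_diff n)) (sk n)
                  (coprod_diff (J n) (\<lambda>_. disk_diff (Suc n))) (h n) id (sk (Suc n)) id \<Phi>"
    using sk_pushout ..
  then have "cell_attachment n (sk n) (sk (Suc n)) (J n) (h n) \<Phi>"
    by (intro cell_attachment.intro sk_diff attaching)
  then show ?thesis
    by (rule exI[of "cell_attachment n (sk n) (sk (Suc n)) (J n) (h n)"])
qed

lemma sk_plot_Suc: "P \<in> plots (sk n) k U \<Longrightarrow> P \<in> plots (sk (Suc n)) k U"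
  using cell cell_attachment.Z_plot by blast

lemma sk_plot_mono: "n \<le> l \<Longrightarrow> P \<in> plots (sk n) k U \<Longrightarrow> P \<in> plots (sk l) k U"
  by (induction l rule: dec_induct) (auto intro: sk_plot_Suc)

lemma points_sk_mono: "n \<le> l \<Longrightarrow> points (sk n) \<subseteq> points (sk l)"
proof (induction l rule: dec_induct)
  case (step l)
  have "points (sk l) \<subseteq> points (sk (Suc l))"
    using cell cell_attachment.Z_sub by blast
  with step show ?case by blast
qed simp

text \<open>Descend one skeleton at a time by \<open>plot_into_Z\<close>.\<close>

lemma sk_plot_down:
  "n \<le> l \<Longrightarrow> P \<in> plots (sk l) k U \<Longrightarrow> P \<in> U \<rightarrow> points (sk n) \<Longrightarrow> P \<in> plots (sk n) k U"
proof (induction l rule: dec_induct)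
  case (step l)
  have "P \<in> U \<rightarrow> points (sk l)"
    using step.prems(2) points_sk_mono[OF step.hyps(1)] by blast
  then have "P \<in> plots (sk l) k U"
    using cell[of l] cell_attachment.plot_into_Z step.prems(1) by blast
  then show ?case using step by blast
qed simp

lemma sk_smooth: "smooth_map (sk n) (sk (Suc n)) id"
  unfolding smooth_map_def using points_sk_mono[of n "Suc n"] sk_plot_Suc by auto

lemma X_plot: "P \<in> plots (sk n) k U \<Longrightarrow> P \<in> plots X k U"
proof -
  assume P: "P \<in> plots (sk n) k U"
  have "smooth_map (sk n) X id"
    using is_seq_colimit_cocone(1)[OF sk_diff sk_smooth colimit] .
  then have "id \<circ> P \<in> plots X k U"
    using P unfolding smooth_map_def by blast
  then show ?thesis by simp
qed

text \<open>The colimit is a quotient of a coproduct, so a plot lifts locally to one summand, that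
  is, to one skeleton; the structure maps being identities, the lift is the plot itself.\<close>

lemma X_plot_local:
  assumes P: "P \<in> plots X k U" and x: "x \<in> U"
  obtains W n where "openin (Euclidean_space k) W" "x \<in> W" "W \<subseteq> U" "P \<in> plots (sk n) k W"
proof -
  let ?S = "coprod_diff UNIV sk" and ?R = "seq_rel sk (\<lambda>_. id)"
  obtain u where u: "diffeomorphism (quot_diff ?S ?R) X u"
    and uk: "\<forall>n. \<forall>x\<in>points (sk n). u (quot_proj ?S ?R (n, x)) = id x"
    using colimit unfolding is_seq_colimit_def by blast
  obtain g where g: "smooth_map X (quot_diff ?S ?R) g" "\<forall>y\<in>points X. u (g y) = y"
    using u unfolding diffeomorphism_def by blast
  have PX: "P \<in> U \<rightarrow> points X"
    using diffeological_spaceD(2)[OF X_diff P] .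
  have "g \<circ> P \<in> plots (quot_diff ?S ?R) k U"
    using g P unfolding smooth_map_def by blast
  then obtain W1 where W1: "openin (Euclidean_space k) W1" "x \<in> W1" "W1 \<subseteq> U"
    and ex1: "\<exists>Q\<in>plots ?S k W1. \<forall>y\<in>W1. (g \<circ> P) y = quot_proj ?S ?R (Q y)"
    unfolding quot_diff_def diffeology.simps by (rule local_plotsE[OF _ x])
  then obtain s where s: "s \<in> plots ?S k W1" "\<forall>y\<in>W1. g (P y) = quot_proj ?S ?R (s y)"
    by auto
  from s(1) obtain W where W: "openin (Euclidean_space k) W" "x \<in> W" "W \<subseteq> W1"
    and ex: "\<exists>n\<in>UNIV. \<exists>Q\<in>plots (sk n) k W. \<forall>y\<in>W. s y = (n, Q y)"
    unfolding coprod_diff_def diffeology.simps by (rule local_plotsE[OF _ W1(2)])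
  then obtain n Q where Q: "Q \<in> plots (sk n) k W" "\<forall>y\<in>W. s y = (n, Q y)" by blast
  have "Q y = P y" if y: "y \<in> W" for y
  proof -
    have "Q y \<in> points (sk n)"
      using diffeological_spaceD(2)[OF sk_diff Q(1)] y by blast
    then have "u (quot_proj ?S ?R (s y)) = Q y"
      using uk Q(2) y by simp
    moreover have "y \<in> W1" "P y \<in> points X"
      using y W(3) W1(3) PX by auto
    ultimately show ?thesis
      using s(2) g(2) by metis
  qed
  then have "P \<in> plots (sk n) k W"
    by (rule diffeological_spaceD(5)[OF sk_diff Q(1)])
  then show ?thesis
    using that W W1(3) by blast
qed

text \<open>Zero-dimensional plots turn facts about plots into facts about points.\<close>

lemma const_plot: "diffeological_space Y \<Longrightarrow> y \<in> points Y \<Longrightarrow> (\<lambda>_. y) \<in> plots Y 0 (EE 0)"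
  by (rule diffeological_spaceD(3)) simp_all

lemma zero_EE: "(\<lambda>_. 0) \<in> EE k"
  by (simp add: topspace_Euclidean_space)

lemma X_points: "y \<in> points X \<Longrightarrow> \<exists>n. y \<in> points (sk n)"
proof -
  assume y: "y \<in> points X"
  obtain W n where "(\<lambda>_. 0) \<in> W" "(\<lambda>_. y) \<in> plots (sk n) 0 W"
    by (rule X_plot_local[OF const_plot[OF X_diff y] zero_EE])
  then show ?thesis
    using diffeological_spaceD(2)[OF sk_diff] by blast
qed

lemma points_sk_X: "points (sk n) \<subseteq> points X"
proof
  fix y assume y: "y \<in> points (sk n)"
  show "y \<in> points X"
    using diffeological_spaceD(2)[OF X_diff X_plot[OF const_plot[OF sk_diff y]]] zero_EE by blast
qed

lemma X_plot_into_sk: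
  assumes P: "P \<in> plots X k U" "P \<in> U \<rightarrow> points (sk n)"
  shows "P \<in> plots (sk n) k U"
proof (rule diffeological_space_local[OF sk_diff])
  fix x assume x: "x \<in> U"
  obtain W l where W: "openin (Euclidean_space k) W" "x \<in> W" "W \<subseteq> U" "P \<in> plots (sk l) k W"
    by (rule X_plot_local[OF P(1) x])
  have "P \<in> plots (sk n) k W"
  proof (cases "l \<le> n")
    case True
    then show ?thesis using sk_plot_mono W(4) by blast
  next
    case False
    then show ?thesis
      using sk_plot_down[of n l P k W] W(3,4) P(2) by (auto simp: Pi_iff)
  qed
  with W(1-3) show "\<exists>W. openin (Euclidean_space k) W \<and> x \<in> W \<and> W \<subseteq> U \<and> P \<in> plots (sk n) k W"
    by blast
qed

lemma D_open_sk_complement_point: "D_open (sk n) (points (sk n) - {s})"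
proof (induction n arbitrary: s)
  case 0
  obtain S where "sk 0 = discrete_diff S" using sk_0 ..
  then show ?case
    using D_open_discrete[of "S - {s}" S] by (simp add: discrete_diff_def)
next
  case (Suc n)
  obtain \<Phi> where "cell_attachment n (sk n) (sk (Suc n)) (J n) (h n) \<Phi>"
    using cell by blast
  then show ?case
    by (rule cell_attachment.D_open_complement_point) (rule Suc.IH)
qed

text \<open>Checking the skeleta from b on suffices because plots of lower skeleta are plots of
  higher ones.\<close>

lemma D_open_X:
  assumes "A \<subseteq> points X" "\<And>n. b \<le> n \<Longrightarrow> D_open (sk n) (A \<inter> points (sk n))"
  shows "D_open X A"
  unfolding D_open_def
proof (intro conjI allI ballI assms(1))
  fix k U P assume P: "P \<in> plots X k U"
  show "openin (Euclidean_space k) {x \<in> U. P x \<in> A}"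
  proof (rule local_plots_vimage)
    fix x assume x: "x \<in> U"
    obtain W l where W: "openin (Euclidean_space k) W" "x \<in> W" "W \<subseteq> U" "P \<in> plots (sk l) k W"
      by (rule X_plot_local[OF P x])
    define l' where "l' = max l b"
    have P': "P \<in> plots (sk l') k W"
      using sk_plot_mono[OF _ W(4)] by (simp add: l'_def)
    have "{y \<in> W. P y \<in> A} = {y \<in> W. P y \<in> A \<inter> points (sk l')}"
      using diffeological_spaceD(2)[OF sk_diff P'] by blast
    then have "openin (Euclidean_space k) {y \<in> W. P y \<in> A}"
      using D_openD[OF assms(2) P'] by (simp add: l'_def)
    with W(1-3) show "\<exists>W. openin (Euclidean_space k) W \<and> x \<in> W \<and> W \<subseteq> U \<and> openin (Euclidean_space k) {y \<in> W. P y \<in> A}"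
      by blast
  qed
qed

text \<open>Extend W from each skeleton to the next by \<open>D_open_extend\<close>, choosing each
  extension to restrict to the previous one; the union then meets every skeleton in the chosen
  set.\<close>

lemma D_open_sk_extend:
  assumes W: "D_open (sk n) W"
  shows "\<exists>W'. D_open X W' \<and> W' \<inter> points (sk n) = W"
proof -
  have ext: "\<exists>B. D_open (sk (n + Suc i)) B \<and> B \<inter> points (sk (n + i)) = A" if "D_open (sk (n + i)) A" for A i
    using cell[of "n + i"] cell_attachment.D_open_extend that by fastforce
  have "\<exists>f. \<forall>i. D_open (sk (n + i)) (f i) \<and> (i = 0 \<longrightarrow> f i = W) \<and> f (Suc i) \<inter> points (sk (n + i)) = f i"
    by (rule dependent_nat_choice[where P="\<lambda>i A. D_open (sk (n + i)) A \<and> (i = 0 \<longrightarrow> A = W)"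
          and Q="\<lambda>i A B. B \<inter> points (sk (n + i)) = A", simplified conj_assoc])
       (use W ext in auto)
  then obtain f where f: "\<And>i. D_open (sk (n + i)) (f i)" "f 0 = W" "\<And>i. f (Suc i) \<inter> points (sk (n + i)) = f i"
    by blast
  have sub: "f i \<subseteq> points (sk (n + i))" for i
    using f(1) by (auto simp: D_open_def)
  have up: "f (i + d) \<inter> points (sk (n + i)) = f i" for i d
  proof (induction d)
    case (Suc d)
    have "points (sk (n + i)) \<subseteq> points (sk (n + (i + d)))"
      by (rule points_sk_mono) simp
    then have "f (i + Suc d) \<inter> points (sk (n + i)) = f (Suc (i + d)) \<inter> points (sk (n + (i + d))) \<inter> points (sk (n + i))"
      by auto
    then show ?case using f(3) Suc by simp
  qed (use sub in auto)
  define A where "A = (\<Union>i. f i)"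
  have A: "A \<inter> points (sk (n + i)) = f i" for i
  proof
    show "f i \<subseteq> A \<inter> points (sk (n + i))"
      using sub by (auto simp: A_def)
    show "A \<inter> points (sk (n + i)) \<subseteq> f i"
    proof
      fix y assume "y \<in> A \<inter> points (sk (n + i))"
      then obtain j where j: "y \<in> f j" "y \<in> points (sk (n + i))"
        by (auto simp: A_def)
      show "y \<in> f i"
      proof (cases "i \<le> j")
        case True
        then show ?thesis using up[of i "j - i"] j by auto
      next
        case False
        then show ?thesis using up[of j "i - j"] j by auto
      qed
    qed
  qed
  have "D_open X A"
  proof (rule D_open_X[where b=n])
    show "A \<subseteq> points X"
      using sub points_sk_X by (fastforce simp: A_def)
    fix l assume "n \<le> l"
    then show "D_open (sk l) (A \<inter> points (sk l))"
      using A[of "l - n"] f(1)[of "l - n"] by simp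
  qed
  then show ?thesis
    using A[of 0] f(2) by (intro exI[of _ A]) simp
qed

lemma topspace_D_sk: "topspace (D_topology (sk n)) = points (sk n)" and topspace_D_X: "topspace (D_topology X) = points X"
  by (simp_all add: topspace_D_topology sk_diff X_diff)

text \<open>By \<open>D_open_sk_extend\<close> each skeleton has the topology induced from X, so
  continuity into X gives continuity into the skeleton.\<close>

lemma continuous_into_sk:
  assumes f: "continuous_map Y (D_topology X) f" and "\<And>y. y \<in> topspace Y \<Longrightarrow> f y \<in> points (sk n)"
  shows "continuous_map Y (D_topology (sk n)) f"
  unfolding continuous_map_def topspace_D_sk
proof (intro conjI allI impI)
  show "f \<in> topspace Y \<rightarrow> points (sk n)"
    using assms(2) by blast
  fix W assume "openin (D_topology (sk n)) W"
  then obtain W' where W': "D_open X W'" "W' \<inter> points (sk n) = W"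
    using D_open_sk_extend openin_D_topology by blast
  have "{x \<in> topspace Y. f x \<in> W} = {x \<in> topspace Y. f x \<in> W'}"
    using W'(2) assms(2) by auto
  moreover have "openin (D_topology X) W'"
    using W'(1) by (simp add: openin_D_topology)
  from openin_continuous_map_preimage[OF f this] have "openin Y {x \<in> topspace Y. f x \<in> W'}" .
  ultimately show "openin Y {x \<in> topspace Y. f x \<in> W}"
    by (simp only:)
qed

lemma sk_into_X_continuous: "continuous_map (D_topology (sk n)) (D_topology X) (\<lambda>y. y)"
proof -
  have "smooth_map (sub_diff (sk n) (points (sk n))) X (\<lambda>y. y)"
    unfolding smooth_map_def using points_sk_X X_plot by (auto simp: o_def)
  from smooth_imp_continuous[OF D_open_points[OF sk_diff] this sk_diff X_diff] show ?thesis
    by (metis topspace_D_sk subtopology_topspace)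
qed

text \<open>This is why a convergent sequence cannot leave every skeleton.\<close>

lemma D_open_complement_locally_finite:
  assumes "\<And>n. finite (S \<inter> points (sk n))"
  shows "D_open X (points X - S)"
proof (rule D_open_X[where b=0])
  fix n
  have "openin (D_topology (sk n)) (points (sk n) \<inter> \<Inter>(insert (points (sk n)) ((\<lambda>s. points (sk n) - {s}) ` (S \<inter> points (sk n)))))"
  proof (intro openin_Int openin_Inter)
    show "openin (D_topology (sk n)) A"
      if "A \<in> insert (points (sk n)) ((\<lambda>s. points (sk n) - {s}) ` (S \<inter> points (sk n)))" for A
      using that D_open_sk_complement_point D_open_points[OF sk_diff] by (auto simp: openin_D_topology)
  qed (use assms in \<open>auto simp: openin_D_topology D_open_points[OF sk_diff]\<close>)
  moreover have "points (sk n) \<inter> \<Inter>(insert (points (sk n)) ((\<lambda>s. points (sk n) - {s}) ` (S \<inter> points (sk n))))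
      = (points X - S) \<inter> points (sk n)"
    using points_sk_X by auto
  ultimately show "D_open (sk n) ((points X - S) \<inter> points (sk n))"
    by (simp add: openin_D_topology)
qed blast

end

section \<open>Continuous maps from a manifold to a smooth CW complex\<close>

locale CW_map = manifold m T \<A> + smooth_CW_complex X sk J h
  for m :: nat and T :: "'m topology" and \<A> and X :: "'x diffeology" and sk and J :: "nat \<Rightarrow> 'i set" and h
begin

lemma smoothable_sk: "smoothable (sk n)"
proof (induction n)
  case 0
  then show ?case using sk_0 smoothable_discrete by metis
next
  case (Suc n)
  then show ?case using cell[of n] smoothable_cell by blast
qed

text \<open>Otherwise there are points \<open>z k\<close> converging to x in a chart with
  \<open>f (z k)\<close> outside the k-skeleton. Their values form a closed set once
  \<open>f x\<close> is removed, so eventually \<open>f (z k)\<close> equals \<open>f x\<close>,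
  which lies in some skeleton.\<close>

lemma locally_in_skeleton:
  assumes f: "continuous_map T (D_topology X) f" and x: "x \<in> topspace T"
  shows "\<exists>k W. openin T W \<and> x \<in> W \<and> f ` W \<subseteq> points (sk k)"
proof (rule ccontr)
  assume no: "\<not> ?thesis"
  obtain C \<phi> where C: "(C, \<phi>) \<in> \<A>" "x \<in> C"
    using atlas_cover[OF x] by blast
  have CT: "C \<subseteq> topspace T" and \<phi>C: "\<phi> ` C \<subseteq> EE m"
    using chart[OF C(1)] openin_subset by auto
  note inj = chart_inj[OF C(1)]
  define d where "d z = (\<Sum>i<m. (\<phi> z i - \<phi> x i)\<^sup>2)" for z
  have dc: "continuous_map (subtopology T C) euclideanreal d"
  proof -
    have "continuous_map (subtopology T C) (Euclidean_space m) \<phi>"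
      using homeomorphic_imp_continuous_map[OF chart(3)[OF C(1)]] continuous_map_in_subtopology by blast
    from continuous_map_compose[OF this continuous_map_sumsq] show ?thesis
      by (simp add: o_def d_def[abs_def])
  qed
  define B where "B k = {z \<in> C. d z \<in> {..<1 / real (Suc k)}}" for k
  have B: "openin T (B k)" for k
    unfolding B_def by (rule openin_level[OF chart(1)[OF C(1)] dc]) simp
  have xB: "x \<in> B k" for k
    using C(2) by (simp add: B_def d_def)
  have "\<exists>z. z \<in> B k \<and> f z \<notin> points (sk k)" for k
    using no B[of k] xB[of k] by blast
  then obtain z where z: "\<And>k. z k \<in> B k" "\<And>k. f (z k) \<notin> points (sk k)"
    by metis
  have fx: "f x \<in> points X"
    using f x topspace_D_X unfolding continuous_map_def by blast
  \<comment> \<open>Removing \<open>f x\<close> makes the complement of S a neighbourhood of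
    \<open>f x\<close>; the n-skeleton contains at most the values with index below n.\<close>
  define S where "S = (\<lambda>k. f (z k)) ` UNIV - {f x}"
  have "finite (S \<inter> points (sk n))" for n
  proof (rule finite_subset)
    show "S \<inter> points (sk n) \<subseteq> (\<lambda>k. f (z k)) ` {..<n}"
    proof
      fix y assume y: "y \<in> S \<inter> points (sk n)"
      then obtain k where k: "y = f (z k)" by (auto simp: S_def)
      have "k < n"
        using z(2)[of k] y k points_sk_mono[of n k] by (meson IntD2 not_le subsetD)
      then show "y \<in> (\<lambda>k. f (z k)) ` {..<n}" using k by blast
    qed
  qed simp
  then have "openin (D_topology X) (points X - S)"
    using D_open_complement_locally_finite by (simp add: openin_D_topology)
  from openin_continuous_map_preimage[OF f this]
  have o: "openin T {y \<in> topspace T. f y \<in> points X - S}" .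
  define W where "W = C \<inter> {y \<in> topspace T. f y \<in> points X - S}"
  have W: "openin T W" "x \<in> W"
    using o chart(1)[OF C(1)] C(2) x fx by (auto simp: W_def S_def)
  have eq: "{y \<in> \<phi> ` C. inv_into C \<phi> y \<in> W} = \<phi> ` W"
    using inj by (auto simp: W_def)
  have oW: "openin (Euclidean_space m) (\<phi> ` W)"
    using plot_vimage_open[OF inv_chart_plot[OF C(1)] W(1)] eq by simp
  have xW: "\<phi> x \<in> \<phi> ` W" using W(2) by blast
  obtain e where e: "0 < e" "\<And>y. y \<in> EE m \<Longrightarrow> (\<Sum>i<m. (y i - \<phi> x i)\<^sup>2) < e \<Longrightarrow> y \<in> \<phi> ` W"
    by (rule Euclidean_ball_subset[OF oW xW]) blast
  obtain k0 where k0: "inverse (real (Suc k0)) < e"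
    using reals_Archimedean[OF e(1)] by blast
  have zW: "z k \<in> W" if "k0 \<le> k" for k
  proof -
    have zk: "z k \<in> C" "d (z k) < 1 / real (Suc k)"
      using z(1)[of k] by (auto simp: B_def)
    have "1 / real (Suc k) \<le> inverse (real (Suc k0))"
      using that by (simp add: inverse_eq_divide frac_le)
    then have "d (z k) < e"
      using zk(2) k0 by linarith
    then have "\<phi> (z k) \<in> \<phi> ` W"
      using e(2)[of "\<phi> (z k)"] zk(1) \<phi>C by (auto simp: d_def)
    then obtain y where y: "y \<in> W" "\<phi> (z k) = \<phi> y" by blast
    then have "z k = y"
      using inj_onD[OF inj y(2) zk(1)] by (auto simp: W_def)
    then show ?thesis using y(1) by simp
  qed
  have "f (z k) = f x" if "k0 \<le> k" for k
    using zW[OF that] by (auto simp: W_def S_def)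
  moreover obtain l where "f x \<in> points (sk l)"
    using X_points[OF fx] by blast
  ultimately have "f (z (max k0 l)) \<in> points (sk l)"
    by simp
  then show False
    using z(2)[of "max k0 l"] points_sk_mono[of l "max k0 l"] by auto
qed

end

section \<open>Maps into infinite-dimensional complexes\<close>

context CW_map begin

text \<open>\<rho> averages dimensions \<kappa> of skeleta that contain the images of whole
  neighbourhoods, so at least one of the averaged dimensions at y is at most the value of \<rho>
  there.\<close>

lemma skeleton_height:
  assumes f: "continuous_map T (D_topology X) f"
  obtains \<rho> where "continuous_map T euclideanreal \<rho>" "\<And>x. x \<in> topspace T \<Longrightarrow> 0 \<le> \<rho> x"
    "\<And>x k. x \<in> topspace T \<Longrightarrow> \<rho> x \<le> real k \<Longrightarrow> f x \<in> points (sk k)"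
proof -
  have "\<forall>x\<in>topspace T. \<exists>k W. openin T W \<and> x \<in> W \<and> f ` W \<subseteq> points (sk k)"
    using locally_in_skeleton[OF f] by blast
  from bchoice[OF this] obtain \<kappa> where
    "\<forall>x\<in>topspace T. \<exists>W. openin T W \<and> x \<in> W \<and> f ` W \<subseteq> points (sk (\<kappa> x))" ..
  from bchoice[OF this] obtain U where
    U: "\<forall>x\<in>topspace T. openin T (U x) \<and> x \<in> U x \<and> f ` (U x) \<subseteq> points (sk (\<kappa> x))" ..
  then have U': "\<And>x. x \<in> topspace T \<Longrightarrow> openin T (U x) \<and> x \<in> U x"
    by blast
  obtain F :: "'m \<Rightarrow> nat \<Rightarrow> real" where F: "\<And>i. msmooth (topspace T) (\<lambda>y. F y i)"
    "\<And>y. y \<in> topspace T \<Longrightarrow> \<exists>(I :: 'm set set) a \<xi>. finite I \<and> (\<forall>j\<in>I. \<xi> j \<in> topspace T \<and> y \<in> U (\<xi> j) \<and> 0 \<le> a j) \<and>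
       sum a I = (1::real) \<and> (\<forall>i. F y i = (\<Sum>j\<in>I. a j * real (\<kappa> (\<xi> j))))"
    using patch_constants[where U=U and c="\<lambda>x _. real (\<kappa> x)", OF openin_topspace U'] by blast
  show ?thesis
  proof (rule that[of "\<lambda>y. F y 0"])
    show "continuous_map T euclideanreal (\<lambda>y. F y 0)"
      using msmooth_continuous[OF openin_topspace F(1)] by simp
    show "0 \<le> F y 0" if y: "y \<in> topspace T" for y
    proof -
      obtain I :: "'m set set" and a \<xi> where "\<forall>j\<in>I. \<xi> j \<in> topspace T \<and> y \<in> U (\<xi> j) \<and> 0 \<le> a j"
         "\<forall>i. F y i = (\<Sum>j\<in>I. a j * real (\<kappa> (\<xi> j)))"
        using F(2)[OF y] by (elim exE conjE) (rule that)
      then show ?thesis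
        by (simp add: sum_nonneg)
    qed
    show "f y \<in> points (sk k)" if y: "y \<in> topspace T" and le: "F y 0 \<le> real k" for y k
    proof (rule ccontr)
      assume no: "f y \<notin> points (sk k)"
      obtain I :: "'m set set" and a \<xi> where I: "\<forall>j\<in>I. \<xi> j \<in> topspace T \<and> y \<in> U (\<xi> j) \<and> 0 \<le> a j"
         "sum a I = 1" "\<forall>i. F y i = (\<Sum>j\<in>I. a j * real (\<kappa> (\<xi> j)))"
        using F(2)[OF y] by (elim exE conjE) (rule that)
      \<comment> \<open>All contributing skeleta contain \<open>f y\<close>, so their dimensions
        exceed k, and then so does the average.\<close>
      have "real (Suc k) \<le> real (\<kappa> (\<xi> j))" if j: "j \<in> I" for j
      proof -
        have "f y \<in> points (sk (\<kappa> (\<xi> j)))"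
          using I(1) U j by blast
        then have "\<not> \<kappa> (\<xi> j) \<le> k"
          using no points_sk_mono by blast
        then show ?thesis by simp
      qed
      then have "(\<Sum>j\<in>I. a j * real (Suc k)) \<le> (\<Sum>j\<in>I. a j * real (\<kappa> (\<xi> j)))"
        using I(1) by (intro sum_mono mult_left_mono) auto
      moreover have "(\<Sum>j\<in>I. a j * real (Suc k)) = real (Suc k)"
        using I(2) by (simp only: sum_distrib_right[symmetric] mult_1)
      ultimately have "real (Suc k) \<le> F y 0"
        using I(3) by simp
      then show False using le by simp
    qed
  qed
qed

lemma msmap_into_sk:
  assumes "msmap V X f" "\<And>x. x \<in> V \<Longrightarrow> f x \<in> points (sk n)"
  shows "msmap V (sk n) f"
proof (rule msmapI)
  fix k U P assume P: "P \<in> plots \<M> k U" "P \<in> U \<rightarrow> V"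
  show "(\<lambda>x. f (P x)) \<in> plots (sk n) k U"
    by (rule X_plot_into_sk[OF msmap_plot[OF assms(1) P]]) (use assms(2) P(2) in auto)
qed (use assms(2) in auto)

lemma msmap_sk_X: "msmap V (sk n) f \<Longrightarrow> msmap V X f"
  by (rule msmapI) (use msmap_points points_sk_X X_plot msmap_plot in blast)+

text \<open>Where the skeleton containing \<open>f x\<close> is locally constant, the finite-dimensional case applies
  separately to each of the disjoint open sets \<open>\<nu> = k\<close>.\<close>

lemma smoothing_locally_finite_dimensional:
  assumes V: "openin T V" and A: "closedin (subtopology T V) A" and Om: "openin T Om" "A \<subseteq> Om" "Om \<subseteq> V"
    and f: "continuous_map (subtopology T V) (D_topology X) f" and fs: "msmap Om X f"
    and \<nu>: "\<And>k. openin T {x \<in> V. \<nu> x = k}" "\<And>x. x \<in> V \<Longrightarrow> f x \<in> points (sk (\<nu> x))"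
  obtains g H where "msmap V X g"
    "continuous_map (prod_topology (subtopology T V) euclideanreal) (D_topology X) H"
    "\<And>x t. x \<in> V \<Longrightarrow> H (x, t) \<in> points (sk (\<nu> x))"
    "\<And>x t. x \<in> V \<Longrightarrow> t \<le> 0 \<Longrightarrow> H (x, t) = f x" "\<And>x t. x \<in> V \<Longrightarrow> 1 \<le> t \<Longrightarrow> H (x, t) = g x"
    "\<And>x t. x \<in> A \<Longrightarrow> x \<in> V \<Longrightarrow> H (x, t) = f x"
proof -
  define W where "W k = {x \<in> V. \<nu> x = k}" for k
  have W: "openin T (W k)" "W k \<subseteq> V" for k
    using \<nu>(1)[of k] by (auto simp: W_def)
  have ex: "\<exists>g H. msmap (W k) (sk k) g \<and>
      continuous_map (prod_topology (subtopology T (W k)) euclideanreal) (D_topology (sk k)) H \<and>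
      (\<forall>x\<in>W k. \<forall>t. (t \<le> 0 \<longrightarrow> H (x, t) = f x) \<and> (1 \<le> t \<longrightarrow> H (x, t) = g x) \<and> (x \<in> A \<longrightarrow> H (x, t) = f x))" for k
  proof -
    have fW: "f x \<in> points (sk k)" if "x \<in> W k" for x
      using \<nu>(2) that by (auto simp: W_def)
    have 1: "closedin (subtopology T (W k)) (A \<inter> W k)"
    proof -
      have "closedin (subtopology (subtopology T V) (W k)) (A \<inter> W k)"
        using A by (auto simp: closedin_subtopology)
      then show ?thesis
        by (simp only: subtopology_subtopology Int_absorb1[OF W(2)])
    qed
    have 2: "openin T (Om \<inter> W k)" "A \<inter> W k \<subseteq> Om \<inter> W k" "Om \<inter> W k \<subseteq> W k"
      using Om W(1) by auto
    have 3: "continuous_map (subtopology T (W k)) (D_topology (sk k)) f"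
      by (rule continuous_into_sk[OF continuous_map_from_subtopology_mono[OF f W(2)]])
         (use fW topspace_sub[OF W(1)] in blast)
    have 4: "msmap (Om \<inter> W k) (sk k) f"
      by (rule msmap_into_sk[OF msmap_subset[OF fs]]) (use fW in auto)
    obtain g where g: "msmap (W k) (sk k) g" "homot (W k) (D_topology (sk k)) (A \<inter> W k) f g"
      by (rule smoothableD[OF smoothable_sk W(1) 1 2 3 4])
    obtain H where "continuous_map (prod_topology (subtopology T (W k)) euclideanreal) (D_topology (sk k)) H"
      "\<And>x t. x \<in> W k \<Longrightarrow> t \<le> 0 \<Longrightarrow> H (x, t) = f x" "\<And>x t. x \<in> W k \<Longrightarrow> 1 \<le> t \<Longrightarrow> H (x, t) = g x"
      "\<And>x t. x \<in> A \<inter> W k \<Longrightarrow> x \<in> W k \<Longrightarrow> H (x, t) = f x"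
      by (rule homotE[OF g(2)]) blast
    then show ?thesis
      using g(1) by (intro exI[of _ g] exI[of _ H]) simp
  qed
  have "\<forall>k. \<exists>g H. msmap (W k) (sk k) g \<and>
      continuous_map (prod_topology (subtopology T (W k)) euclideanreal) (D_topology (sk k)) H \<and>
      (\<forall>x\<in>W k. \<forall>t. (t \<le> 0 \<longrightarrow> H (x, t) = f x) \<and> (1 \<le> t \<longrightarrow> H (x, t) = g x) \<and> (x \<in> A \<longrightarrow> H (x, t) = f x))"
    by (rule allI) (rule ex)
  from choice[OF this] obtain g where "\<forall>k. \<exists>H. msmap (W k) (sk k) (g k) \<and>
      continuous_map (prod_topology (subtopology T (W k)) euclideanreal) (D_topology (sk k)) H \<and>
      (\<forall>x\<in>W k. \<forall>t. (t \<le> 0 \<longrightarrow> H (x, t) = f x) \<and> (1 \<le> t \<longrightarrow> H (x, t) = g k x) \<and> (x \<in> A \<longrightarrow> H (x, t) = f x))" ..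
  from choice[OF this] obtain H where gH: "\<forall>k. msmap (W k) (sk k) (g k) \<and>
      continuous_map (prod_topology (subtopology T (W k)) euclideanreal) (D_topology (sk k)) (H k) \<and>
      (\<forall>x\<in>W k. \<forall>t. (t \<le> 0 \<longrightarrow> H k (x, t) = f x) \<and> (1 \<le> t \<longrightarrow> H k (x, t) = g k x) \<and> (x \<in> A \<longrightarrow> H k (x, t) = f x))" ..
  have xW: "x \<in> W (\<nu> x)" if "x \<in> V" for x
    using that by (simp add: W_def)
  let ?X = "prod_topology (subtopology T V) euclideanreal"
  show ?thesis
  proof (rule that[of "\<lambda>x. g (\<nu> x) x" "\<lambda>p. H (\<nu> (fst p)) p"])
    show "msmap V X (\<lambda>x. g (\<nu> x) x)"
    proof (rule msmap_local[OF X_diff])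
      fix x assume x: "x \<in> V"
      have "msmap (W (\<nu> x)) X (g (\<nu> x))"
        using gH msmap_sk_X by blast
      then have "msmap (W (\<nu> x)) X (\<lambda>x. g (\<nu> x) x)"
        by (rule msmap_cong[OF X_diff]) (simp add: W_def)
      then show "\<exists>W. openin T W \<and> x \<in> W \<and> msmap W X (\<lambda>x. g (\<nu> x) x)"
        using W(1) xW[OF x] by blast
    qed
    show "continuous_map ?X (D_topology X) (\<lambda>p. H (\<nu> (fst p)) p)"
    proof (rule continuous_map_local)
      have tX: "topspace ?X = V \<times> UNIV"
        using topspace_sub[OF V] by simp
      fix p assume "p \<in> topspace ?X"
      then have p: "fst p \<in> V"
        unfolding tX by (rule mem_Times_iff[THEN iffD1, THEN conjunct1])
      let ?U = "W (\<nu> (fst p)) \<times> (UNIV :: real set)"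
      have e: "subtopology ?X ?U = prod_topology (subtopology T (W (\<nu> (fst p)))) euclideanreal"
        by (simp only: subtopology_Times subtopology_subtopology Int_absorb1[OF W(2)] subtopology_UNIV)
      have "continuous_map (subtopology ?X ?U) (D_topology (sk (\<nu> (fst p)))) (H (\<nu> (fst p)))"
        unfolding e using gH by blast
      from continuous_map_compose[OF this sk_into_X_continuous]
      have "continuous_map (subtopology ?X ?U) (D_topology X) (H (\<nu> (fst p)))"
        by (simp add: o_def)
      then have "continuous_map (subtopology ?X ?U) (D_topology X) (\<lambda>p. H (\<nu> (fst p)) p)"
        by (rule continuous_map_eq) (auto simp: W_def)
      moreover have "openin ?X ?U"
        using W V by (simp add: openin_prod_Times_iff openin_open_subtopology)
      moreover have "p \<in> ?U"
        using xW[OF p] by (simp add: mem_Times_iff)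
      ultimately show "\<exists>U. openin ?X U \<and> p \<in> U \<and> continuous_map (subtopology ?X U) (D_topology X) (\<lambda>p. H (\<nu> (fst p)) p)"
        by blast
    qed
    fix x t assume x: "x \<in> V"
    have c: "continuous_map (prod_topology (subtopology T (W (\<nu> x))) euclideanreal) (D_topology (sk (\<nu> x))) (H (\<nu> x))"
      using gH by blast
    have "(x, t) \<in> topspace (prod_topology (subtopology T (W (\<nu> x))) euclideanreal)"
      using xW[OF x] topspace_sub[OF W(1)] by simp
    then show "H (\<nu> (fst (x, t))) (x, t) \<in> points (sk (\<nu> x))"
      using c unfolding continuous_map_def topspace_D_sk by auto
    have e: "\<forall>t. (t \<le> 0 \<longrightarrow> H (\<nu> x) (x, t) = f x) \<and> (1 \<le> t \<longrightarrow> H (\<nu> x) (x, t) = g (\<nu> x) x) \<and> (x \<in> A \<longrightarrow> H (\<nu> x) (x, t) = f x)"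
      using gH xW[OF x] by blast
    show "t \<le> 0 \<Longrightarrow> H (\<nu> (fst (x, t))) (x, t) = f x"
      using e by simp
    show "1 \<le> t \<Longrightarrow> H (\<nu> (fst (x, t))) (x, t) = g (\<nu> x) x"
      using e by simp
    show "x \<in> A \<Longrightarrow> H (\<nu> (fst (x, t))) (x, t) = f x"
      using e by simp
  qed
qed

text \<open>Away from the integers the floor is locally constant; adding 1 makes the number an upper
  bound for s.\<close>

lemma openin_floor_level:
  assumes V: "openin T V" and s: "continuous_map (subtopology T V) euclideanreal s"
    and ni: "\<And>x. x \<in> V \<Longrightarrow> s x \<notin> \<int>"
  shows "openin T {x \<in> V. nat \<lfloor>s x\<rfloor> + 1 = k}"
proof (subst openin_subopen, intro ballI)
  fix x assume x: "x \<in> {x \<in> V. nat \<lfloor>s x\<rfloor> + 1 = k}"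
  let ?O = "{y \<in> V. s y \<in> {real_of_int \<lfloor>s x\<rfloor><..<real_of_int \<lfloor>s x\<rfloor> + 1}}"
  have "openin T ?O"
    by (rule openin_level[OF V s]) simp
  moreover have "s x \<noteq> real_of_int \<lfloor>s x\<rfloor>"
    using ni[of x] x by (metis (mono_tags, lifting) Ints_of_int mem_Collect_eq)
  then have "real_of_int \<lfloor>s x\<rfloor> < s x"
    using of_int_floor_le[of "s x"] by linarith
  then have "x \<in> ?O"
    using x by (simp add: real_of_int_floor_add_one_gt)
  moreover have "?O \<subseteq> {x \<in> V. nat \<lfloor>s x\<rfloor> + 1 = k}"
  proof
    fix y assume y: "y \<in> ?O"
    then have "\<lfloor>s y\<rfloor> = \<lfloor>s x\<rfloor>"
      by (intro floor_unique) auto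
    then show "y \<in> {x \<in> V. nat \<lfloor>s x\<rfloor> + 1 = k}"
      using x y by simp
  qed
  ultimately show "\<exists>S. openin T S \<and> x \<in> S \<and> S \<subseteq> {x \<in> V. nat \<lfloor>s x\<rfloor> + 1 = k}"
    by blast
qed

theorem smoothing:
  assumes f0: "continuous_map T (D_topology X) f" and A: "closedin T A"
    and Om: "openin T Om" "A \<subseteq> Om" and fs: "msmap Om X f"
  shows "\<exists>g. msmap (topspace T) X g \<and> homot (topspace T) (D_topology X) A f g"
proof -
  define M where "M = topspace T"
  have M: "openin T M" "subtopology T M = T"
    by (simp_all add: M_def)
  have f: "continuous_map (subtopology T M) (D_topology X) f"
    using f0 M(2) by simp
  have OmM: "Om \<subseteq> M"
    using openin_subset[OF Om(1)] by (simp add: M_def)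
  obtain \<rho> where \<rho>0: "continuous_map T euclideanreal \<rho>" and \<rho>pos: "\<And>x. x \<in> M \<Longrightarrow> 0 \<le> \<rho> x"
    and \<rho>sk: "\<And>x k. x \<in> M \<Longrightarrow> \<rho> x \<le> real k \<Longrightarrow> f x \<in> points (sk k)"
    unfolding M_def by (rule skeleton_height[OF f0]) blast
  have \<rho>: "continuous_map (subtopology T M) euclideanreal \<rho>"
    using \<rho>0 M(2) by simp
  have "closedin T (M - Om)"
    unfolding M_def by (rule closedin_diff[OF closedin_topspace Om(1)])
  then have "closedin (subtopology T M) (M - Om)"
    unfolding M(2) .
  moreover have "closedin (subtopology T M) A"
    using A M(2) by simp
  moreover have "A \<inter> (M - Om) = {}"
    using Om(2) by blast
  ultimately obtain \<alpha> where \<alpha>: "msmooth M \<alpha>" "\<And>y. y \<in> A \<Longrightarrow> \<alpha> y = 1" "\<And>y. y \<in> M - Om \<Longrightarrow> \<alpha> y = 0"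
    using smooth_Urysohn[OF M(1)] by blast
  have \<alpha>c: "continuous_map (subtopology T M) euclideanreal \<alpha>"
    by (rule msmooth_continuous[OF M(1) \<alpha>(1)])
  \<comment> \<open>\<open>c = 1\<close> where \<open>\<rho>\<close> is an integer, and \<open>c = -1\<close> on the walls, where \<open>\<rho> + 1/2\<close> is one\<close>
  define c where "c x = cos (2 * pi * \<rho> x)" for x
  have cc: "continuous_map (subtopology T M) euclideanreal c"
  proof -
    have "continuous_map euclideanreal euclideanreal (\<lambda>s. cos (2 * pi * s))"
      by (simp add: continuous_intros)
    from continuous_map_compose[OF \<rho> this] show ?thesis
      by (simp add: o_def c_def[abs_def])
  qed
  define fl where "fl x = nat \<lfloor>\<rho> x\<rfloor> + 1" for x
  have fsk: "f x \<in> points (sk (fl x))" if "x \<in> M" for x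
  proof (rule \<rho>sk[OF that])
    have "real (fl x) = real_of_int \<lfloor>\<rho> x\<rfloor> + 1"
      using \<rho>pos[OF that] by (simp add: fl_def)
    then show "\<rho> x \<le> real (fl x)"
      using real_of_int_floor_add_one_ge[of "\<rho> x"] by linarith
  qed
  \<comment> \<open>The first round is relative to a neighbourhood of A, so that its result still
    equals f, and hence is smooth, near A when the second round starts.\<close>
  define A' where "A' = {x \<in> M. \<alpha> x \<in> {1/2..}}"
  have A': "closedin (subtopology T M) A'" "A' \<subseteq> Om" "A \<subseteq> A'"
  proof -
    show "closedin (subtopology T M) A'"
      unfolding A'_def by (rule closedin_level[OF M(1) \<alpha>c]) simp
    show "A' \<subseteq> Om"
      using \<alpha>(3) by (force simp: A'_def)
    show "A \<subseteq> A'"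
      using \<alpha>(2) Om(2) OmM by (auto simp: A'_def)
  qed
  \<comment> \<open>Bands around the walls. Integers, where c is 1, are excluded, so the dimension
    bound \<open>fl\<close> is locally constant on B.\<close>
  define B where "B = {x \<in> M. c x \<in> {..<1/2}}"
  have B: "openin T B" "B \<subseteq> M"
    unfolding B_def by (rule openin_level[OF M(1) cc], simp) blast
  have B_ni: "\<rho> x \<notin> \<int>" if "x \<in> B" for x
  proof
    assume "\<rho> x \<in> \<int>"
    then have "c x = 1"
      unfolding c_def cos_one_2pi_int by (auto elim!: Ints_cases)
    then show False using that by (simp add: B_def)
  qed
  obtain g1 H1 where g1: "msmap B X g1"
    and H1: "continuous_map (prod_topology (subtopology T B) euclideanreal) (D_topology X) H1"
    and H1sk: "\<And>x t. x \<in> B \<Longrightarrow> H1 (x, t) \<in> points (sk (fl x))"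
    and H1_0: "\<And>x t. x \<in> B \<Longrightarrow> t \<le> 0 \<Longrightarrow> H1 (x, t) = f x"
    and H1_1: "\<And>x t. x \<in> B \<Longrightarrow> 1 \<le> t \<Longrightarrow> H1 (x, t) = g1 x"
    and H1_A: "\<And>x t. x \<in> A' \<inter> B \<Longrightarrow> x \<in> B \<Longrightarrow> H1 (x, t) = f x"
  proof (rule smoothing_locally_finite_dimensional[of B "A' \<inter> B" "Om \<inter> B" f fl])
    show "closedin (subtopology T B) (A' \<inter> B)"
    proof -
      have "closedin (subtopology (subtopology T M) B) (A' \<inter> B)"
        using A'(1) by (auto simp: closedin_subtopology)
      then show ?thesis
        by (simp only: subtopology_subtopology Int_absorb1[OF B(2)])
    qed
    show "openin T {x \<in> B. fl x = k}" for k
      unfolding fl_def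
      by (rule openin_floor_level[OF B(1) continuous_map_from_subtopology_mono[OF \<rho> B(2)] B_ni])
    show "continuous_map (subtopology T B) (D_topology X) f"
      by (rule continuous_map_from_subtopology_mono[OF f B(2)])
    show "msmap (Om \<inter> B) X f"
      by (rule msmap_subset[OF fs]) blast
    show "f x \<in> points (sk (fl x))" if "x \<in> B" for x
      using fsk B(2) that by blast
  qed (use B Om A' in \<open>auto intro: openin_Int\<close>)
  \<comment> \<open>The first homotopy runs to its end where c is at most -1/2 and does not start
    where c is nonnegative.\<close>
  define e where "e x = clamp01 (- 2 * c x)" for x
  have ec: "continuous_map (subtopology T M) euclideanreal e"
    unfolding e_def[abs_def] by (intro continuous_map_clamp01 continuous_map_real_mult_left cc)
  define N where "N = {x \<in> M. c x \<in> {..0}}"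
  have N: "closedin (subtopology T M) N" "N \<subseteq> B"
    unfolding N_def B_def by (rule closedin_level[OF M(1) cc], simp) auto
  have off: "H1 (x, t * e x) = f x" if "x \<in> B" "x \<notin> N" "0 \<le> t" for x t
  proof -
    have "e x = 0"
      using that(1,2) B(2) by (auto simp: N_def e_def clamp01_simps)
    then show ?thesis using H1_0[OF that(1)] by simp
  qed
  define f1 where "f1 x = (if x \<in> B then H1 (x, e x) else f x)" for x
  have hf1: "homot M (D_topology X) A' f f1"
    by (rule homotI[OF continuous_map_cutoff_extension[OF M(1) B f H1 ec N off]])
       (use H1_0 H1_A in \<open>auto simp: clamp01_simps f1_def\<close>)
  have f1: "continuous_map (subtopology T M) (D_topology X) f1"
    by (rule homot_continuous(2)[OF M(1) hf1])
  have f1sk: "f1 x \<in> points (sk (fl x))" if "x \<in> M" for x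
    using fsk[OF that] H1sk by (simp add: f1_def)
  define O1 where "O1 = {x \<in> M. \<alpha> x \<in> {1/2<..}} \<union> {x \<in> M. c x \<in> {..<-1/2}}"
  have O1: "openin T O1"
    unfolding O1_def by (intro openin_Un openin_level[OF M(1) \<alpha>c] openin_level[OF M(1) cc]) auto
  have f1s: "msmap O1 X f1"
  proof (rule msmap_local[OF X_diff])
    fix x assume "x \<in> O1"
    then consider "x \<in> {x \<in> M. \<alpha> x \<in> {1/2<..}}" | "x \<in> {x \<in> M. c x \<in> {..<-1/2}}"
      unfolding O1_def by blast
    then show "\<exists>W. openin T W \<and> x \<in> W \<and> msmap W X f1"
    proof cases
      case 1
      have "msmap {x \<in> M. \<alpha> x \<in> {1/2<..}} X f1"
      proof (rule msmap_cong[OF X_diff msmap_subset[OF fs]])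
        show "{x \<in> M. \<alpha> x \<in> {1/2<..}} \<subseteq> Om"
          using A'(2) by (auto simp: A'_def)
        show "f y = f1 y" if "y \<in> {x \<in> M. \<alpha> x \<in> {1/2<..}}" for y
          using homot_agree[OF hf1, of y] that by (simp add: A'_def)
      qed
      moreover have "openin T {x \<in> M. \<alpha> x \<in> {1/2<..}}"
        by (rule openin_level[OF M(1) \<alpha>c]) simp
      ultimately show ?thesis
        using 1 by blast
    next
      case 2
      have "msmap {x \<in> M. c x \<in> {..<-1/2}} X f1"
      proof (rule msmap_cong[OF X_diff msmap_subset[OF g1]])
        show "{x \<in> M. c x \<in> {..<-1/2}} \<subseteq> B"
          by (auto simp: B_def)
        fix y assume y: "y \<in> {x \<in> M. c x \<in> {..<-1/2}}"
        then have "y \<in> B" "e y = 1"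
          by (auto simp: B_def e_def clamp01_simps)
        then show "g1 y = f1 y"
          using H1_1[of y 1] by (simp add: f1_def)
      qed
      moreover have "openin T {x \<in> M. c x \<in> {..<-1/2}}"
        by (rule openin_level[OF M(1) cc]) simp
      ultimately show ?thesis
        using 2 by blast
    qed
  qed
  \<comment> \<open>Exactly the walls are removed, so here the floor of \<rho> + 1/2 is locally
    constant.\<close>
  define E where "E = {x \<in> M. c x \<in> {-1<..}}"
  have E: "openin T E" "E \<subseteq> M"
    unfolding E_def by (rule openin_level[OF M(1) cc], simp) blast
  have E_ni: "\<rho> x + 1/2 \<notin> \<int>" if "x \<in> E" for x
  proof
    assume "\<rho> x + 1/2 \<in> \<int>"
    then have "cos (2 * pi * (\<rho> x + 1/2)) = 1"
      unfolding cos_one_2pi_int by (auto elim!: Ints_cases)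
    moreover have "cos (2 * pi * (\<rho> x + 1/2)) = - c x"
      by (simp add: c_def distrib_left)
    ultimately show False using that by (simp add: E_def)
  qed
  define fe where "fe x = nat \<lfloor>\<rho> x + 1/2\<rfloor> + 1" for x
  \<comment> \<open>The wall neighbourhood c \<le> -3/4 lies inside the open set c < -1/2 where
    \<open>f1\<close> is already smooth; keeping it fixed lets the second homotopy extend over the
    walls.\<close>
  define A2 where "A2 = E \<inter> (A \<union> {x \<in> M. c x \<in> {..(-3/4)}})"
  have \<rho>E: "continuous_map (subtopology T E) euclideanreal (\<lambda>x. \<rho> x + 1/2)"
    using continuous_map_from_subtopology_mono[OF \<rho> E(2)] by (intro continuous_map_add) auto
  obtain g2 H2 where g2: "msmap E X g2"
    and H2: "continuous_map (prod_topology (subtopology T E) euclideanreal) (D_topology X) H2"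
    and "\<And>x t. x \<in> E \<Longrightarrow> H2 (x, t) \<in> points (sk (fe x))"
    and H2_0: "\<And>x t. x \<in> E \<Longrightarrow> t \<le> 0 \<Longrightarrow> H2 (x, t) = f1 x"
    and H2_1: "\<And>x t. x \<in> E \<Longrightarrow> 1 \<le> t \<Longrightarrow> H2 (x, t) = g2 x"
    and H2_A: "\<And>x t. x \<in> A2 \<Longrightarrow> x \<in> E \<Longrightarrow> H2 (x, t) = f1 x"
  proof (rule smoothing_locally_finite_dimensional[of E A2 "O1 \<inter> E" f1 fe])
    show "closedin (subtopology T E) A2"
    proof -
      have "closedin (subtopology T M) (A \<union> {x \<in> M. c x \<in> {..(-3/4)}})"
        using A M(2) by (intro closedin_Un closedin_level[OF M(1) cc]) auto
      then have "closedin (subtopology (subtopology T M) E) A2"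
        unfolding A2_def by (auto simp: closedin_subtopology)
      then show ?thesis
        by (simp only: subtopology_subtopology Int_absorb1[OF E(2)])
    qed
    show "openin T {x \<in> E. fe x = k}" for k
      unfolding fe_def by (rule openin_floor_level[OF E(1) \<rho>E E_ni])
    show "continuous_map (subtopology T E) (D_topology X) f1"
      by (rule continuous_map_from_subtopology_mono[OF f1 E(2)])
    show "msmap (O1 \<inter> E) X f1"
      by (rule msmap_subset[OF f1s]) blast
    show "f1 x \<in> points (sk (fe x))" if "x \<in> E" for x
    proof -
      \<comment> \<open>The first homotopy never left the skeleton \<open>fl x\<close>, and shifting
        by 1/2 can only raise the floor, so the new dimension bound holds for
        \<open>f1\<close>.\<close>
      have "\<lfloor>\<rho> x\<rfloor> \<le> \<lfloor>\<rho> x + 1/2\<rfloor>"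
        by (intro floor_mono) simp
      then have "fl x \<le> fe x"
        unfolding fl_def fe_def by (simp add: nat_mono)
      then show ?thesis
        using f1sk[of x] points_sk_mono[of "fl x" "fe x"] E(2) that by blast
    qed
    have "A \<subseteq> O1"
      using \<alpha>(2) Om(2) OmM by (force simp: O1_def)
    then show "A2 \<subseteq> O1 \<inter> E"
      by (auto simp: A2_def O1_def)
  qed (use E O1 in \<open>auto intro: openin_Int\<close>)
  have "homot E (D_topology X) A2 f1 g2"
    by (rule homotI[OF H2]) (use H2_0 H2_1 H2_A in auto)
  then have "homot M (D_topology X) (M - (E - A2)) f1 (\<lambda>x. if x \<in> E then g2 x else f1 x)"
  proof (rule homot_extend[OF M(1) E f1])
    show "closedin (subtopology T M) {x \<in> M. c x \<in> {-3/4..}}"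
      by (rule closedin_level[OF M(1) cc]) simp
  qed (auto simp: E_def A2_def)
  then have "homot M (D_topology X) A f1 (\<lambda>x. if x \<in> E then g2 x else f1 x)"
    by (rule homot_subset) (use OmM Om(2) in \<open>auto simp: A2_def\<close>)
  then have "homot M (D_topology X) A f (\<lambda>x. if x \<in> E then g2 x else f1 x)"
    using homot_trans[OF M(1) homot_subset[OF hf1 A'(3)]] by blast
  moreover have "msmap M X (\<lambda>x. if x \<in> E then g2 x else f1 x)"
  proof (rule msmap_local[OF X_diff])
    fix x assume x: "x \<in> M"
    show "\<exists>W. openin T W \<and> x \<in> W \<and> msmap W X (\<lambda>x. if x \<in> E then g2 x else f1 x)"
    proof (cases "x \<in> E")
      case True
      have "msmap E X (\<lambda>x. if x \<in> E then g2 x else f1 x)"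
        by (rule msmap_cong[OF X_diff g2]) simp
      then show ?thesis using True E(1) by blast
    next
      case False
      \<comment> \<open>On this neighbourhood of the wall, \<open>g2\<close> equals
        \<open>f1\<close> by relativity to \<open>A2\<close>, so both branches give the smooth map
        \<open>f1\<close>.\<close>
      have "msmap {x \<in> M. c x \<in> {..<-3/4}} X (\<lambda>x. if x \<in> E then g2 x else f1 x)"
      proof (rule msmap_cong[OF X_diff msmap_subset[OF f1s]])
        show "{x \<in> M. c x \<in> {..<-3/4}} \<subseteq> O1"
          by (auto simp: O1_def)
        show "f1 y = (if y \<in> E then g2 y else f1 y)" if "y \<in> {x \<in> M. c x \<in> {..<-3/4}}" for y
          using H2_A[of y 1] H2_1[of y 1] that by (auto simp: A2_def)
      qed
      moreover have "x \<in> {x \<in> M. c x \<in> {..<-3/4}}"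
        using False x by (auto simp: E_def)
      moreover have "openin T {x \<in> M. c x \<in> {..<-3/4}}"
        by (rule openin_level[OF M(1) cc]) simp
      ultimately show ?thesis
        by blast
    qed
  qed
  ultimately show ?thesis
    unfolding M_def by blast
qed

text \<open>Continuity for the product topology gives continuity for the D-topology of M \<times>
  \<real>, because every product-open set pulls back to an open set along each plot.\<close>

lemma homot_continuous_homotopy:
  assumes f: "continuous_map T (D_topology X) f" and g: "msmap (topspace T) X g"
    and h: "homot (topspace T) (D_topology X) A f g" and A: "A \<subseteq> topspace T"
  shows "\<exists>H. continuous_homotopy \<M> X f g H \<and> homotopy_rel f H A"
proof -
  obtain H where H: "continuous_map (prod_topology (subtopology T (topspace T)) euclideanreal) (D_topology X) H"
    "\<And>x t. x \<in> topspace T \<Longrightarrow> t \<le> 0 \<Longrightarrow> H (x, t) = f x" "\<And>x t. x \<in> topspace T \<Longrightarrow> 1 \<le> t \<Longrightarrow> H (x, t) = g x"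
    "\<And>x t. x \<in> A \<Longrightarrow> x \<in> topspace T \<Longrightarrow> H (x, t) = f x"
    by (rule homotE[OF h]) blast
  let ?X = "prod_topology T euclideanreal"
  have Hc: "continuous_map ?X (D_topology X) H"
    using H(1) by simp
  \<comment> \<open>The change of time maps t \<le> 1/4 to nonpositive times and t \<ge> 3/4 to
    times at least 1, which gives \<epsilon> = 1/4.\<close>
  define K where "K p = H (fst p, 2 * snd p - 1/2)" for p
  have "continuous_map ?X ?X (\<lambda>p. (fst p, 2 * snd p - 1/2))"
    by (intro continuous_map_pairedI continuous_map_fst continuous_map_diff continuous_map_real_mult
        continuous_map_snd) auto
  from continuous_map_compose[OF this Hc] have K: "continuous_map ?X (D_topology X) K"
    by (simp add: o_def K_def[abs_def])
  have op: "openin (D_topology (prod_diff \<M> real_diff)) S" if S: "openin ?X S" for S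
    unfolding openin_D_topology D_open_def
  proof (intro conjI allI ballI)
    show "S \<subseteq> points (prod_diff \<M> real_diff)"
      using openin_subset[OF S] by (auto simp: prod_diff_def real_diff_def)
    fix n U P assume "P \<in> plots (prod_diff \<M> real_diff) n U"
    then have P: "fst \<circ> P \<in> plots \<M> n U" "smooth_fun n U (snd \<circ> P)"
      by (simp_all add: prod_diff_def)
    have U: "openin (Euclidean_space n) U"
      using plotD(1)[OF P(1)] .
    have "continuous_map (subtopology (Euclidean_space n) U) euclideanreal (snd \<circ> P)"
      using P(2) Ck_fun_continuous by (auto simp: smooth_fun_def)
    then have "continuous_map (subtopology (Euclidean_space n) U) ?X (\<lambda>x. (fst (P x), snd (P x)))"
      using plotD(2)[OF P(1)] by (intro continuous_map_pairedI) (simp_all add: o_def)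
    from openin_continuous_map_preimage[OF this S]
    have "openin (subtopology (Euclidean_space n) U) {x \<in> topspace (subtopology (Euclidean_space n) U). P x \<in> S}"
      by simp
    from openin_trans_full[OF this U]
    show "openin (Euclidean_space n) {x \<in> U. P x \<in> S}"
      using openin_subset[OF U] by (simp add: Int_absorb1)
  qed
  have tp: "topspace (D_topology (prod_diff \<M> real_diff)) = topspace ?X"
  proof (rule antisym)
    have "points (prod_diff \<M> real_diff) = topspace ?X"
      by (simp add: prod_diff_def real_diff_def)
    moreover have "topspace (D_topology (prod_diff \<M> real_diff)) \<subseteq> points (prod_diff \<M> real_diff)"
      using openin_topspace[of "D_topology (prod_diff \<M> real_diff)"]
      unfolding openin_D_topology D_open_def by (rule conjunct1)
    ultimately show "topspace (D_topology (prod_diff \<M> real_diff)) \<subseteq> topspace ?X"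
      by (simp only:)
    show "topspace ?X \<subseteq> topspace (D_topology (prod_diff \<M> real_diff))"
      by (rule openin_subset[OF op[OF openin_topspace]])
  qed
  have "D_continuous (prod_diff \<M> real_diff) X K"
    using K op unfolding D_continuous_def continuous_map_def tp by blast
  moreover have "D_continuous \<M> X f"
    using f by (simp add: D_continuous_def D_topology_manifold)
  moreover have "D_continuous \<M> X g"
    using msmap_continuous[OF openin_topspace X_diff g] by (simp add: D_continuous_def D_topology_manifold)
  moreover have "\<forall>x\<in>points \<M>. \<forall>t. (t \<le> 1/4 \<longrightarrow> K (x, t) = f x) \<and> (t \<ge> 1 - 1/4 \<longrightarrow> K (x, t) = g x)"
    using H(2,3) by (simp add: K_def)
  moreover have "homotopy_rel f K A"
    using H(4) A by (auto simp: homotopy_rel_def K_def)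
  ultimately show ?thesis
    unfolding continuous_homotopy_def
    by (intro exI[of _ K] conjI) (auto intro!: exI[of _ "1/4"])
qed

end

theorem theorem2p2:
  fixes m :: nat
    and T :: "'m topology"
    and \<A> :: "('m set \<times> ('m \<Rightarrow> nat \<Rightarrow> real)) set"
    and X :: "'x diffeology"
    and sk :: "nat \<Rightarrow> 'x diffeology"
    and J :: "nat \<Rightarrow> 'i set"
    and h :: "nat \<Rightarrow> 'i \<times> (nat \<Rightarrow> real) \<Rightarrow> 'x"
    and f :: "'m \<Rightarrow> 'x"
  assumes "smooth_manifold m T \<A>"
    and "smooth_CW X sk J h"
    and "D_continuous (manifold_diff m T \<A>) X f"
  shows "(\<exists>g H. smooth_map (manifold_diff m T \<A>) X g \<and>
                continuous_homotopy (manifold_diff m T \<A>) X f g H) \<and>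
         (\<forall>A. smooth_on_closed T (manifold_diff m T \<A>) X f A \<and>
              (compact_space T \<or> (\<exists>d. X = sk d)) \<longrightarrow>
              (\<exists>g H. smooth_map (manifold_diff m T \<A>) X g \<and>
                     continuous_homotopy (manifold_diff m T \<A>) X f g H \<and>
                     homotopy_rel f H A))"
proof -
  interpret CW_map m T \<A> X sk J h
    using assms(1,2) by (intro CW_map.intro manifold.intro smooth_CW_complex.intro)
  have f: "continuous_map T (D_topology X) f"
    using assms(3) by (simp add: D_continuous_def D_topology_manifold)
  have main: "\<exists>g H. smooth_map \<M> X g \<and> continuous_homotopy \<M> X f g H \<and> homotopy_rel f H A"
    if A: "closedin T A" and Om: "openin T Om" "A \<subseteq> Om" "msmap Om X f" for A Om
  proof -
    obtain g where g: "msmap (topspace T) X g" "homot (topspace T) (D_topology X) A f g"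
      using smoothing[OF f A Om] by blast
    have "smooth_map \<M> X g"
      unfolding smooth_map_def
    proof (intro conjI allI ballI)
      show "g \<in> points \<M> \<rightarrow> points X"
        using msmap_points[OF g(1)] by simp
      fix n U P assume P: "P \<in> plots \<M> n U"
      show "g \<circ> P \<in> plots X n U"
        using msmap_plot[OF g(1) P plotD(3)[OF P]] by (simp add: o_def)
    qed
    then show ?thesis
      using homot_continuous_homotopy[OF f g closedin_subset[OF A]] by blast
  qed
  \<comment> \<open>The assertion without a relative part is the case in which A and its
    neighbourhood are empty; only plots with empty domain have to be checked.\<close>
  have "msmap {} X f"
  proof (rule msmapI)
    fix n U P assume "P \<in> plots \<M> n U" "P \<in> U \<rightarrow> {}"
    then have "U = {}" by auto
    then show "(\<lambda>x. f (P x)) \<in> plots X n U"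
      using diffeological_space_local[OF X_diff, of "{}"] by blast
  qed simp
  then have "\<exists>g H. smooth_map \<M> X g \<and> continuous_homotopy \<M> X f g H"
    using main[of "{}" "{}"] by auto
  moreover have "\<exists>g H. smooth_map \<M> X g \<and> continuous_homotopy \<M> X f g H \<and> homotopy_rel f H A"
    if "smooth_on_closed T \<M> X f A" for A
    using that main unfolding smooth_on_closed_def msmap_def by blast
  ultimately show ?thesis
    by blast
qed

end
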